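(* Let $n\ge1$, $R'=\mathbb Q[x_1,x_2,x_3,x_4]$, $w=x_1^{n+1}+x_2^{n+1}-x_3^{n+1}-x_4^{n+1}$. Let $C(\Gamma_1)=W(x_1,x_2;x_3,x_4)$ be the factorization of a single wide edge, and let $$C(\Gamma)=W(x_1,x_2;x_5,x_6)\otimes_{\mathbb Q[x_5,x_6]}W(x_5,x_6;x_3,x_4)$$ be the factorization of the graph consisting of two wide edges joined by two oriented edges (marked $x_5,x_6$) that leave the second and enter the first, regarded as a graded $(R',w)$-factorization. Then there is an isomorphism in $\mathrm{hmf}_w$ $$C(\Gamma)\cong C(\Gamma_1)\{1\}\oplus C(\Gamma_1)\{-1\}.$$
   Context: **Graded factorizations.** Let $R$ be a polynomial ring over $\mathbb Q$ in finitely many variables of degree $2$, $w\in R$ homogeneous of degree $2(n+1)$. $\{m\}$ shifts the grading of a graded module up by $m$. A graded $(R,w)$-factorization is a pair of free graded $R$-modules $M^0,M^1$ (possibly of infinite rank) with $R$-linear maps $M^0\xrightarrow{d}M^1\xrightarrow{d}M^0$ of degree $n+1$, $d^2=w$. Morphisms are pairs of degree $0$ maps commuting with $d$; $f,g$ are homotopic if $f-g=hd+dh$ with $h^i:M^i\to N^{i-1}$ of degree $-n-1$. $H(M)$ is the cohomology of $M/\mathfrak mM$, $\mathfrak m$ the ideal generated by the variables. $\mathrm{hmf}_w$ is the category of graded $(R,w)$-factorizations with $\dim_{\mathbb Q}H(M)<\infty$ and morphisms up to homotopy. If $R\subset S$ and $w\in R$, an $(S,w)$-factorization is regarded as an $(R,w)$-factorization.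 Tensor products have $d(m\otimes m')=dm\otimes m'+(-1)^im\otimes dm'$, $m\in M^i$. For homogeneous $a,b$ with $\deg a+\deg b=2n+2$, $\{a,b\}$ is $R\xrightarrow{a}R\{n+1-\deg a\}\xrightarrow{b}R$; $\{(a_i),(b_i)\}=\bigotimes_i\{a_i,b_i\}$. **Wide edges.** Let $g$ be the polynomial with $g(x+y,xy)=x^{n+1}+y^{n+1}$. For a wide edge with outgoing marks $x_1,x_2$ and incoming marks $x_3,x_4$, $$W(x_1,x_2;x_3,x_4)=\{(u_1,u_2),(x_1+x_2-x_3-x_4,\;x_1x_2-x_3x_4)\}\{-1\}$$ over $\mathbb Q[x_1,x_2,x_3,x_4]$, where $u_1=\frac{g(x_1+x_2,x_1x_2)-g(x_3+x_4,x_1x_2)}{x_1+x_2-x_3-x_4}$, $u_2=\frac{g(x_3+x_4,x_1x_2)-g(x_3+x_4,x_3x_4)}{x_1x_2-x_3x_4}$. *)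

theory Defs
  imports
    Complex_Main
    "HOL-Library.Poly_Mapping"
    "HOL-Library.Z2"
    "HOL-Algebra.Module"
    "HOL-Algebra.Ideal"
    "HOL-Algebra.Generated_Groups"
begin

section \<open>Polynomial rings over the rationals\<close>

text \<open>A polynomial is a finitely supported function from monomials (exponent vectors) to
  coefficients. The ring \<open>\<rat>[x\<^sub>v : v \<in> V]\<close> is the subring of those polynomials in which only
  variables with index in \<open>V\<close> occur, so that inclusions such as
  \<open>\<rat>[x\<^sub>1,x\<^sub>2] \<subseteq> \<rat>[x\<^sub>1,x\<^sub>2,x\<^sub>3]\<close> are inclusions of carriers.\<close>

type_synonym rpoly = "(nat \<Rightarrow>\<^sub>0 nat) \<Rightarrow>\<^sub>0 rat"

definition Var :: "nat \<Rightarrow> rpoly" where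
  "Var v = Poly_Mapping.single (Poly_Mapping.single v 1) 1"

definition Const :: "rat \<Rightarrow> rpoly" where
  "Const c = Poly_Mapping.single 0 c"

definition poly_ring :: "nat set \<Rightarrow> rpoly ring" where
  "poly_ring V =
    \<lparr>carrier = {p. \<forall>t \<in> Poly_Mapping.keys p. Poly_Mapping.keys t \<subseteq> V},
     mult = (*), one = 1, zero = 0, add = (+)\<rparr>"

text \<open>Every variable has degree 2.\<close>

definition mono_deg :: "(nat \<Rightarrow>\<^sub>0 nat) \<Rightarrow> int" where
  "mono_deg t = 2 * int (\<Sum>v \<in> Poly_Mapping.keys t. Poly_Mapping.lookup t v)"

definition homogeneous :: "int \<Rightarrow> rpoly \<Rightarrow> bool" where
  "homogeneous k p \<longleftrightarrow> (\<forall>t \<in> Poly_Mapping.keys p. mono_deg t = k)"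

text \<open>The degree of a nonzero homogeneous polynomial.\<close>

definition poly_deg :: "rpoly \<Rightarrow> int" where
  "poly_deg p = Max (mono_deg ` Poly_Mapping.keys p)"

definition subst :: "(nat \<Rightarrow> rpoly) \<Rightarrow> rpoly \<Rightarrow> rpoly" where
  "subst \<sigma> p = (\<Sum>t \<in> Poly_Mapping.keys p. Const (Poly_Mapping.lookup p t) *
     (\<Prod>v \<in> Poly_Mapping.keys t. \<sigma> v ^ Poly_Mapping.lookup t v))"

text \<open>The quotient \<open>a / b\<close> of polynomials with \<open>b \<noteq> 0\<close> and \<open>b\<close> dividing \<open>a\<close>
  (unique because the polynomials form an integral domain).\<close>

definition exact_quot :: "rpoly \<Rightarrow> rpoly \<Rightarrow> rpoly" where
  "exact_quot a b = (THE q. q * b = a)"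


section \<open>Graded modules\<close>

text \<open>The ring of scalars is not part of the record, so restricting scalars from
  \<open>\<rat>[V']\<close> to \<open>\<rat>[V]\<close> with \<open>V \<subseteq> V'\<close> leaves the record unchanged. The fields \<open>mult\<close>
  and \<open>one\<close> inherited from \<^typ>\<open>('a, 'm) module\<close> play no role for modules.\<close>

record ('a, 'm) gmodule = "('a, 'm) module" +
  grade :: "int \<Rightarrow> 'm set"

type_synonym 'm pmodule = "(rpoly, 'm) gmodule"

definition graded_module :: "nat set \<Rightarrow> 'm pmodule \<Rightarrow> bool" where
  "graded_module V M \<longleftrightarrow>
     module (poly_ring V) M \<and>
     (\<forall>k. additive_subgroup (grade M k) M) \<and>
     (\<forall>x \<in> carrier M. \<exists>!c. (\<forall>k. c k \<in> grade M k) \<and> finite {k. c k \<noteq> \<zero>\<^bsub>M\<^esub>} \<and>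
        x = finsum M c {k. c k \<noteq> \<zero>\<^bsub>M\<^esub>}) \<and>
     (\<forall>j k. \<forall>p \<in> carrier (poly_ring V). \<forall>x \<in> grade M k.
        homogeneous j p \<longrightarrow> p \<odot>\<^bsub>M\<^esub> x \<in> grade M (j + k))"

text \<open>Free graded modules have a (possibly infinite) basis of homogeneous elements.\<close>

definition free_graded_module :: "nat set \<Rightarrow> 'm pmodule \<Rightarrow> bool" where
  "free_graded_module V M \<longleftrightarrow>
     graded_module V M \<and>
     (\<exists>B \<subseteq> (\<Union>k. grade M k). \<forall>x \<in> carrier M. \<exists>!c.
        (\<forall>b \<in> B. c b \<in> carrier (poly_ring V)) \<and> (\<forall>b. b \<notin> B \<longrightarrow> c b = 0) \<and>
        finite {b. c b \<noteq> 0} \<and> x = finsum M (\<lambda>b. c b \<odot>\<^bsub>M\<^esub> b) {b. c b \<noteq> 0})"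

definition graded_hom :: "nat set \<Rightarrow> int \<Rightarrow> 'm pmodule \<Rightarrow> 'n pmodule \<Rightarrow> ('m \<Rightarrow> 'n) set" where
  "graded_hom V d M N = {f. f \<in> carrier M \<rightarrow> carrier N \<and>
     (\<forall>x \<in> carrier M. \<forall>y \<in> carrier M. f (x \<oplus>\<^bsub>M\<^esub> y) = f x \<oplus>\<^bsub>N\<^esub> f y) \<and>
     (\<forall>p \<in> carrier (poly_ring V). \<forall>x \<in> carrier M. f (p \<odot>\<^bsub>M\<^esub> x) = p \<odot>\<^bsub>N\<^esub> f x) \<and>
     (\<forall>k. f ` grade M k \<subseteq> grade N (k + d))}"

definition poly_module :: "nat set \<Rightarrow> rpoly pmodule" where
  "poly_module V =
    \<lparr>carrier = carrier (poly_ring V), mult = (*), one = 1, zero = 0, add = (+), smult = (*),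
     grade = (\<lambda>k. {p \<in> carrier (poly_ring V). homogeneous k p})\<rparr>"

text \<open>\<open>M{m}\<close>, with \<open>M{m}\<^sub>k = M\<^sub>k\<^sub>-\<^sub>m\<close>: the grading is shifted up by \<open>m\<close>.\<close>

definition shift_module :: "int \<Rightarrow> 'm pmodule \<Rightarrow> 'm pmodule" where
  "shift_module m M = M\<lparr>grade := (\<lambda>k. grade M (k - m))\<rparr>"

definition sum_module :: "'m pmodule \<Rightarrow> 'n pmodule \<Rightarrow> ('m \<times> 'n) pmodule" where
  "sum_module M N =
    \<lparr>carrier = carrier M \<times> carrier N, mult = undefined, one = undefined,
     zero = (\<zero>\<^bsub>M\<^esub>, \<zero>\<^bsub>N\<^esub>),
     add = (\<lambda>(x, y) (x', y'). (x \<oplus>\<^bsub>M\<^esub> x', y \<oplus>\<^bsub>N\<^esub> y')),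
     smult = (\<lambda>p (x, y). (p \<odot>\<^bsub>M\<^esub> x, p \<odot>\<^bsub>N\<^esub> y)),
     grade = (\<lambda>k. grade M k \<times> grade N k)\<rparr>"

text \<open>The quotient \<open>M / H\<close> by a subgroup \<open>H\<close> that is stable under scalars; its elements are
  the cosets of \<open>H\<close>. The scalar multiplication sends \<open>x + H\<close> to \<open>p x + H = H + p (x + H)\<close>.\<close>

definition quot_module :: "'m pmodule \<Rightarrow> 'm set \<Rightarrow> 'm set pmodule" where
  "quot_module M H =
    \<lparr>carrier = a_rcosets\<^bsub>M\<^esub> H, mult = undefined, one = undefined,
     zero = H, add = set_add M,
     smult = (\<lambda>p X. set_add M H ((\<lambda>x. p \<odot>\<^bsub>M\<^esub> x) ` X)),
     grade = (\<lambda>k. (\<lambda>x. a_r_coset M H x) ` grade M k)\<rparr>"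

text \<open>The map \<open>x + H \<mapsto> f x + K\<close> into \<open>N / K\<close> induced by an additive \<open>f\<close> with \<open>f H \<subseteq> K\<close>.\<close>

definition quot_map :: "'n pmodule \<Rightarrow> 'n set \<Rightarrow> ('m \<Rightarrow> 'n) \<Rightarrow> 'm set \<Rightarrow> 'n set" where
  "quot_map N K f X = set_add N K (f ` X)"

definition sub_module :: "'m pmodule \<Rightarrow> 'm set \<Rightarrow> 'm pmodule" where
  "sub_module M Z = M\<lparr>carrier := Z, grade := (\<lambda>k. grade M k \<inter> Z)\<rparr>"

definition finite_dim :: "'m pmodule \<Rightarrow> bool" where
  "finite_dim M \<longleftrightarrow> (\<exists>S \<subseteq> carrier M. finite S \<and>
     (\<forall>x \<in> carrier M. \<exists>c :: 'm \<Rightarrow> rat. x = finsum M (\<lambda>s. Const (c s) \<odot>\<^bsub>M\<^esub> s) S))"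


section \<open>Tensor products\<close>

text \<open>Let \<open>M\<close> be a \<open>\<rat>[V\<^sub>1]\<close>-module and \<open>N\<close> a \<open>\<rat>[V\<^sub>2]\<close>-module. Their tensor product over
  \<open>\<rat>[V\<^sub>1 \<inter> V\<^sub>2]\<close> is the free abelian group on the pairs \<open>(x, y)\<close> modulo biadditivity and
  \<open>(r x, y) = (x, r y)\<close> for \<open>r \<in> \<rat>[V\<^sub>1 \<inter> V\<^sub>2]\<close>. It is a module over
  \<open>\<rat>[V\<^sub>1] \<otimes>\<^bsub>\<rat>[V\<^sub>1 \<inter> V\<^sub>2]\<^esub> \<rat>[V\<^sub>2] = \<rat>[V\<^sub>1 \<union> V\<^sub>2]\<close>: a monomial \<open>c t\<close> factors as \<open>(c t') t''\<close>,
  where \<open>t'\<close> contains the variables in \<open>V\<^sub>1\<close> and \<open>t''\<close> the others, and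
  \<open>c t (x \<otimes> y) = (c t' x) \<otimes> (t'' y)\<close>. For \<open>V\<^sub>1 = V\<^sub>2\<close> this is the tensor product of two
  modules over one ring, scalars acting through the first factor.\<close>

definition mono_part :: "nat set \<Rightarrow> (nat \<Rightarrow>\<^sub>0 nat) \<Rightarrow> (nat \<Rightarrow>\<^sub>0 nat)" where
  "mono_part V t =
    (\<Sum>v \<in> Poly_Mapping.keys t \<inter> V. Poly_Mapping.single v (Poly_Mapping.lookup t v))"

definition formal_smult ::
    "nat set \<Rightarrow> 'm pmodule \<Rightarrow> 'n pmodule \<Rightarrow> rpoly \<Rightarrow> ('m \<times> 'n \<Rightarrow>\<^sub>0 int) \<Rightarrow> ('m \<times> 'n \<Rightarrow>\<^sub>0 int)" where
  "formal_smult V1 M N p = frag_extend (\<lambda>(x, y). \<Sum>t \<in> Poly_Mapping.keys p. frag_of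
     (Poly_Mapping.single (mono_part V1 t) (Poly_Mapping.lookup p t) \<odot>\<^bsub>M\<^esub> x,
      Poly_Mapping.single (mono_part (- V1) t) 1 \<odot>\<^bsub>N\<^esub> y))"

text \<open>The free abelian group on pairs, with the operations that descend to the tensor product.
  Only its quotient is a module.\<close>

definition formal_pairs ::
    "nat set \<Rightarrow> 'm pmodule \<Rightarrow> 'n pmodule \<Rightarrow> ('m \<times> 'n \<Rightarrow>\<^sub>0 int) pmodule" where
  "formal_pairs V1 M N =
    \<lparr>carrier = {z. Poly_Mapping.keys z \<subseteq> carrier M \<times> carrier N},
     mult = undefined, one = undefined, zero = 0, add = (+),
     smult = formal_smult V1 M N,
     grade = (\<lambda>k. generate \<lparr>carrier = {z. Poly_Mapping.keys z \<subseteq> carrier M \<times> carrier N},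
         monoid.mult = (+), one = 0\<rparr>
       {frag_of (x, y) | x y. \<exists>i j. i + j = k \<and> x \<in> grade M i \<and> y \<in> grade N j})\<rparr>"

definition tensor_rel ::
    "nat set \<Rightarrow> nat set \<Rightarrow> 'm pmodule \<Rightarrow> 'n pmodule \<Rightarrow> ('m \<times> 'n \<Rightarrow>\<^sub>0 int) set" where
  "tensor_rel V1 V2 M N = generate (add_monoid (formal_pairs V1 M N))
     ({frag_of (x \<oplus>\<^bsub>M\<^esub> x', y) - frag_of (x, y) - frag_of (x', y) | x x' y.
         x \<in> carrier M \<and> x' \<in> carrier M \<and> y \<in> carrier N} \<union>
      {frag_of (x, y \<oplus>\<^bsub>N\<^esub> y') - frag_of (x, y) - frag_of (x, y') | x y y'.
         x \<in> carrier M \<and> y \<in> carrier N \<and> y' \<in> carrier N} \<union>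
      {frag_of (r \<odot>\<^bsub>M\<^esub> x, y) - frag_of (x, r \<odot>\<^bsub>N\<^esub> y) | r x y.
         r \<in> carrier (poly_ring (V1 \<inter> V2)) \<and> x \<in> carrier M \<and> y \<in> carrier N})"

definition tensor_module ::
    "nat set \<Rightarrow> nat set \<Rightarrow> 'm pmodule \<Rightarrow> 'n pmodule \<Rightarrow> ('m \<times> 'n \<Rightarrow>\<^sub>0 int) set pmodule" where
  "tensor_module V1 V2 M N = quot_module (formal_pairs V1 M N) (tensor_rel V1 V2 M N)"

text \<open>\<open>f \<otimes> g\<close>, with values in the tensor product of \<open>M'\<close> and \<open>N'\<close>.\<close>

definition tensor_map ::
    "nat set \<Rightarrow> nat set \<Rightarrow> 'p pmodule \<Rightarrow> 'q pmodule \<Rightarrow> ('m \<Rightarrow> 'p) \<Rightarrow> ('n \<Rightarrow> 'q) \<Rightarrow>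
     ('m \<times> 'n \<Rightarrow>\<^sub>0 int) set \<Rightarrow> ('p \<times> 'q \<Rightarrow>\<^sub>0 int) set" where
  "tensor_map V1 V2 M' N' f g =
     quot_map (formal_pairs V1 M' N') (tensor_rel V1 V2 M' N')
       (frag_extend (\<lambda>(x, y). frag_of (f x, g y)))"


section \<open>Graded factorizations\<close>

text \<open>The indices \<open>0, 1\<close> of \<open>M\<^sup>0, M\<^sup>1\<close> are elements of \<^typ>\<open>bit\<close>, the integers modulo 2.\<close>

record 'm factorization =
  fmod :: "bit \<Rightarrow> 'm pmodule"
  fdiff :: "bit \<Rightarrow> 'm \<Rightarrow> 'm"

definition graded_factorization :: "nat \<Rightarrow> nat set \<Rightarrow> rpoly \<Rightarrow> 'm factorization \<Rightarrow> bool" where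
  "graded_factorization n V w M \<longleftrightarrow>
     finite V \<and> w \<in> carrier (poly_ring V) \<and> homogeneous (2 * (int n + 1)) w \<and>
     (\<forall>i. free_graded_module V (fmod M i) \<and>
        fdiff M i \<in> graded_hom V (int n + 1) (fmod M i) (fmod M (i + 1)) \<and>
        (\<forall>x \<in> carrier (fmod M i). fdiff M (i + 1) (fdiff M i x) = w \<odot>\<^bsub>fmod M i\<^esub> x))"

definition fact_hom ::
    "nat set \<Rightarrow> 'm factorization \<Rightarrow> 'n factorization \<Rightarrow> (bit \<Rightarrow> 'm \<Rightarrow> 'n) set" where
  "fact_hom V M N = {f. \<forall>i. f i \<in> graded_hom V 0 (fmod M i) (fmod N i) \<and>
     (\<forall>x \<in> carrier (fmod M i). f (i + 1) (fdiff M i x) = fdiff N i (f i x))}"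

definition homotopic ::
    "nat \<Rightarrow> nat set \<Rightarrow> 'm factorization \<Rightarrow> 'n factorization \<Rightarrow>
     (bit \<Rightarrow> 'm \<Rightarrow> 'n) \<Rightarrow> (bit \<Rightarrow> 'm \<Rightarrow> 'n) \<Rightarrow> bool" where
  "homotopic n V M N f g \<longleftrightarrow>
     (\<exists>h. \<forall>i. h i \<in> graded_hom V (- int n - 1) (fmod M i) (fmod N (i - 1)) \<and>
        (\<forall>x \<in> carrier (fmod M i).
           f i x \<ominus>\<^bsub>fmod N i\<^esub> g i x =
           h (i + 1) (fdiff M i x) \<oplus>\<^bsub>fmod N i\<^esub> fdiff N (i - 1) (h i x)))"

text \<open>\<open>\<mm>M\<close>, where \<open>\<mm>\<close> is the ideal of \<open>\<rat>[V]\<close> generated by the variables, and the cohomology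
  of \<open>M / \<mm>M\<close> with its induced differential.\<close>

definition max_mult :: "nat set \<Rightarrow> 'm pmodule \<Rightarrow> 'm set" where
  "max_mult V M = generate (add_monoid M)
     {p \<odot>\<^bsub>M\<^esub> x | p x. p \<in> genideal (poly_ring V) (Var ` V) \<and> x \<in> carrier M}"

definition red_module :: "nat set \<Rightarrow> 'm factorization \<Rightarrow> bit \<Rightarrow> 'm set pmodule" where
  "red_module V M i = quot_module (fmod M i) (max_mult V (fmod M i))"

definition red_diff :: "nat set \<Rightarrow> 'm factorization \<Rightarrow> bit \<Rightarrow> 'm set \<Rightarrow> 'm set" where
  "red_diff V M i = quot_map (fmod M (i + 1)) (max_mult V (fmod M (i + 1))) (fdiff M i)"

definition cohomology :: "nat set \<Rightarrow> 'm factorization \<Rightarrow> bit \<Rightarrow> 'm set set pmodule" where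
  "cohomology V M i = quot_module
     (sub_module (red_module V M i)
        (a_kernel (red_module V M i) (red_module V M (i + 1)) (red_diff V M i)))
     (red_diff V M (i - 1) ` carrier (red_module V M (i - 1)))"

definition hmf_object :: "nat \<Rightarrow> nat set \<Rightarrow> rpoly \<Rightarrow> 'm factorization \<Rightarrow> bool" where
  "hmf_object n V w M \<longleftrightarrow>
     graded_factorization n V w M \<and> (\<forall>i. finite_dim (cohomology V M i))"

definition hmf_isomorphic ::
    "nat \<Rightarrow> nat set \<Rightarrow> rpoly \<Rightarrow> 'm factorization \<Rightarrow> 'n factorization \<Rightarrow> bool" where
  "hmf_isomorphic n V w M N \<longleftrightarrow>
     hmf_object n V w M \<and> hmf_object n V w N \<and>
     (\<exists>f \<in> fact_hom V M N. \<exists>g \<in> fact_hom V N M.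
        homotopic n V M M (\<lambda>i. g i \<circ> f i) (\<lambda>i. id) \<and>
        homotopic n V N N (\<lambda>i. f i \<circ> g i) (\<lambda>i. id))"

definition shift_fact :: "int \<Rightarrow> 'm factorization \<Rightarrow> 'm factorization" where
  "shift_fact m M = \<lparr>fmod = (\<lambda>i. shift_module m (fmod M i)), fdiff = fdiff M\<rparr>"

definition sum_fact ::
    "'m factorization \<Rightarrow> 'n factorization \<Rightarrow> ('m \<times> 'n) factorization" where
  "sum_fact M N =
    \<lparr>fmod = (\<lambda>i. sum_module (fmod M i) (fmod N i)),
     fdiff = (\<lambda>i (x, y). (fdiff M i x, fdiff N i y))\<rparr>"

text \<open>Tensor product over \<open>\<rat>[V\<^sub>1 \<inter> V\<^sub>2]\<close>: its part of index \<open>k\<close> is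
  \<open>(M\<^sup>0 \<otimes> N\<^sup>k) \<oplus> (M\<^sup>1 \<otimes> N\<^sup>k\<^sup>+\<^sup>1)\<close>, and
  \<open>d (x \<otimes> y) = d x \<otimes> y + (-1)\<^sup>i x \<otimes> d y\<close> for \<open>x \<in> M\<^sup>i\<close>.\<close>

definition tensor_fact ::
    "nat set \<Rightarrow> nat set \<Rightarrow> 'm factorization \<Rightarrow> 'n factorization \<Rightarrow>
     (('m \<times> 'n \<Rightarrow>\<^sub>0 int) set \<times> ('m \<times> 'n \<Rightarrow>\<^sub>0 int) set) factorization" where
  "tensor_fact V1 V2 M N =
    (let T = (\<lambda>i j. tensor_module V1 V2 (fmod M i) (fmod N j));
         dl = (\<lambda>i j. tensor_map V1 V2 (fmod M (i + 1)) (fmod N j) (fdiff M i) id);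
         dr = (\<lambda>i j. tensor_map V1 V2 (fmod M i) (fmod N (j + 1)) id (fdiff N j))
     in \<lparr>fmod = (\<lambda>k. sum_module (T 0 k) (T 1 (k + 1))),
         fdiff = (\<lambda>k (x, y).
           (dl 1 (k + 1) y \<oplus>\<^bsub>T 0 (k + 1)\<^esub> dr 0 k x,
            dl 0 k x \<ominus>\<^bsub>T 1 k\<^esub> dr 1 (k + 1) y))\<rparr>)"

text \<open>\<open>{a, b}\<close>, that is \<open>R \<midarrow>a\<rightarrow> R{n + 1 - deg a} \<midarrow>b\<rightarrow> R\<close> for \<open>R = \<rat>[V]\<close>.\<close>

definition koszul :: "nat \<Rightarrow> nat set \<Rightarrow> rpoly \<Rightarrow> rpoly \<Rightarrow> rpoly factorization" where
  "koszul n V a b =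
    \<lparr>fmod = (\<lambda>i. if i = 0 then poly_module V
                 else shift_module (int n + 1 - poly_deg a) (poly_module V)),
     fdiff = (\<lambda>i. if i = 0 then (*) a else (*) b)\<rparr>"


section \<open>Wide edges\<close>

definition power_sum_poly :: "nat \<Rightarrow> rpoly" where
  "power_sum_poly n = (THE g. g \<in> carrier (poly_ring {0, 1}) \<and>
     subst (\<lambda>v. if v = 0 then Var 0 + Var 1 else Var 0 * Var 1) g =
       Var 0 ^ (n + 1) + Var 1 ^ (n + 1))"

text \<open>\<open>g(a, b)\<close>\<close>

definition gpoly :: "nat \<Rightarrow> rpoly \<Rightarrow> rpoly \<Rightarrow> rpoly" where
  "gpoly n a b = subst (\<lambda>v. if v = 0 then a else b) (power_sum_poly n)"

text \<open>\<open>W(x\<^sub>i, x\<^sub>j; x\<^sub>k, x\<^sub>l)\<close> over \<open>\<rat>[x\<^sub>i, x\<^sub>j, x\<^sub>k, x\<^sub>l]\<close>.\<close>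

definition wide_edge :: "nat \<Rightarrow> nat \<Rightarrow> nat \<Rightarrow> nat \<Rightarrow> nat \<Rightarrow>
    ((rpoly \<times> rpoly \<Rightarrow>\<^sub>0 int) set \<times> (rpoly \<times> rpoly \<Rightarrow>\<^sub>0 int) set) factorization" where
  "wide_edge n i j k l =
    (let V = {i, j, k, l};
         s = Var i + Var j; p = Var i * Var j;
         s' = Var k + Var l; p' = Var k * Var l;
         u1 = exact_quot (gpoly n s p - gpoly n s' p) (s - s');
         u2 = exact_quot (gpoly n s' p - gpoly n s' p') (p - p')
     in shift_fact (- 1)
          (tensor_fact V V (koszul n V u1 (s - s')) (koszul n V u2 (p - p'))))"

end

theory Submission
  imports Defs
begin

text \<open>
  After the two wide edges are joined, the factorization is a Koszul factorization with four rows
  over \<open>\<rat>[x\<^sub>1,\<dots>,x\<^sub>6]\<close>. A row \<open>{a, b}\<close> over a ring \<open>S\<close> can be eliminated over a smaller ring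
  \<open>R'\<close> as soon as division by \<open>b\<close> with remainder, \<open>x = \<rho> x + b \<delta> x\<close>, is available \<open>R'\<close>-linearly: the
  factorization retracts by an explicit homotopy onto the one given by the other rows on the remainders.
  The first row has \<open>b = x\<^sub>1 + x\<^sub>2 - x\<^sub>5 - x\<^sub>6\<close> and eliminates \<open>x\<^sub>6\<close>; after that the second row
  has \<open>b = (x\<^sub>5 - x\<^sub>1)(x\<^sub>5 - x\<^sub>2)\<close>, whose remainders are \<open>R' \<oplus> (x\<^sub>5 - x\<^sub>1) R'\<close> with
  \<open>R' = \<rat>[x\<^sub>1,\<dots>,x\<^sub>4]\<close>. The other two rows involve \<open>x\<^sub>5, x\<^sub>6\<close> only through \<open>x\<^sub>5 + x\<^sub>6\<close> and
  \<open>x\<^sub>5 x\<^sub>6\<close>, which have become \<open>x\<^sub>1 + x\<^sub>2\<close> and \<open>x\<^sub>1 x\<^sub>2\<close>, so what is left is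
  \<open>C(\<Gamma>\<^sub>1){-1} \<oplus> C(\<Gamma>\<^sub>1){1}\<close>, generated by \<open>1\<close> and \<open>x\<^sub>5 - x\<^sub>1\<close>.

  All modules are free with a finite homogeneous basis over some \<open>\<rat>[V]\<close>, so each is described by
  coordinate functions, and the maps above become operators on tuples of polynomials.
\<close>

section \<open>Polynomial rings\<close>

text \<open>Over \<open>\<rat>[x1,...,x4]\<close> the modules of \<open>C(\<Gamma>)\<close> have
  infinite rank, those of the right-hand side finite rank. Hence the equivalence holds only up to
  homotopy, and membership of \<open>C(\<Gamma>)\<close> in the category is part of the claim: its
  finite-dimensional cohomology is transported from the small side along the equivalence. Tensor
  products are cosets of formal sums of pairs, so their freeness has to be proved before anything
  can be computed.

  In an elimination the remaining differential \<open>D\<close> need not preserve remainders, and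
  its square is \<open>w - a b\<close> instead of \<open>w\<close>. The embedding of the remainders
  therefore gets a correction in the odd component of the row; it is compatible with the
  differentials because \<open>\<delta>\<close> commutes with \<open>w\<close>, which is free of
  \<open>x5\<close> and \<open>x6\<close>. For \<open>x5\<close> it then suffices that the other
  entries take equal values at \<open>x5 = x1\<close> and \<open>x5 = x2\<close>: such elements act
  as scalars on the remainders.

  The shifts: two wide edges carry two normalizing shifts \<open>{-1}\<close>, one wide edge a
  single one. The surplus is seen at the generator \<open>1\<close>, and \<open>x5 - x1\<close>, of
  degree 2, raises it to \<open>{1}\<close>.\<close>

abbreviation "keys \<equiv> Poly_Mapping.keys"
abbreviation "lookup \<equiv> Poly_Mapping.lookup"
abbreviation "single \<equiv> Poly_Mapping.single"

lemma keys_uminus [simp]: "keys (- p) = keys (p :: 'a \<Rightarrow>\<^sub>0 'b::ab_group_add)"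
  by (transfer) simp

section \<open>The subrings \<open>\<rat>[V]\<close> and induction on polynomials\<close>

abbreviation P :: "nat set \<Rightarrow> rpoly set" where
  "P V \<equiv> carrier (poly_ring V)"

lemma poly_ring_simps [simp]:
  "mult (poly_ring V) = (*)" "one (poly_ring V) = 1"
  "zero (poly_ring V) = 0" "add (poly_ring V) = (+)"
  by (auto simp: poly_ring_def)

lemma P_iff: "p \<in> P V \<longleftrightarrow> (\<forall>t \<in> keys p. keys t \<subseteq> V)"
  by (simp add: poly_ring_def)

lemma P_mono: "V \<subseteq> U \<Longrightarrow> p \<in> P V \<Longrightarrow> p \<in> P U"
  by (auto simp: P_iff)

lemma P_zero [simp]: "0 \<in> P V"
  by (simp add: P_iff)

lemma P_single: "keys t \<subseteq> V \<Longrightarrow> single t c \<in> P V"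
  by (auto simp: P_iff)

lemma P_Const [simp]: "Const c \<in> P V"
  by (simp add: Const_def P_single)

lemma P_one [simp]: "1 \<in> P V"
  by (simp add: P_iff)

lemma P_Var [simp]: "Var v \<in> P V \<longleftrightarrow> v \<in> V"
  by (auto simp: Var_def P_iff)

lemma P_add [simp]: "p \<in> P V \<Longrightarrow> q \<in> P V \<Longrightarrow> p + q \<in> P V"
  unfolding P_iff using keys_add[of p q] by blast

lemma P_uminus [simp]: "- p \<in> P V \<longleftrightarrow> p \<in> P V"
  by (simp add: P_iff)

lemma P_diff [simp]: "p \<in> P V \<Longrightarrow> q \<in> P V \<Longrightarrow> p - q \<in> P V"
  using P_add[of p V "- q"] by simp

lemma P_mult [simp]: "p \<in> P V \<Longrightarrow> q \<in> P V \<Longrightarrow> p * q \<in> P V"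
  unfolding P_iff
proof
  assume pq: "\<forall>t\<in>keys p. keys t \<subseteq> V"
    "\<forall>t\<in>keys q. keys t \<subseteq> V"
  fix t assume "t \<in> keys (p * q)"
  then obtain a b where "a \<in> keys p" "b \<in> keys q" "t = a + b"
    using keys_mult[of p q] by auto
  then show "keys t \<subseteq> V"
    using keys_add[of a b] pq by blast
qed

lemma P_sum: "(\<And>i. i \<in> A \<Longrightarrow> f i \<in> P V) \<Longrightarrow> sum f A \<in> P V"
  by (induction A rule: infinite_finite_induct) auto

lemma cring_poly_ring: "cring (poly_ring V)"
proof (rule cringI)
  show "abelian_group (poly_ring V)"
  proof (rule abelian_groupI)
    fix p assume "p \<in> P V"
    then show "\<exists>y\<in>P V. y \<oplus>\<^bsub>poly_ring V\<^esub> p = \<zero>\<^bsub>poly_ring V\<^esub>"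
      by (intro bexI[of _ "- p"]) auto
  qed (auto simp: ac_simps)
  show "comm_monoid (poly_ring V)"
    by (rule comm_monoidI) (auto simp: ac_simps)
qed (auto simp: algebra_simps)

lemma sum_monomials:
  "(\<Sum>t \<in> keys p. single t (lookup p t)) = p"
  by (rule poly_mapping_eqI)
    (auto simp: lookup_sum lookup_single when_def in_keys_iff)

text \<open>A polynomial is the finite sum of its own monomials, so additive statements reduce to
  monomials whose variables lie in \<open>V\<close>.\<close>

lemma sum_monomials_induct [consumes 1, case_names monomial zero add]:
  assumes "p \<in> P V"
    and "\<And>t c. keys t \<subseteq> V \<Longrightarrow> Q (single t c)"
    and "Q 0" and "\<And>p q. Q p \<Longrightarrow> Q q \<Longrightarrow> Q (p + q)"
  shows "Q p"
proof -
  have "Q (\<Sum>t \<in> A. single t (lookup p t))"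
    if "finite A" "A \<subseteq> keys p" for A
    using that by (induction A) (use assms in \<open>auto simp: P_iff\<close>)
  from this[of "keys p"] show ?thesis
    by (simp add: sum_monomials)
qed

lemma P_UNIV [simp]: "p \<in> P UNIV"
  by (simp add: P_iff)

text \<open>Peeling off one variable lowers the total degree; since supports are finite, this ends
  at the exponent \<open>0\<close>.\<close>

lemma exponent_induct [consumes 1, case_names zero add]:
  fixes t :: "nat \<Rightarrow>\<^sub>0 nat"
  assumes "keys t \<subseteq> V" "Q 0"
    and "\<And>v t. v \<in> V \<Longrightarrow> keys t \<subseteq> V \<Longrightarrow> Q t \<Longrightarrow> Q (single v 1 + t)"
  shows "Q t"
  using assms(1)
proof (induction "\<Sum>v \<in> keys t. lookup t v" arbitrary: t rule: less_induct)
  case less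
  show ?case
  proof (cases "t = 0")
    case False
    then obtain v where v: "v \<in> keys t" by fastforce
    define u where "u = t - single v 1"
    have t: "t = single v 1 + u"
      using v by (intro poly_mapping_eqI)
        (auto simp: u_def lookup_add lookup_minus lookup_single when_def in_keys_iff)
    have sub: "keys u \<subseteq> keys t"
      by (auto simp: t in_keys_iff lookup_add)
    have "(\<Sum>v \<in> keys t. lookup t v)
        = (\<Sum>w \<in> keys t. (if w = v then 1 else 0) + lookup u w)"
      by (intro sum.cong) (auto simp: t lookup_add lookup_single when_def)
    also have "\<dots> = 1 + (\<Sum>w \<in> keys t. lookup u w)"
      using v by (simp add: sum.distrib)
    also have "(\<Sum>w \<in> keys t. lookup u w)
        = (\<Sum>w \<in> keys u. lookup u w)"
      using sub by (intro sum.mono_neutral_right) (auto simp: in_keys_iff)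
    finally have "Q u"
      using less.prems sub by (intro less.hyps) auto
    then show ?thesis
      unfolding t using v less.prems sub by (intro assms(3)) auto
  qed (simp add: assms)
qed

lemma single_Var: "single (single v 1 + t) c = Var v * single t c"
  by (simp add: Var_def mult_single)

lemma Const_simps: "Const 0 = 0" "Const 1 = 1" "Const (a + b) = Const a + Const b"
  "Const (a * b) = Const a * Const b" "Const (- a) = - Const a" "Const (a - b) = Const a - Const b"
  by (simp_all add: Const_def single_add mult_single single_uminus single_diff)

text \<open>Constants and variables generate \<open>\<rat>[V]\<close> as a ring. Identities between
  ring homomorphisms, in particular between substitutions, are checked on these generators.\<close>

lemma P_induct [consumes 1, case_names Const Var add mult]:
  assumes "p \<in> P V"
    and C: "\<And>c. Q (Const c)" and X: "\<And>v. v \<in> V \<Longrightarrow> Q (Var v)"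
    and add: "\<And>p q. Q p \<Longrightarrow> Q q \<Longrightarrow> Q (p + q)" and mult: "\<And>p q. Q p \<Longrightarrow> Q q \<Longrightarrow> Q (p * q)"
  shows "Q p"
  using assms(1)
proof (induction rule: sum_monomials_induct)
  case (monomial t c)
  from monomial show ?case
  proof (induction t arbitrary: c rule: exponent_induct)
    case zero
    then show ?case using C by (simp add: Const_def)
  next
    case (add v t)
    then show ?case by (metis single_Var X mult)
  qed
qed (use assms C[of 0] in \<open>auto simp: Const_simps\<close>)

section \<open>The grading by degree\<close>

lemma mono_deg_add: "mono_deg (s + t) = mono_deg s + mono_deg t"
proof -
  have *: "(\<Sum>v \<in> keys u. lookup u v) =
      (\<Sum>v \<in> A. lookup u v)"
    if "finite A" "keys u \<subseteq> A" for A and u :: "nat \<Rightarrow>\<^sub>0 nat"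
    using that by (intro sum.mono_neutral_left) (auto simp: in_keys_iff)
  let ?A = "keys s \<union> keys t"
  have "(\<Sum>v \<in> keys (s + t). lookup (s + t) v)
      = (\<Sum>v \<in> ?A. lookup (s + t) v)"
    using keys_add[of s t] by (intro *) auto
  also have "\<dots> = (\<Sum>v \<in> ?A. lookup s v) + (\<Sum>v \<in> ?A. lookup t v)"
    by (simp add: lookup_add sum.distrib)
  also have "\<dots> = (\<Sum>v \<in> keys s. lookup s v)
      + (\<Sum>v \<in> keys t. lookup t v)"
    by (rule arg_cong2[where f = "(+)"]; rule *[symmetric]; simp)
  finally show ?thesis
    by (simp add: mono_deg_def)
qed

lemma mono_deg_zero [simp]: "mono_deg 0 = 0"
  by (simp add: mono_deg_def)

lemma homogeneous_zero [simp]: "homogeneous k 0"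
  by (simp add: homogeneous_def)

lemma homogeneous_add: "homogeneous k p \<Longrightarrow> homogeneous k q \<Longrightarrow> homogeneous k (p + q)"
  unfolding homogeneous_def using keys_add[of p q] by blast

lemma homogeneous_uminus [simp]: "homogeneous k (- p) \<longleftrightarrow> homogeneous k p"
  by (simp add: homogeneous_def)

lemma homogeneous_diff: "homogeneous k p \<Longrightarrow> homogeneous k q \<Longrightarrow> homogeneous k (p - q)"
  using homogeneous_add[of k p "- q"] by simp

lemma homogeneous_mult:
  assumes "homogeneous j p" "homogeneous k q"
  shows "homogeneous (j + k) (p * q)"
  unfolding homogeneous_def
proof
  fix t assume "t \<in> keys (p * q)"
  then obtain a b where "a \<in> keys p" "b \<in> keys q" "t = a + b"
    using keys_mult[of p q] by auto
  then show "mono_deg t = j + k"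
    using assms by (simp add: homogeneous_def mono_deg_add)
qed

lemma homogeneous_mult':
  "homogeneous j p \<Longrightarrow> homogeneous k q \<Longrightarrow> l = j + k \<Longrightarrow> homogeneous l (p * q)"
  by (simp add: homogeneous_mult)

lemma homogeneous_sum: "(\<And>i. i \<in> A \<Longrightarrow> homogeneous k (f i)) \<Longrightarrow> homogeneous k (sum f A)"
  by (induction A rule: infinite_finite_induct) (auto simp: homogeneous_add)

lemma homogeneous_single: "homogeneous (mono_deg t) (single t c)"
  by (auto simp: homogeneous_def)

lemma homogeneous_Const [simp]: "homogeneous 0 (Const c)"
  using homogeneous_single[of 0 c] by (simp add: Const_def)

lemma homogeneous_one [simp]: "homogeneous 0 1"
  using homogeneous_Const[of 1] by (simp add: Const_simps)

lemma mono_deg_single [simp]: "mono_deg (single v m) = 2 * int m"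
  by (simp add: mono_deg_def)

lemma homogeneous_Var [simp]: "homogeneous 2 (Var v)"
  using homogeneous_single[of "single v 1" 1] by (simp add: Var_def)

text \<open>For a nonzero homogeneous polynomial the maximum in \<open>poly_deg\<close> is taken
  over a singleton. The shifts inside Koszul factorizations are determined in this way.\<close>

lemma poly_deg_homogeneous:
  assumes "homogeneous k p" "p \<noteq> 0"
  shows "poly_deg p = k"
proof -
  have "mono_deg ` keys p = {k}"
    using assms by (force simp: homogeneous_def image_iff simp flip: keys_eq_empty)
  then show ?thesis by (simp add: poly_deg_def)
qed

section \<open>Substitution\<close>

lemma subst_superset:
  assumes "finite A" "keys p \<subseteq> A"
  shows "subst \<sigma> p = (\<Sum>t \<in> A. Const (lookup p t) *
     (\<Prod>v \<in> keys t. \<sigma> v ^ lookup t v))"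
  unfolding subst_def using assms
  by (intro sum.mono_neutral_left) (auto simp: in_keys_iff Const_simps)

text \<open>All three sums are taken over the union of the supports of \<open>p\<close> and
  \<open>q\<close>; monomials that cancel in \<open>p + q\<close> contribute
  \<open>0\<close>.\<close>

lemma subst_add: "subst \<sigma> (p + q) = subst \<sigma> p + subst \<sigma> q"
proof -
  let ?A = "keys p \<union> keys q"
  show ?thesis
    using keys_add[of p q]
    by (simp add: subst_superset[of ?A] lookup_add Const_simps algebra_simps sum.distrib)
qed

lemma subst_zero [simp]: "subst \<sigma> 0 = 0"
  by (simp add: subst_def)

lemma subst_single:
  "subst \<sigma> (single t c) =
     Const c * (\<Prod>v \<in> keys t. \<sigma> v ^ lookup t v)"
  by (cases "c = 0") (auto simp: subst_def Const_simps)

text \<open>For one monomial on each side the claim is additivity of exponents; both factors are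
  then built up from monomials.\<close>

lemma subst_mult: "subst \<sigma> (p * q) = subst \<sigma> p * subst \<sigma> q"
proof -
  let ?m = "\<lambda>t. \<Prod>v \<in> keys t. \<sigma> v ^ lookup t v"
  have *: "?m t = (\<Prod>v \<in> A. \<sigma> v ^ lookup t v)"
    if "finite A" "keys t \<subseteq> A" for A t
    using that by (intro prod.mono_neutral_left) (auto simp: in_keys_iff)
  have m: "?m (s + t) = ?m s * ?m t" for s t
  proof -
    let ?A = "keys s \<union> keys t"
    have "?m (s + t) = (\<Prod>v \<in> ?A. \<sigma> v ^ lookup (s + t) v)"
      using keys_add[of s t] by (intro *) auto
    also have "\<dots> = (\<Prod>v \<in> ?A. \<sigma> v ^ lookup s v) * (\<Prod>v \<in> ?A. \<sigma> v ^ lookup t v)"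
      by (simp add: lookup_add power_add prod.distrib)
    also have "\<dots> = ?m s * ?m t"
      by (rule arg_cong2[where f = "(*)"]; rule *[symmetric]; simp)
    finally show ?thesis .
  qed
  have 1: "subst \<sigma> (single s c * q) = subst \<sigma> (single s c) * subst \<sigma> q" for s c
    using P_UNIV[of q]
    by (induction rule: sum_monomials_induct)
      (auto simp: mult_single subst_single m Const_simps algebra_simps subst_add)
  show ?thesis
    using P_UNIV[of p]
    by (induction rule: sum_monomials_induct) (auto simp: 1 ring_distribs subst_add)
qed

lemma subst_Const [simp]: "subst \<sigma> (Const c) = Const c"
  by (simp add: Const_def subst_single)

lemma subst_one [simp]: "subst \<sigma> 1 = 1"
  using subst_Const[of \<sigma> 1] by (simp add: Const_simps del: subst_Const)

lemma subst_Var [simp]: "subst \<sigma> (Var v) = \<sigma> v"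
  by (simp add: Var_def subst_single Const_simps)

lemma subst_uminus: "subst \<sigma> (- p) = - subst \<sigma> p"
  using subst_add[of \<sigma> p "- p"] by (simp add: eq_neg_iff_add_eq_0 add.commute)

lemma subst_diff: "subst \<sigma> (p - q) = subst \<sigma> p - subst \<sigma> q"
  using subst_add[of \<sigma> p "- q"] by (simp add: subst_uminus)

lemma subst_power: "subst \<sigma> (p ^ m) = subst \<sigma> p ^ m"
  by (induction m) (auto simp: subst_mult)

lemma subst_numeral [simp]: "subst \<sigma> (numeral m) = numeral m"
proof -
  have "Const (numeral m) = numeral m"
    by (simp add: Const_def)
  then show ?thesis using subst_Const by metis
qed

lemmas subst_simps = subst_add subst_mult subst_uminus subst_diff subst_power

lemma subst_cong: "p \<in> P V \<Longrightarrow> (\<And>v. v \<in> V \<Longrightarrow> \<sigma> v = \<tau> v) \<Longrightarrow> subst \<sigma> p = subst \<tau> p"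
  by (induction rule: P_induct) (auto simp: subst_simps)

lemma subst_id: "p \<in> P V \<Longrightarrow> (\<And>v. v \<in> V \<Longrightarrow> \<sigma> v = Var v) \<Longrightarrow> subst \<sigma> p = p"
  by (induction rule: P_induct) (auto simp: subst_simps)

lemma subst_in_P: "p \<in> P V \<Longrightarrow> (\<And>v. v \<in> V \<Longrightarrow> \<sigma> v \<in> P U) \<Longrightarrow> subst \<sigma> p \<in> P U"
  by (induction rule: P_induct) (auto simp: subst_simps)

text \<open>Variables have degree 2, so replacing them by elements of degree 2 respects degrees; the
  induction adds one variable to the exponent at a time.\<close>

lemma homogeneous_subst:
  assumes "\<And>v. homogeneous 2 (\<sigma> v)" "homogeneous k p"
  shows "homogeneous k (subst \<sigma> p)"
  unfolding subst_def
proof (rule homogeneous_sum)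
  fix t assume t: "t \<in> keys p"
  have "homogeneous (mono_deg s) (subst \<sigma> (single s c))" for s c
    using subset_UNIV
  proof (induction s rule: exponent_induct)
    case zero
    then show ?case using homogeneous_Const[of c] by (simp add: subst_single)
  next
    case (add v t)
    then show ?case
      by (auto intro!: homogeneous_mult' assms(1) simp: single_Var mono_deg_add subst_mult
          simp del: One_nat_def)
  qed
  from this[of t] show "homogeneous k (Const (lookup p t) *
     (\<Prod>v \<in> keys t. \<sigma> v ^ lookup t v))"
    using t assms(2) by (simp add: subst_single homogeneous_def)
qed

lemma exact_quot_eq: "b \<noteq> 0 \<Longrightarrow> q * b = a \<Longrightarrow> exact_quot a b = q"
  unfolding exact_quot_def by (rule the_equality) auto

section \<open>Division with remainder by \<open>Var v - c\<close>\<close>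

definition ev :: "nat \<Rightarrow> rpoly \<Rightarrow> rpoly \<Rightarrow> rpoly" where
  "ev v c = subst (Var(v := c))"

text \<open>For \<open>c\<close> free of the variable \<open>v\<close>, evaluation \<open>ev\<close>
  is the remainder of division by the monic linear polynomial \<open>Var v - c\<close>, and
  \<open>dq\<close> is the quotient, a divided difference.\<close>

definition dq :: "nat \<Rightarrow> rpoly \<Rightarrow> rpoly \<Rightarrow> rpoly" where
  "dq v c p = exact_quot (p - ev v c p) (Var v - c)"

lemma ev_simps:
  "ev v c (p + q) = ev v c p + ev v c q" "ev v c (p * q) = ev v c p * ev v c q"
  "ev v c (- p) = - ev v c p" "ev v c (p - q) = ev v c p - ev v c q"
  "ev v c (p ^ m) = ev v c p ^ m"
  "ev v c 0 = 0" "ev v c 1 = 1"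
  "ev v c (Var u) = (if u = v then c else Var u)"
  by (auto simp: ev_def subst_simps)

lemma ev_id: "p \<in> P V \<Longrightarrow> v \<notin> V \<Longrightarrow> ev v c p = p"
  unfolding ev_def by (erule subst_id) auto

lemma ev_in_P: "p \<in> P U \<Longrightarrow> U \<subseteq> insert v V \<Longrightarrow> c \<in> P V \<Longrightarrow> ev v c p \<in> P V"
  unfolding ev_def by (erule subst_in_P) auto

lemma homogeneous_ev: "homogeneous 2 c \<Longrightarrow> homogeneous k p \<Longrightarrow> homogeneous k (ev v c p)"
  unfolding ev_def by (rule homogeneous_subst) auto

text \<open>Multiplication by another variable multiplies remainder and quotient by it;
  multiplication by \<open>Var v\<close> itself uses \<open>Var v = c + (Var v - c)\<close>. The
  quotient is built together with its degree, two below that of the monomial.\<close>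

lemma quotient_monomial:
  assumes "keys t \<subseteq> V" "c \<in> P V" "v \<in> V" "homogeneous 2 c"
  shows "\<exists>q \<in> P V. homogeneous (mono_deg t - 2) q \<and>
    single t a = ev v c (single t a) + (Var v - c) * q"
  using assms(1)
proof (induction t rule: exponent_induct)
  case zero
  then show ?case
    by (intro bexI[of _ 0]) (simp_all add: ev_def flip: Const_def)
next
  case (add u t)
  then obtain q where q: "q \<in> P V" "homogeneous (mono_deg t - 2) q"
    "single t a = ev v c (single t a) + (Var v - c) * q"
    by auto
  let ?s = "single t a"
  show ?case
  proof (cases "u = v")
    case True
    have e: "ev v c ?s = ?s - (Var v - c) * q"
      using q(3) by (simp add: algebra_simps)
    \<comment> \<open>Split \<open>Var v * ?s\<close> into \<open>(Var v - c) * ?s\<close> and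
      \<open>c * ?s\<close>, and divide the latter by the induction hypothesis.\<close>
    have eq: "Var v * ?s = c * ev v c ?s + (Var v - c) * (?s + c * q)"
      unfolding e by (simp add: algebra_simps)
    have ev: "ev v c (Var v * ?s) = c * ev v c ?s"
      by (simp add: ev_simps(2,8))
    have "homogeneous (mono_deg t) (?s + c * q)"
      by (auto intro!: homogeneous_add homogeneous_single homogeneous_mult' assms q)
    moreover have "?s + c * q \<in> P V"
      using q(1) assms P_single[OF add(2), of a] by simp
    ultimately show ?thesis
      unfolding True single_Var ev
      by (intro bexI[of _ "?s + c * q"] conjI eq) (simp_all only: mono_deg_add mono_deg_single, simp)
  next
    case False
    have eq: "Var u * ?s = Var u * ev v c ?s + (Var v - c) * (Var u * q)"
      by (subst q(3)) (simp add: algebra_simps)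
    have ev: "ev v c (Var u * ?s) = Var u * ev v c ?s"
      using False by (simp add: ev_simps(2,8))
    have "homogeneous (2 * int 1 + mono_deg t - 2) (Var u * q)"
      by (auto intro!: homogeneous_mult' q)
    then show ?thesis
      unfolding single_Var ev
      using q(1) add(1) by (intro bexI[of _ "Var u * q"] conjI eq) (simp_all only: mono_deg_add mono_deg_single P_mult P_Var)
  qed
qed

lemma Var_diff_nonzero:
  assumes "c \<in> P V" "v \<notin> V"
  shows "Var v - c \<noteq> 0"
proof
  assume "Var v - c = 0"
  then have "Var v \<in> P V" using assms by simp
  then show False using assms by simp
qed

text \<open>The quotient is assembled monomial by monomial, so one choice is homogeneous for
  whichever \<open>k\<close> the polynomial is.\<close>

lemma quotient_exists:
  assumes "p \<in> P V" "c \<in> P V" "v \<in> V" "homogeneous 2 c"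
  shows "\<exists>q \<in> P V. p = ev v c p + (Var v - c) * q \<and> (\<forall>k. homogeneous k p \<longrightarrow> homogeneous (k - 2) q)"
proof -
  let ?s = "\<lambda>t. single t (lookup p t)"
  have "\<exists>q \<in> P V. homogeneous (mono_deg t - 2) q \<and> ?s t = ev v c (?s t) + (Var v - c) * q"
    if "t \<in> keys p" for t
    by (rule quotient_monomial) (use assms that in \<open>auto simp: P_iff\<close>)
  then obtain q where q: "\<And>t. t \<in> keys p \<Longrightarrow> q t \<in> P V \<and> homogeneous (mono_deg t - 2) (q t) \<and>
      ?s t = ev v c (?s t) + (Var v - c) * q t"
    by metis
  have ev_sum: "ev v c (sum f A) = (\<Sum>t \<in> A. ev v c (f t))" for f and A :: "(nat \<Rightarrow>\<^sub>0 nat) set"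
    by (induction A rule: infinite_finite_induct) (auto simp: ev_simps)
  show ?thesis
  proof (intro bexI[of _ "sum q (keys p)"] conjI allI impI)
    have "(\<Sum>t \<in> keys p. ?s t) =
        (\<Sum>t \<in> keys p. ev v c (?s t) + (Var v - c) * q t)"
      using q by (intro sum.cong) blast+
    then show "p = ev v c p + (Var v - c) * sum q (keys p)"
      by (simp only: sum.distrib ev_sum[symmetric] sum_distrib_left[symmetric] sum_monomials)
    show "homogeneous (k - 2) (sum q (keys p))" if "homogeneous k p" for k
      using that q by (intro homogeneous_sum) (auto simp: homogeneous_def)
  qed (use q in \<open>blast intro: P_sum\<close>)
qed

text \<open>\<open>Var v - c\<close> can be cancelled, so the quotient found above is the one that
  \<open>exact_quot\<close> selects, and its properties pass to \<open>dq\<close>.\<close>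

lemma dq_props:
  assumes "p \<in> P (insert v V)" "c \<in> P V" "v \<notin> V" "homogeneous 2 c"
  shows "p = ev v c p + (Var v - c) * dq v c p" "dq v c p \<in> P (insert v V)"
    "homogeneous k p \<Longrightarrow> homogeneous (k - 2) (dq v c p)"
proof -
  have "c \<in> P (insert v V)" using assms by (auto intro: P_mono)
  then obtain q where q: "q \<in> P (insert v V)" "p = ev v c p + (Var v - c) * q"
    "\<And>k. homogeneous k p \<Longrightarrow> homogeneous (k - 2) q"
    using quotient_exists[of p "insert v V" c v] assms by blast
  have "q * (Var v - c) = p - ev v c p"
    using q(2) by (metis add_diff_cancel_left' mult.commute)
  then have "dq v c p = q"
    unfolding dq_def using Var_diff_nonzero[OF assms(2,3)] by (intro exact_quot_eq)
  then show "p = ev v c p + (Var v - c) * dq v c p" "dq v c p \<in> P (insert v V)"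
    "homogeneous k p \<Longrightarrow> homogeneous (k - 2) (dq v c p)"
    using q by blast+
qed

section \<open>Power sums in the elementary symmetric polynomials\<close>

text \<open>\<open>psum m (x + y) (x y) = x\<^sup>m + y\<^sup>m\<close>, by Newton's recursion; \<open>psum1\<close> and \<open>psum2\<close> are its
  divided differences in the two arguments.\<close>

fun psum :: "nat \<Rightarrow> rpoly \<Rightarrow> rpoly \<Rightarrow> rpoly" where
  "psum 0 a b = 2"
| "psum (Suc 0) a b = a"
| "psum (Suc (Suc m)) a b = a * psum (Suc m) a b - b * psum m a b"

fun psum1 :: "nat \<Rightarrow> rpoly \<Rightarrow> rpoly \<Rightarrow> rpoly \<Rightarrow> rpoly" where
  "psum1 0 a a' b = 0"
| "psum1 (Suc 0) a a' b = 1"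
| "psum1 (Suc (Suc m)) a a' b = psum (Suc m) a b + a' * psum1 (Suc m) a a' b - b * psum1 m a a' b"

fun psum2 :: "nat \<Rightarrow> rpoly \<Rightarrow> rpoly \<Rightarrow> rpoly \<Rightarrow> rpoly" where
  "psum2 0 a b b' = 0"
| "psum2 (Suc 0) a b b' = 0"
| "psum2 (Suc (Suc m)) a b b' = a * psum2 (Suc m) a b b' - psum m a b - b' * psum2 m a b b'"

lemma psum_power: "psum m (x + y) (x * y) = x ^ m + y ^ m"
  by (induction m "x + y" "x * y" rule: psum.induct) (simp_all add: algebra_simps)

text \<open>The recursion for \<open>psum1\<close> is the rule
  \<open>a f(a) - a' f(a') = (a - a') f(a) + a' (f(a) - f(a'))\<close> applied to Newton's
  recursion.\<close>

lemma psum1_mult: "psum1 m a a' b * (a - a') = psum m a b - psum m a' b"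
proof (induction m a a' b rule: psum1.induct)
  case (3 m a a' b)
  have "psum1 (Suc (Suc m)) a a' b * (a - a') = psum (Suc m) a b * (a - a')
      + a' * (psum1 (Suc m) a a' b * (a - a')) - b * (psum1 m a a' b * (a - a'))"
    by (simp add: algebra_simps)
  then show ?case by (simp only: 3) (simp add: algebra_simps)
qed simp_all

text \<open>The same rule, now for the factor \<open>b\<close> in the term
  \<open>b * psum m a b\<close>; the minus sign of that term in Newton's recursion accounts for the
  two minus signs.\<close>

lemma psum2_mult: "psum2 m a b b' * (b - b') = psum m a b - psum m a b'"
proof (induction m a b b' rule: psum2.induct)
  case (3 m a b b')
  have "psum2 (Suc (Suc m)) a b b' * (b - b') = a * (psum2 (Suc m) a b b' * (b - b'))
      - psum m a b * (b - b') - b' * (psum2 m a b b' * (b - b'))"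
    by (simp add: algebra_simps)
  then show ?case by (simp only: 3) (simp add: algebra_simps)
qed simp_all

lemma subst_psum:
  "subst \<sigma> (psum m a b) = psum m (subst \<sigma> a) (subst \<sigma> b)"
  "subst \<sigma> (psum1 m a a' b) = psum1 m (subst \<sigma> a) (subst \<sigma> a') (subst \<sigma> b)"
  "subst \<sigma> (psum2 m a b b') = psum2 m (subst \<sigma> a) (subst \<sigma> b) (subst \<sigma> b')"
  \<comment> \<open>The scheme of \<open>psum\<close> serves only as induction on \<open>m\<close>
    in steps of two; its other arguments are ignored.\<close>
  by (induction m rule: psum.induct[of "\<lambda>m _ _. _ m"]) (simp_all add: subst_simps)

lemma P_psum:
  assumes "a \<in> P V" "b \<in> P V"
  shows "psum m a b \<in> P V" "a' \<in> P V \<Longrightarrow> psum1 m a a' b \<in> P V" "b' \<in> P V \<Longrightarrow> psum2 m a b b' \<in> P V"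
proof -
  have "2 \<in> P V" using P_add[OF P_one P_one, of V] by simp
  then show 0: "psum m a b \<in> P V" for m
    using assms by (induction m rule: psum.induct[of "\<lambda>m _ _. _ m"]) simp_all
  show "a' \<in> P V \<Longrightarrow> psum1 m a a' b \<in> P V" "b' \<in> P V \<Longrightarrow> psum2 m a b b' \<in> P V"
    using assms by (induction m rule: psum.induct[of "\<lambda>m _ _. _ m"]) (simp_all add: 0)
qed

text \<open>Each divided difference loses the degree of its denominator: 2 for \<open>a - a'\<close>
  and 4 for \<open>b - b'\<close>.\<close>

lemma homogeneous_psum:
  assumes "homogeneous 2 a" "homogeneous 4 b"
  shows "homogeneous (2 * int m) (psum m a b)"
    "homogeneous 2 a' \<Longrightarrow> homogeneous (2 * int m - 2) (psum1 m a a' b)"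
    "homogeneous 4 b' \<Longrightarrow> homogeneous (2 * int m - 4) (psum2 m a b b')"
proof -
  have "homogeneous 0 (Const 2)" by simp
  then have "homogeneous 0 (2 :: rpoly)"
    by (simp add: Const_def del: homogeneous_Const)
  then show 0: "homogeneous (2 * int m) (psum m a b)" for m
    using assms by (induction m rule: psum.induct[of "\<lambda>m _ _. _ m"])
      (auto intro!: homogeneous_diff homogeneous_mult')
  show "homogeneous (2 * int m - 2) (psum1 m a a' b)" if "homogeneous 2 a'"
    using assms that 
  proof (induction m rule: psum.induct[of "\<lambda>m _ _. _ m"])
    case (3 m) 
    then show ?case using 0[of "Suc m"]
      by (auto intro!: homogeneous_diff homogeneous_add intro: homogeneous_mult')
  qed auto
  show "homogeneous (2 * int m - 4) (psum2 m a b b')" if "homogeneous 4 b'"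
    using assms that 
  proof (induction m rule: psum.induct[of "\<lambda>m _ _. _ m"])
    case (3 m) 
    then show ?case using 0[of m]
      by (auto intro!: homogeneous_diff homogeneous_add intro: homogeneous_mult')
  qed auto
qed

text \<open>This and the next two values show that the entries of a wide edge do not vanish, which
  is needed to know their \<open>poly_deg\<close>.\<close>

lemma psum_one_zero: "psum (Suc m) 1 0 = 1"
  by (induction m) simp_all

lemma psum1_one_zero: "psum1 (Suc m) 1 0 0 = 1"
proof (cases m)
  case (Suc k)
  then show ?thesis using psum_one_zero[of k] by simp
qed simp

text \<open>In terms of \<open>s = x + y\<close> and \<open>p = x y\<close> the power sum of order
  \<open>k\<close> begins with \<open>s^k - k s^(k-2) p\<close>; the value is the coefficient of
  \<open>p\<close> at \<open>s = 1\<close>.\<close>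

lemma psum2_one_zero: "psum2 (Suc (Suc m)) 1 0 0 = - of_nat (Suc (Suc m))"
  by (induction m) (simp_all add: psum_one_zero)

lemma subst_subst: "subst \<tau> (subst \<sigma> p) = subst (\<lambda>v. subst \<tau> (\<sigma> v)) p"
  using P_UNIV[of p] by (induction rule: P_induct) (auto simp: subst_simps)

lemma keys_Var_mult: "t \<in> keys (Var v * q) \<Longrightarrow>
    \<exists>u \<in> keys q. t = single v 1 + u"
  using keys_mult[of "Var v" q] by (auto simp: Var_def)

text \<open>Setting the second variable to \<open>0\<close> turns the sum into \<open>Var 0\<close>
  and the product into \<open>0\<close>, so a relation \<open>g\<close> has no terms free of
  \<open>Var 1\<close>. Dividing by \<open>Var 1\<close> gives a relation again, because
  \<open>Var 0 * Var 1\<close> can be cancelled. Repetition excludes every exponent of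
  \<open>Var 1\<close>.\<close>

lemma elementary_symmetric_independent:
  assumes "g \<in> P {0, 1}"
    and "subst (\<lambda>v. if v = 0 then Var 0 + Var 1 else Var 0 * Var 1) g = 0"
  shows "g = 0"
proof -
  let ?\<sigma> = "\<lambda>v. if v = 0 then Var 0 + Var 1 else Var 0 * Var 1"
  have "lookup g t = 0" if "lookup t 1 < m" for m t
    using assms that
  proof (induction m arbitrary: g t)
    case (Suc m)
    \<comment> \<open>Evaluating \<open>g\<close> at \<open>Var 1 = 0\<close> is the same as
      inserting sum and product and then killing the second variable.\<close>
    have "ev 1 0 g = subst (\<lambda>v. subst (\<lambda>v. if v = 0 then Var 0 else 0) (?\<sigma> v)) g"
      unfolding ev_def by (rule subst_cong[OF Suc.prems(1)]) (auto simp: subst_simps)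
    also have "\<dots> = 0"
      using Suc.prems(2) by (simp add: subst_subst[symmetric])
    finally have ev: "ev 1 0 g = 0" .
    define q where "q = dq 1 0 g"
    have q: "g = Var 1 * q" "q \<in> P {0, 1}"
      using dq_props[of g 1 "{0}" 0] Suc.prems(1) ev by (auto simp: q_def insert_commute)
    have "Var 0 * Var 1 * subst ?\<sigma> q = 0"
      using Suc.prems(2) by (simp add: q(1) subst_mult)
    moreover have "Var v \<noteq> 0" for v
      by (simp add: Var_def flip: keys_eq_empty)
    ultimately have "subst ?\<sigma> q = 0"
      by simp
    show ?case
    proof (rule ccontr)
      assume "lookup g t \<noteq> 0"
      then obtain u where u: "u \<in> keys q" "t = single 1 1 + u"
        using keys_Var_mult[of t 1 q] q(1) by (auto simp: in_keys_iff)
      then have "lookup u 1 < m"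
        using Suc.prems(3) by (simp add: lookup_add)
      then have "lookup q u = 0"
        using Suc.IH q \<open>subst ?\<sigma> q = 0\<close> by blast
      then show False using u by auto
    qed
  qed simp
  then show ?thesis
    by (intro poly_mapping_eqI) (metis lessI lookup_zero)
qed

text \<open>\<open>power_sum_poly\<close> is a definite description: Newton's recursion gives
  existence, algebraic independence of sum and product gives uniqueness.\<close>

lemma gpoly_eq: "gpoly n a b = psum (n + 1) a b"
proof -
  let ?\<sigma> = "\<lambda>v. if v = 0 then Var 0 + Var 1 else Var 0 * Var 1"
  let ?g = "psum (n + 1) (Var 0) (Var 1)"
  have 1: "subst ?\<sigma> ?g = Var 0 ^ (n + 1) + Var 1 ^ (n + 1)"
    by (simp add: subst_psum psum_power del: psum.simps)
  have 2: "?g \<in> P {0, 1}"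
    by (rule P_psum) auto
  have "power_sum_poly n = ?g"
    unfolding power_sum_poly_def
  proof (rule the_equality)
    fix g assume g: "g \<in> P {0, 1} \<and> subst (\<lambda>v. if v = 0 then Var 0 + Var 1 else Var 0 * Var 1) g =
       Var 0 ^ (n + 1) + Var 1 ^ (n + 1)"
    have "subst ?\<sigma> g = subst ?\<sigma> ?g"
      using 1 g by (simp only:)
    then have "subst ?\<sigma> (g - ?g) = 0"
      by (simp only: subst_diff right_minus_eq)
    moreover have "g - ?g \<in> P {0, 1}"
      using 2 g by (simp only: P_diff)
    ultimately have "g - ?g = 0"
      using elementary_symmetric_independent by blast
    then show "g = ?g" by simp
  qed (use 1 2 in \<open>auto simp del: psum.simps\<close>)
  then show ?thesis
    by (simp add: gpoly_def subst_psum del: psum.simps)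
qed

text \<open>The quotients in a wide edge, as functions of arbitrary sums and products. In this form
  they visibly commute with substitutions, unlike the definite description
  \<open>exact_quot\<close>.\<close>

definition u1 :: "nat \<Rightarrow> rpoly \<Rightarrow> rpoly \<Rightarrow> rpoly \<Rightarrow> rpoly" where
  "u1 n = psum1 (n + 1)"

definition u2 :: "nat \<Rightarrow> rpoly \<Rightarrow> rpoly \<Rightarrow> rpoly \<Rightarrow> rpoly" where
  "u2 n = psum2 (n + 1)"

text \<open>The point with one coordinate \<open>1\<close> and all others \<open>0\<close> separates
  the two pairs of marks: both products vanish there and one sum survives.\<close>

lemma subst_indicator_sum:
  fixes x :: nat
  defines "\<sigma> \<equiv> \<lambda>v. if v = x then 1 else 0"
  assumes "distinct [i, j, k, l]"
  shows "x = i \<Longrightarrow> subst \<sigma> (Var i + Var j) = 1" "x = i \<Longrightarrow> subst \<sigma> (Var i * Var j) = 0"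
     "x = i \<Longrightarrow> subst \<sigma> (Var k + Var l) = 0" "x = i \<Longrightarrow> subst \<sigma> (Var k * Var l) = 0"
  using assms(2) by (auto simp: \<sigma>_def subst_simps)

text \<open>The denominators are nonzero and can be cancelled, and the quotients are nonzero, so
  their degrees are those of \<open>homogeneous_psum\<close>. For \<open>u2\<close> this is where
  \<open>n \<ge> 1\<close> enters: for \<open>n = 0\<close> the polynomial \<open>g\<close> does not
  involve its second argument.\<close>

lemma wide_edge_data:
  fixes n i j k l :: nat
  assumes "n \<ge> 1" "distinct [i, j, k, l]"
  defines "s \<equiv> Var i + Var j" and "p \<equiv> Var i * Var j"
    and "s' \<equiv> Var k + Var l" and "p' \<equiv> Var k * Var l"
    and "V \<equiv> {i, j, k, l}"
  shows "wide_edge n i j k l = shift_fact (- 1)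
      (tensor_fact V V (koszul n V (u1 n s s' p) (s - s')) (koszul n V (u2 n s' p p') (p - p')))"
    "poly_deg (u1 n s s' p) = 2 * int n" "poly_deg (u2 n s' p p') = 2 * int n - 2"
proof -
  note [simp del] = psum.simps psum1.simps psum2.simps
  obtain m where m: "n = Suc m" using assms(1) by (cases n) auto
  let ?\<sigma> = "\<lambda>x v :: nat. if v = x then 1 else 0 :: rpoly"
  note \<sigma>1 = subst_indicator_sum[OF assms(2), of i, folded s_def p_def s'_def p'_def]
  have d': "distinct [k, l, i, j]" using assms(2) by auto
  note \<sigma>2 = subst_indicator_sum[OF d', of k, folded s_def p_def s'_def p'_def]
  have "subst (?\<sigma> i) (s - s') = 1"
    by (simp add: subst_diff \<sigma>1)
  then have s: "s - s' \<noteq> 0" by (metis subst_zero zero_neq_one)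
  \<comment> \<open>Both \<open>i\<close> and \<open>j\<close> are set to \<open>1\<close>, since a
    single nonzero variable would kill the product \<open>p\<close> as well.\<close>
  have "subst (\<lambda>v. if v = i \<or> v = j then 1 else 0) (p - p') = 1"
    using assms(2) by (auto simp: p_def p'_def subst_simps)
  then have p: "p - p' \<noteq> 0" by (metis subst_zero zero_neq_one)
  have "subst (?\<sigma> i) (u1 n s s' p) = 1"
    by (simp add: u1_def subst_psum \<sigma>1 psum1_one_zero)
  then have u1: "u1 n s s' p \<noteq> 0" by (metis subst_zero zero_neq_one)
  \<comment> \<open>The sum inside \<open>u2\<close> is \<open>s'\<close>, hence the point where the
    variable \<open>k\<close> is \<open>1\<close>; the value is \<open>- (n + 1)\<close>.\<close>
  have "subst (?\<sigma> k) (u2 n s' p p') = - of_nat (Suc (Suc m))"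
    by (simp only: u2_def subst_psum \<sigma>2 psum2_one_zero m Suc_eq_plus1[symmetric])
  then have u2: "u2 n s' p p' \<noteq> 0" by (metis subst_zero neg_equal_0_iff_equal of_nat_neq_0)
  have hs: "homogeneous 2 s" "homogeneous 2 s'"
    by (auto simp: s_def s'_def intro!: homogeneous_add)
  have hp: "homogeneous 4 p" "homogeneous 4 p'"
    using homogeneous_mult[OF homogeneous_Var homogeneous_Var] by (simp_all add: p_def p'_def)
  show "poly_deg (u1 n s s' p) = 2 * int n"
    using homogeneous_psum(2)[OF hs(1) hp(1) hs(2), of "n + 1"] u1
    by (intro poly_deg_homogeneous) (simp_all add: u1_def)
  show "poly_deg (u2 n s' p p') = 2 * int n - 2"
    using homogeneous_psum(3)[OF hs(2) hp(1) hp(2), of "n + 1"] u2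
    by (intro poly_deg_homogeneous) (simp_all add: u2_def)
  have "exact_quot (gpoly n s p - gpoly n s' p) (s - s') = u1 n s s' p"
    using s by (intro exact_quot_eq) (simp_all add: u1_def psum1_mult gpoly_eq)
  moreover have "exact_quot (gpoly n s' p - gpoly n s' p') (p - p') = u2 n s' p p'"
    using p by (intro exact_quot_eq) (simp_all add: u2_def psum2_mult gpoly_eq)
  ultimately show "wide_edge n i j k l = shift_fact (- 1)
      (tensor_fact V V (koszul n V (u1 n s s' p) (s - s')) (koszul n V (u2 n s' p p') (p - p')))"
    by (simp add: wide_edge_def Let_def V_def s_def s'_def p_def p'_def)
qed

section \<open>Graded modules in coordinates\<close>

definition hpart :: "int \<Rightarrow> rpoly \<Rightarrow> rpoly" where
  "hpart k p = (\<Sum>t \<in> {t \<in> keys p. mono_deg t = k}.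
     single t (lookup p t))"

lemma lookup_hpart: "lookup (hpart k p) t = (if mono_deg t = k then lookup p t else 0)"
  by (auto simp: hpart_def lookup_sum lookup_single when_def in_keys_iff)

lemma hpart_simps:
  "hpart k (p + q) = hpart k p + hpart k q" "hpart k 0 = 0"
  by (auto intro!: poly_mapping_eqI simp: lookup_hpart lookup_add)

lemma hpart_sum: "hpart k (sum f A) = (\<Sum>i \<in> A. hpart k (f i))"
  by (induction A rule: infinite_finite_induct) (auto simp: hpart_simps)

lemma homogeneous_hpart [simp]: "homogeneous k (hpart k p)"
  by (auto simp: homogeneous_def in_keys_iff lookup_hpart split: if_splits)

lemma hpart_homogeneous: "homogeneous j p \<Longrightarrow> hpart k p = (if j = k then p else 0)"
  by (auto intro!: poly_mapping_eqI simp: lookup_hpart homogeneous_def in_keys_iff)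

lemma P_hpart: "p \<in> P V \<Longrightarrow> hpart k p \<in> P V"
  unfolding hpart_def by (intro P_sum P_single) (auto simp: P_iff)

lemma keys_mono_part: "keys (mono_part V t) = keys t \<inter> V"
  and lookup_mono_part: "lookup (mono_part V t) v = (if v \<in> V then lookup t v else 0)"
proof -
  show l: "lookup (mono_part V t) v = (if v \<in> V then lookup t v else 0)" for v
    by (auto simp: mono_part_def lookup_sum lookup_single when_def in_keys_iff)
  show "keys (mono_part V t) = keys t \<inter> V"
    by (auto simp: in_keys_iff l split: if_splits)
qed

lemma mono_part_split: "mono_part V t + mono_part (- V) t = t"
  by (auto intro!: poly_mapping_eqI simp: lookup_add lookup_mono_part)

lemma mono_part_add: "mono_part V (s + t) = mono_part V s + mono_part V t"
  by (auto intro!: poly_mapping_eqI simp: lookup_add lookup_mono_part)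

lemma mono_part_id: "keys t \<subseteq> V \<Longrightarrow> mono_part V t = t"
  by (rule poly_mapping_eqI) (auto simp: lookup_mono_part in_keys_iff)

lemma mono_part_none: "keys t \<inter> V = {} \<Longrightarrow> mono_part V t = 0"
  by (metis keys_mono_part keys_eq_empty)

lemma lookup_mult_single:
  fixes p :: rpoly
  shows "lookup (p * single t 1) (s + t) = lookup p s"
  using P_UNIV[of p]
  by (induction rule: sum_monomials_induct)
    (auto simp: mult_single lookup_single lookup_add ring_distribs when_def)

text \<open>Linear independence over \<open>\<rat>[V']\<close> of the monomials in the other
  variables, as a rule for extracting coefficients: a monomial splits in only one way into a part
  over \<open>V'\<close> and a part over \<open>V - V'\<close>.\<close>

lemma lookup_free_sum:
  assumes "finite T" "\<And>t. t \<in> T \<Longrightarrow> keys t \<subseteq> V - V'" "\<And>t. t \<in> T \<Longrightarrow> g t \<in> P V'"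
    and "keys t0 \<subseteq> V - V'" "keys s \<subseteq> V'"
  shows "lookup (\<Sum>t \<in> T. g t * single t 1) (s + t0)
    = (if t0 \<in> T then lookup (g t0) s else 0)"
proof -
  have "lookup (g t * single t 1) (s + t0) = 0" if "t \<in> T" "t \<noteq> t0" for t
  proof (rule ccontr)
    assume "lookup (g t * single t 1) (s + t0) \<noteq> 0"
    then have "s + t0 \<in> keys (g t * single t 1)"
      by (simp add: in_keys_iff)
    then obtain u where u: "u \<in> keys (g t)" "s + t0 = u + t"
      using keys_mult[of "g t" "single t 1"] by auto
    have "keys u \<subseteq> V'"
      using u assms(3)[OF that(1)] by (simp add: P_iff)
    then have "mono_part (V - V') u = 0" "mono_part (V - V') s = 0"
      using assms(5) by (auto intro!: mono_part_none)
    then have "mono_part (V - V') t0 = mono_part (V - V') t"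
      using arg_cong[OF u(2), of "mono_part (V - V')"] by (simp add: mono_part_add)
    then show False
      using assms(2)[OF that(1)] assms(4) that by (simp add: mono_part_id)
  qed
  then have "lookup (\<Sum>t \<in> T. g t * single t 1) (s + t0)
      = (\<Sum>t \<in> T. if t = t0 then lookup (g t0) s else 0)"
    by (auto simp: lookup_sum lookup_mult_single intro!: sum.cong)
  then show ?thesis using assms(1) by simp
qed

text \<open>Each monomial is the product of its parts inside and outside \<open>V'\<close>.
  Collecting terms exhibits \<open>\<rat>[V]\<close> as spanned over \<open>\<rat>[V']\<close> by
  monomials, which is the reason that restriction of scalars keeps modules free.\<close>

lemma free_expansion:
  assumes "p \<in> P V"
  shows "\<exists>g. finite {t. g t \<noteq> 0} \<and> (\<forall>t. g t \<noteq> 0 \<longrightarrow> keys t \<subseteq> V - V') \<and>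
    (\<forall>t. g t \<in> P V') \<and> p = (\<Sum>t | g t \<noteq> 0. g t * single t 1)"
  using assms
proof (induction rule: sum_monomials_induct)
  case (monomial t c)
  let ?t = "mono_part (- V') t" and ?s = "mono_part V' t"
  let ?g = "\<lambda>u. if u = ?t then single ?s c else 0"
  have fin: "finite {u. ?g u \<noteq> 0}"
    by (rule finite_subset[of _ "{?t}"]) auto
  have "(\<Sum>u | ?g u \<noteq> 0. ?g u * single u 1) = (\<Sum>u \<in> {?t}. ?g u * single u 1)"
    by (intro sum.mono_neutral_left) auto
  also have "\<dots> = single t c"
    by (simp add: mult_single mono_part_split)
  finally show ?case
    using fin monomial by (intro exI[of _ ?g]) (auto simp: keys_mono_part intro!: P_single)
next
  case (add p q)
  then obtain g h where g: "finite {t. g t \<noteq> 0}" "\<And>t. g t \<noteq> 0 \<Longrightarrow> keys t \<subseteq> V - V'"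
     "\<And>t. g t \<in> P V'" "p = (\<Sum>t | g t \<noteq> 0. g t * single t 1)"
    and h: "finite {t. h t \<noteq> 0}" "\<And>t. h t \<noteq> 0 \<Longrightarrow> keys t \<subseteq> V - V'"
     "\<And>t. h t \<in> P V'" "q = (\<Sum>t | h t \<noteq> 0. h t * single t 1)"
    by auto
  let ?A = "{t. g t \<noteq> 0} \<union> {t. h t \<noteq> 0}"
  have sub: "{t. g t + h t \<noteq> 0} \<subseteq> ?A" by auto
  have eq: "(\<Sum>t | f t \<noteq> 0. f t * single t 1) = (\<Sum>t \<in> ?A. f t * single t 1)"
    if "{t. f t \<noteq> 0} \<subseteq> ?A" for f :: "(nat \<Rightarrow>\<^sub>0 nat) \<Rightarrow> rpoly"
    using that g(1) h(1) by (intro sum.mono_neutral_left) auto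
  have "p + q = (\<Sum>t | g t + h t \<noteq> 0. (g t + h t) * single t 1)"
    unfolding g(4) h(4) eq[OF sub] eq[OF Un_upper1] eq[OF Un_upper2]
    by (simp add: sum.distrib ring_distribs)
  moreover have "finite {t. g t + h t \<noteq> 0}"
    using sub g(1) h(1) by (meson finite_UnI finite_subset)
  moreover have "keys t \<subseteq> V - V'" if "g t + h t \<noteq> 0" for t
  proof -
    have "g t \<noteq> 0 \<or> h t \<noteq> 0" using that by auto
    then show ?thesis using g(2) h(2) by blast
  qed
  ultimately show ?case
    using g(3) h(3) by (intro exI[of _ "\<lambda>t. g t + h t"]) (intro conjI allI impI P_add)
qed (auto intro!: exI[of _ "\<lambda>_. 0"])

section \<open>Free graded modules given by coordinates\<close>

definition fam :: "nat set \<Rightarrow> 'i set \<Rightarrow> ('i \<Rightarrow> rpoly) set" where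
  "fam V I = {F. (\<forall>i. F i \<in> P V) \<and> (\<forall>i. i \<notin> I \<longrightarrow> F i = 0)}"

text \<open>A free graded module with a finite homogeneous basis indexed by \<open>I\<close>,
  encoded by its coordinate map. The basis element of index \<open>i\<close> has degree
  \<open>\<delta> i\<close>, so the coordinate at \<open>i\<close> of an element of degree
  \<open>k\<close> has degree \<open>k - \<delta> i\<close>. Coordinates are total functions
  vanishing off \<open>I\<close>; thus the even and odd parts of a factorization can share one index
  type.\<close>

locale coords =
  fixes V :: "nat set" and I :: "'i set" and \<delta> :: "'i \<Rightarrow> int"
    and \<phi> :: "'m \<Rightarrow> 'i \<Rightarrow> rpoly" and M :: "'m pmodule"
  assumes bij: "bij_betw \<phi> (carrier M) (fam V I)"
    and zero_closed: "\<zero>\<^bsub>M\<^esub> \<in> carrier M" and phi_zero: "\<phi> \<zero>\<^bsub>M\<^esub> i = 0"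
    and add_closed: "x \<in> carrier M \<Longrightarrow> y \<in> carrier M \<Longrightarrow> x \<oplus>\<^bsub>M\<^esub> y \<in> carrier M"
    and phi_add: "x \<in> carrier M \<Longrightarrow> y \<in> carrier M \<Longrightarrow> \<phi> (x \<oplus>\<^bsub>M\<^esub> y) i = \<phi> x i + \<phi> y i"
    and smult_closed: "p \<in> P V \<Longrightarrow> x \<in> carrier M \<Longrightarrow> p \<odot>\<^bsub>M\<^esub> x \<in> carrier M"
    and phi_smult: "p \<in> P V \<Longrightarrow> x \<in> carrier M \<Longrightarrow> \<phi> (p \<odot>\<^bsub>M\<^esub> x) i = p * \<phi> x i"
    and grade_eq: "grade M k = {x \<in> carrier M. \<forall>i. homogeneous (k - \<delta> i) (\<phi> x i)}"
    and finite_I: "finite I"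
begin

definition elt :: "('i \<Rightarrow> rpoly) \<Rightarrow> 'm" where
  "elt = the_inv_into (carrier M) \<phi>"

lemma elt: "F \<in> fam V I \<Longrightarrow> elt F \<in> carrier M" "F \<in> fam V I \<Longrightarrow> \<phi> (elt F) = F"
  "x \<in> carrier M \<Longrightarrow> elt (\<phi> x) = x"
  using bij unfolding elt_def
  by (auto simp: bij_betw_def f_the_inv_into_f the_inv_into_f_f intro!: the_inv_into_into[of _ _ _ "carrier M"])

lemma phi_fam: "x \<in> carrier M \<Longrightarrow> \<phi> x \<in> fam V I"
  using bij by (auto simp: bij_betw_def)

lemma phi_P: "x \<in> carrier M \<Longrightarrow> \<phi> x i \<in> P V"
  using phi_fam by (auto simp: fam_def)

lemma phi_off: "x \<in> carrier M \<Longrightarrow> i \<notin> I \<Longrightarrow> \<phi> x i = 0"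
  using phi_fam by (auto simp: fam_def)

lemma eqI: "x \<in> carrier M \<Longrightarrow> y \<in> carrier M \<Longrightarrow> (\<And>i. \<phi> x i = \<phi> y i) \<Longrightarrow> x = y"
  using bij by (meson bij_betw_imp_inj_on ext inj_onD)

lemma abelian_group: "abelian_group M"
proof (rule abelian_groupI)
  fix x assume x: "x \<in> carrier M"
  have F: "(\<lambda>i. - \<phi> x i) \<in> fam V I"
    using phi_fam[OF x] by (auto simp: fam_def)
  show "\<exists>y\<in>carrier M. y \<oplus>\<^bsub>M\<^esub> x = \<zero>\<^bsub>M\<^esub>"
    by (rule bexI[of _ "elt (\<lambda>i. - \<phi> x i)"])
      (auto intro!: eqI add_closed zero_closed simp: phi_add x phi_zero elt F)
qed (auto intro!: eqI simp: add_closed zero_closed phi_add phi_zero algebra_simps)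

lemma phi_a_inv:
  assumes "x \<in> carrier M"
  shows "\<phi> (\<ominus>\<^bsub>M\<^esub> x) i = - \<phi> x i"
proof -
  interpret abelian_group M by (rule abelian_group)
  have "\<phi> (x \<oplus>\<^bsub>M\<^esub> \<ominus>\<^bsub>M\<^esub> x) i = \<phi> x i + \<phi> (\<ominus>\<^bsub>M\<^esub> x) i"
    using assms by (simp only: phi_add a_inv_closed)
  then show ?thesis
    using assms by (simp add: r_neg phi_zero add_eq_0_iff)
qed

lemma a_inv_closed: "x \<in> carrier M \<Longrightarrow> \<ominus>\<^bsub>M\<^esub> x \<in> carrier M"
  by (rule abelian_group.a_inv_closed[OF abelian_group])

lemma phi_minus:
  assumes "x \<in> carrier M" "y \<in> carrier M"
  shows "x \<ominus>\<^bsub>M\<^esub> y \<in> carrier M" "\<phi> (x \<ominus>\<^bsub>M\<^esub> y) i = \<phi> x i - \<phi> y i"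
  using assms by (simp_all add: a_minus_def add_closed phi_add phi_a_inv a_inv_closed)

lemma module:
  assumes "V' \<subseteq> V"
  shows "module (poly_ring V') M"
proof (rule moduleI)
  have sub: "p \<in> P V' \<Longrightarrow> p \<in> P V" for p
    using assms by (rule P_mono)
  show "cring (poly_ring V')" by (rule cring_poly_ring)
  show "Ring.abelian_group M" by (rule abelian_group)
qed (auto intro!: eqI simp: add_closed smult_closed phi_add phi_smult algebra_simps P_mono[OF assms])

lemma phi_finsum:
  assumes "finite A" "f \<in> A \<rightarrow> carrier M"
  shows "finsum M f A \<in> carrier M" "\<phi> (finsum M f A) i = (\<Sum>a \<in> A. \<phi> (f a) i)"
proof -
  interpret abelian_group M by (rule abelian_group)
  show "finsum M f A \<in> carrier M"
    using assms(2) by (rule finsum_closed)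
  show "\<phi> (finsum M f A) i = (\<Sum>a \<in> A. \<phi> (f a) i)"
    using assms
  proof (induction A)
    case (insert a A)
    then have "f a \<in> carrier M" "f \<in> A \<rightarrow> carrier M" "finsum M f A \<in> carrier M"
      using finsum_closed by auto
    then show ?case
      using insert by (simp add: finsum_insert phi_add)
  qed (simp add: phi_zero)
qed

lemma grade_subgroup: "additive_subgroup (grade M k) M"
proof (rule additive_subgroup.intro)
  interpret abelian_group M by (rule abelian_group)
  show "subgroup (grade M k) (add_monoid M)"
    by (rule add.subgroupI)
      (auto simp: grade_eq phi_add phi_zero phi_a_inv zero_closed homogeneous_add homogeneous_diff
          simp flip: a_inv_def intro!: exI[of _ "\<zero>\<^bsub>M\<^esub>"])
qed

lemma hpart_fam: "x \<in> carrier M \<Longrightarrow> (\<lambda>i. hpart (k - \<delta> i) (\<phi> x i)) \<in> fam V I"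
  using phi_fam[of x] by (auto simp: fam_def P_hpart hpart_simps)

text \<open>Components are taken coordinatewise with \<open>hpart\<close>; applying
  \<open>hpart\<close> to any other decomposition recovers its summands, whence uniqueness.\<close>

lemma grade_decomposition:
  assumes x: "x \<in> carrier M"
  shows "\<exists>!c. (\<forall>k. c k \<in> grade M k) \<and> finite {k. c k \<noteq> \<zero>\<^bsub>M\<^esub>} \<and>
        x = finsum M c {k. c k \<noteq> \<zero>\<^bsub>M\<^esub>}"
proof (rule ex1I)
  define c where "c k = elt (\<lambda>i. hpart (k - \<delta> i) (\<phi> x i))" for k
  have c: "c k \<in> carrier M" "\<phi> (c k) i = hpart (k - \<delta> i) (\<phi> x i)" for k i
    by (auto simp: c_def elt hpart_fam[OF x])
  let ?S = "{k. c k \<noteq> \<zero>\<^bsub>M\<^esub>}"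
  \<comment> \<open>A nonzero component of degree \<open>k\<close> comes from a monomial
    \<open>t\<close> in some coordinate \<open>i\<close> with
    \<open>mono_deg t + \<delta> i = k\<close>, and there are only finitely many such pairs.\<close>
  have "k \<in> (\<Union>i \<in> I. (\<lambda>t. mono_deg t + \<delta> i) ` keys (\<phi> x i))" if nz: "c k \<noteq> \<zero>\<^bsub>M\<^esub>" for k
  proof -
    obtain i where i: "\<phi> (c k) i \<noteq> 0"
      using nz eqI[of "c k" "\<zero>\<^bsub>M\<^esub>"] c(1) zero_closed unfolding phi_zero by blast
    then have "i \<in> I" using phi_off c(1) by blast
    from i obtain t where "lookup (hpart (k - \<delta> i) (\<phi> x i)) t \<noteq> 0"
      unfolding c(2) by (metis poly_mapping_eqI lookup_zero)
    then show ?thesis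
      using \<open>i \<in> I\<close> by (force simp: lookup_hpart in_keys_iff split: if_splits)
  qed
  then have "?S \<subseteq> (\<Union>i \<in> I. (\<lambda>t. mono_deg t + \<delta> i) ` keys (\<phi> x i))"
    by blast
  then have fin: "finite ?S"
    by (rule finite_subset) (simp add: finite_I)
  have "x = finsum M c ?S"
  proof (rule eqI)
    fix i
    have "lookup (\<phi> x i) t = (\<Sum>k \<in> ?S. lookup (hpart (k - \<delta> i) (\<phi> x i)) t)" for t
    proof (cases "lookup (\<phi> x i) t = 0")
      case False
      have "\<phi> (c (mono_deg t + \<delta> i)) i \<noteq> 0"
        using False lookup_hpart[of "mono_deg t" "\<phi> x i" t] unfolding c by auto
      then have "mono_deg t + \<delta> i \<in> ?S" using phi_zero by auto
      then have "(\<Sum>k \<in> ?S. if k = mono_deg t + \<delta> i then lookup (\<phi> x i) t else 0)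
          = lookup (\<phi> x i) t"
        using fin by simp
      moreover have "(\<Sum>k \<in> ?S. if k = mono_deg t + \<delta> i then lookup (\<phi> x i) t else 0) =
          (\<Sum>k \<in> ?S. lookup (hpart (k - \<delta> i) (\<phi> x i)) t)"
        by (intro sum.cong) (auto simp: lookup_hpart)
      ultimately show ?thesis by simp
    next
      case True
      then show ?thesis
        by (subst sum.neutral) (auto simp: lookup_hpart)
    qed
    then show "\<phi> x i = \<phi> (finsum M c ?S) i"
      using fin c by (subst phi_finsum) (auto intro!: poly_mapping_eqI simp: lookup_sum)
  qed (use fin c x in \<open>auto intro!: phi_finsum(1)\<close>)
  then show "(\<forall>k. c k \<in> grade M k) \<and> finite ?S \<and> x = finsum M c ?S"
    using fin c by (auto simp: grade_eq)
  fix c' assume c': "(\<forall>k. c' k \<in> grade M k) \<and> finite {k. c' k \<noteq> \<zero>\<^bsub>M\<^esub>} \<and>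
        x = finsum M c' {k. c' k \<noteq> \<zero>\<^bsub>M\<^esub>}"
  let ?S' = "{k. c' k \<noteq> \<zero>\<^bsub>M\<^esub>}"
  from c' have c'1: "c' k \<in> carrier M" "homogeneous (k - \<delta> i) (\<phi> (c' k) i)" for k i
    by (auto simp: grade_eq)
  show "c' = c"
  proof (rule ext, rule eqI)
    fix k i
    have "\<phi> (c k) i = hpart (k - \<delta> i) (\<phi> (finsum M c' ?S') i)"
      using c' c(2) by simp
    also have "\<dots> = (\<Sum>j \<in> ?S'. hpart (k - \<delta> i) (\<phi> (c' j) i))"
      using c' c'1 by (subst phi_finsum) (auto simp: hpart_sum)
    also have "\<dots> = (\<Sum>j \<in> ?S'. if j = k then \<phi> (c' k) i else 0)"
      by (intro sum.cong refl) (simp add: hpart_homogeneous[OF c'1(2)])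
    also have "\<dots> = \<phi> (c' k) i"
      using c' by (simp add: phi_zero)
    finally show "\<phi> (c' k) i = \<phi> (c k) i" ..
  qed (auto intro: c c'1)
qed

lemma graded_module:
  assumes "V' \<subseteq> V"
  shows "graded_module V' M"
  unfolding graded_module_def
proof (intro conjI allI ballI impI module[OF assms] grade_subgroup grade_decomposition)
  fix j k p x
  assume "p \<in> P V'" "x \<in> grade M k" "homogeneous j p"
  then show "p \<odot>\<^bsub>M\<^esub> x \<in> grade M (j + k)"
    using P_mono[OF assms, of p]
    by (auto simp: grade_eq smult_closed phi_smult intro!: homogeneous_mult')
qed

text \<open>Over the smaller ring a basis is given by the old basis elements times the monomials in
  \<open>V - V'\<close>. Spanning is \<open>free_expansion\<close> in each coordinate, uniqueness is
  \<open>lookup_free_sum\<close>.\<close>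

lemma free_graded_module:
  assumes sub: "V' \<subseteq> V"
  shows "free_graded_module V' M"
proof -
  define J :: "('i \<times> (nat \<Rightarrow>\<^sub>0 nat)) set" where "J = I \<times> {t. keys t \<subseteq> V - V'}"
  define \<beta> where "\<beta> = (\<lambda>(i, t). elt (\<lambda>i'. if i' = i then single t 1 else 0))"
  define B where "B = \<beta> ` J"
  have beta: "\<beta> (i, t) \<in> carrier M"
    "\<phi> (\<beta> (i, t)) i' = (if i' = i then single t 1 else 0)"
    if "(i, t) \<in> J" for i t i'
  proof -
    have "(\<lambda>i'. if i' = i then single t 1 else 0) \<in> fam V I"
      using that by (auto simp: fam_def J_def intro!: P_single)
    then show "\<beta> (i, t) \<in> carrier M"
      "\<phi> (\<beta> (i, t)) i' = (if i' = i then single t 1 else 0)"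
      by (auto simp: \<beta>_def elt)
  qed
  have inj: "inj_on \<beta> J"
  proof (rule inj_onI)
    fix a b assume ab: "a \<in> J" "b \<in> J" "\<beta> a = \<beta> b"
    obtain i t j u where [simp]: "a = (i, t)" "b = (j, u)" by (metis surj_pair)
    have it: "(i, t) \<in> J" and ju: "(j, u) \<in> J" and "\<phi> (\<beta> (i, t)) i = \<phi> (\<beta> (j, u)) i"
      using ab by simp_all
    then have "single t (1 :: rat) = (if i = j then single u 1 else 0)"
      unfolding beta(2)[OF it] beta(2)[OF ju] by simp
    then have "i = j \<and> keys (single t (1 :: rat)) = keys (single u (1::rat))"
      by (metis keys_eq_empty keys_single insert_not_empty zero_neq_one)
    then show "a = b" by simp
  qed
  have BM: "B \<subseteq> carrier M"
    using beta by (auto simp: B_def)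
  \<comment> \<open>To coordinate \<open>i\<close> of a combination only the basis elements
    \<open>\<beta> (i, t)\<close> contribute.\<close>
  have phi_sum: "finsum M (\<lambda>b. c b \<odot>\<^bsub>M\<^esub> b) {b. c b \<noteq> 0} \<in> carrier M"
    "i \<in> I \<Longrightarrow> \<phi> (finsum M (\<lambda>b. c b \<odot>\<^bsub>M\<^esub> b) {b. c b \<noteq> 0}) i =
      (\<Sum>t | keys t \<subseteq> V - V' \<and> c (\<beta> (i, t)) \<noteq> 0. c (\<beta> (i, t)) * single t 1)"
    "finite {t. keys t \<subseteq> V - V' \<and> c (\<beta> (i, t)) \<noteq> 0}"
    if c: "\<forall>b \<in> B. c b \<in> P V'" "\<forall>b. b \<notin> B \<longrightarrow> c b = 0" "finite {b. c b \<noteq> 0}" "i \<in> I" for c i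
  proof -
    let ?S = "{b. c b \<noteq> 0}"
    let ?T = "{t. keys t \<subseteq> V - V' \<and> c (\<beta> (i, t)) \<noteq> 0}"
    have SB: "?S \<subseteq> B" using c(2) by auto
    have cV: "c b \<in> P V" if "b \<in> B" for b
      using that c(1) sub by (auto intro: P_mono)
    have clo: "(\<lambda>b. c b \<odot>\<^bsub>M\<^esub> b) \<in> ?S \<rightarrow> carrier M"
      using SB BM cV by (auto intro!: smult_closed)
    then show "finsum M (\<lambda>b. c b \<odot>\<^bsub>M\<^esub> b) ?S \<in> carrier M"
      by (rule phi_finsum(1)[OF c(3)])
    have injT: "inj_on (\<lambda>t. \<beta> (i, t)) ?T"
      using inj c(4) by (auto simp: inj_on_def J_def)
    have TS: "(\<lambda>t. \<beta> (i, t)) ` ?T \<subseteq> ?S" by auto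
    then show "finite ?T"
      using c(3) injT by (meson finite_imageD finite_subset)
    have "\<phi> (finsum M (\<lambda>b. c b \<odot>\<^bsub>M\<^esub> b) ?S) i = (\<Sum>b \<in> ?S. c b * \<phi> b i)"
      using SB BM cV by (auto simp: phi_finsum(2)[OF c(3) clo] phi_smult subset_iff intro!: sum.cong)
    also have "\<dots> = (\<Sum>b \<in> (\<lambda>t. \<beta> (i, t)) ` ?T. c b * \<phi> b i)"
    proof (rule sum.mono_neutral_right[OF c(3) TS], intro ballI)
      fix b assume b: "b \<in> ?S - (\<lambda>t. \<beta> (i, t)) ` ?T"
      then obtain j t where jt: "b = \<beta> (j, t)" "(j, t) \<in> J"
        using SB by (auto simp: B_def)
      then have "j \<noteq> i" using b by (auto simp: J_def)
      then show "c b * \<phi> b i = 0" using jt beta by simp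
    qed
    also have "\<dots> = (\<Sum>t \<in> ?T. c (\<beta> (i, t)) * \<phi> (\<beta> (i, t)) i)"
      using injT by (simp add: sum.reindex)
    also have "\<dots> = (\<Sum>t \<in> ?T. c (\<beta> (i, t)) * single t 1)"
      using c(4) by (intro sum.cong refl) (auto simp: J_def beta)
    finally show "\<phi> (finsum M (\<lambda>b. c b \<odot>\<^bsub>M\<^esub> b) ?S) i =
      (\<Sum>t \<in> ?T. c (\<beta> (i, t)) * single t 1)" .
  qed
  have hom: "B \<subseteq> (\<Union>k. grade M k)"
  proof
    fix b assume "b \<in> B"
    then obtain i t where it: "(i, t) \<in> J" "b = \<beta> (i, t)" by (auto simp: B_def)
    then have "b \<in> grade M (mono_deg t + \<delta> i)"
      by (auto simp: grade_eq beta homogeneous_single)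
    then show "b \<in> (\<Union>k. grade M k)" by blast
  qed
  let ?Q = "\<lambda>x c. (\<forall>b \<in> B. c b \<in> P V') \<and> (\<forall>b. b \<notin> B \<longrightarrow> c b = 0) \<and>
        finite {b. c b \<noteq> 0} \<and> x = finsum M (\<lambda>b. c b \<odot>\<^bsub>M\<^esub> b) {b. c b \<noteq> 0}"
  have uniq: "\<exists>!c. ?Q x c" if x: "x \<in> carrier M" for x
  proof (rule ex_ex1I)
    let ?R = "\<lambda>i g. finite {t. g t \<noteq> 0} \<and> (\<forall>t. g t \<noteq> 0 \<longrightarrow> keys t \<subseteq> V - V') \<and>
      (\<forall>t. g t \<in> P V') \<and> \<phi> x i = (\<Sum>t | g t \<noteq> 0. g t * single t 1)"
    have "\<forall>i. \<exists>g. ?R i g"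
      by (intro allI free_expansion[OF phi_P[OF x]])
    then obtain g where "\<forall>i. ?R i (g i)"
      using choice[of ?R] by blast
    then have g: "\<And>i. finite {t. g i t \<noteq> 0}" "\<And>i t. g i t \<noteq> 0 \<Longrightarrow> keys t \<subseteq> V - V'"
      "\<And>i t. g i t \<in> P V'" "\<And>i. \<phi> x i = (\<Sum>t | g i t \<noteq> 0. g i t * single t 1)"
      by blast+
    \<comment> \<open>Coefficients are indexed by module elements, the expansions by pairs;
      injectivity of \<open>\<beta>\<close> translates between the two.\<close>
    define c where "c b = (if b \<in> B then case_prod g (the_inv_into J \<beta> b) else 0)" for b
    have c: "c (\<beta> (i, t)) = g i t" if "(i, t) \<in> J" for i t
      using that by (auto simp: c_def B_def the_inv_into_f_f[OF inj])
    have c1: "\<forall>b \<in> B. c b \<in> P V'" "\<forall>b. b \<notin> B \<longrightarrow> c b = 0"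
      by (auto simp: c_def g(3) split: prod.split)
    have "{b. c b \<noteq> 0} \<subseteq> \<beta> ` (SIGMA i : I. {t. g i t \<noteq> 0})"
    proof
      fix b assume b: "b \<in> {b. c b \<noteq> 0}"
      then obtain i t where "(i, t) \<in> J" "b = \<beta> (i, t)" using c1(2) by (fastforce simp: B_def)
      then show "b \<in> \<beta> ` (SIGMA i : I. {t. g i t \<noteq> 0})"
        using b c by (auto simp: J_def)
    qed
    then have c2: "finite {b. c b \<noteq> 0}"
      by (rule finite_subset) (simp add: finite_I g(1))
    have "x = finsum M (\<lambda>b. c b \<odot>\<^bsub>M\<^esub> b) {b. c b \<noteq> 0}"
    \<comment> \<open>\<open>phi_sum\<close> presupposes an index in \<open>I\<close>, so the zero
      module is treated apart.\<close>
    proof (cases "I = {}")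
      case True
      have "{b. c b \<noteq> 0} = {}"
        using c1(2) True by (auto simp: B_def J_def)
      then have "finsum M (\<lambda>b. c b \<odot>\<^bsub>M\<^esub> b) {b. c b \<noteq> 0} = \<zero>\<^bsub>M\<^esub>"
        by (simp add: abelian_monoid.finsum_empty abelian_group[THEN abelian_group.axioms(1)])
      then show ?thesis
        using phi_off[OF x] True phi_zero by (auto intro!: eqI x zero_closed)
    next
      case False
      show ?thesis
      proof (rule eqI)
        show "finsum M (\<lambda>b. c b \<odot>\<^bsub>M\<^esub> b) {b. c b \<noteq> 0} \<in> carrier M"
          using False phi_sum(1)[OF c1 c2] by blast
        fix i
        show "\<phi> x i = \<phi> (finsum M (\<lambda>b. c b \<odot>\<^bsub>M\<^esub> b) {b. c b \<noteq> 0}) i"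
        proof (cases "i \<in> I")
          case True
          then have "{t. keys t \<subseteq> V - V' \<and> c (\<beta> (i, t)) \<noteq> 0} = {t. g i t \<noteq> 0}"
            using g(2) c by (auto simp: J_def)
          then show ?thesis
            using True g(2) c by (subst phi_sum(2)[OF c1 c2]) (auto simp: g(4) J_def intro!: sum.cong)
        next
          case False
          then show ?thesis
            using phi_off x \<open>finsum M (\<lambda>b. c b \<odot>\<^bsub>M\<^esub> b) {b. c b \<noteq> 0} \<in> carrier M\<close> by simp
        qed
      qed (rule x)
    qed
    then show "\<exists>c. ?Q x c"
      using c1 c2 by blast
  next
    fix c c' assume c: "?Q x c" and c': "?Q x c'"
    \<comment> \<open>The coefficient of \<open>s\<close> in \<open>c (\<beta> (i, t))\<close> is
      the coefficient of \<open>s + t\<close> in a coordinate of \<open>x\<close>, so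
      \<open>x\<close> determines \<open>c\<close>.\<close>
    have lk: "lookup (\<phi> x i) (s + t) = lookup (c (\<beta> (i, t))) s"
      if "?Q x c" "(i, t) \<in> J" "keys s \<subseteq> V'" for c i t s
    proof -
      have i: "i \<in> I" and t: "keys t \<subseteq> V - V'" using that(2) by (auto simp: J_def)
      let ?T = "{t. keys t \<subseteq> V - V' \<and> c (\<beta> (i, t)) \<noteq> 0}"
      have "\<phi> x i = (\<Sum>t \<in> ?T. c (\<beta> (i, t)) * single t 1)"
        using phi_sum(2)[of c i] that(1) i by simp
      also have "lookup \<dots> (s + t) = (if t \<in> ?T then lookup (c (\<beta> (i, t))) s else 0)"
        by (rule lookup_free_sum[where V = V and V' = V'])
          (use that i t phi_sum(3)[of c i] in \<open>auto simp: B_def J_def\<close>)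
      finally show ?thesis using t by auto
    qed
    show "c = c'"
    proof
      fix b
      show "c b = c' b"
      proof (cases "b \<in> B")
        case True
        then obtain i t where it: "(i, t) \<in> J" "b = \<beta> (i, t)" by (auto simp: B_def)
        show ?thesis
        proof (rule poly_mapping_eqI)
          fix s
          show "lookup (c b) s = lookup (c' b) s"
          proof (cases "keys s \<subseteq> V'")
            case True
            then show ?thesis using lk[OF c it(1)] lk[OF c' it(1)] it by simp
          next
            case False
            have "c b \<in> P V'" "c' b \<in> P V'" using c c' True by auto
            then show ?thesis using False by (metis P_iff in_keys_iff)
          qed
        qed
      qed (use c c' in auto)
    qed
  qed
  show ?thesis
    unfolding free_graded_module_def
    by (intro conjI graded_module[OF sub] exI[of _ B] hom ballI uniq)
qed

end

section \<open>Coordinates on tensor products\<close>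

abbreviation add_grp :: "'a set \<Rightarrow> 'a::ab_group_add monoid" where
  "add_grp C \<equiv> \<lparr>carrier = C, monoid.mult = (+), one = 0\<rparr>"

definition add_closed :: "'a::ab_group_add set \<Rightarrow> bool" where
  "add_closed C \<longleftrightarrow> 0 \<in> C \<and> (\<forall>x \<in> C. \<forall>y \<in> C. x - y \<in> C)"

lemma add_closedD:
  assumes "add_closed C"
  shows "0 \<in> C" "x \<in> C \<Longrightarrow> y \<in> C \<Longrightarrow> x - y \<in> C" "x \<in> C \<Longrightarrow> - x \<in> C"
    "x \<in> C \<Longrightarrow> y \<in> C \<Longrightarrow> x + y \<in> C"
proof -
  show 0: "0 \<in> C" and d: "\<And>x y. x \<in> C \<Longrightarrow> y \<in> C \<Longrightarrow> x - y \<in> C"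
    using assms by (auto simp: add_closed_def)
  show n: "- x \<in> C" if "x \<in> C" for x using d[OF 0 that] by simp
  show "x \<in> C \<Longrightarrow> y \<in> C \<Longrightarrow> x + y \<in> C"
    using d[of x "- y"] n[of y] by simp
qed

lemma add_closed_sum: "add_closed C \<Longrightarrow> (\<And>a. a \<in> A \<Longrightarrow> f a \<in> C) \<Longrightarrow> sum f A \<in> C"
  by (induction A rule: infinite_finite_induct) (auto simp: add_closedD)

lemma add_grp_group: "add_closed C \<Longrightarrow> Group.group (add_grp C)"
proof (rule groupI)
  fix x assume "add_closed C" "x \<in> carrier (add_grp C)"
  then show "\<exists>y\<in>carrier (add_grp C). y \<otimes>\<^bsub>add_grp C\<^esub> x = \<one>\<^bsub>add_grp C\<^esub>"
    by (intro bexI[of _ "- x"]) (auto simp: add_closedD)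
qed (auto simp: add_closedD add.assoc)

lemma generate_add_closed:
  assumes "add_closed C" "S \<subseteq> C"
  shows "add_closed (generate (add_grp C) S)" "generate (add_grp C) S \<subseteq> C"
proof -
  interpret Group.group "add_grp C" by (rule add_grp_group[OF assms(1)])
  have inv: "inv\<^bsub>add_grp C\<^esub> x = - x" if "x \<in> C" for x
    by (rule inv_equality) (use that assms in \<open>auto simp: add_closedD\<close>)
  have sub: "subgroup (generate (add_grp C) S) (add_grp C)"
    by (rule generate_is_subgroup) (simp add: assms)
  then show 1: "generate (add_grp C) S \<subseteq> C"
    using subgroup.subset by fastforce
  show "add_closed (generate (add_grp C) S)"
    unfolding add_closed_def
  proof (intro conjI ballI)
    show "0 \<in> generate (add_grp C) S" using subgroup.one_closed[OF sub] by simp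
    fix x y assume xy: "x \<in> generate (add_grp C) S" "y \<in> generate (add_grp C) S"
    then have "- y \<in> generate (add_grp C) S"
      using subgroup.m_inv_closed[OF sub, of y] inv 1 by auto
    then show "x - y \<in> generate (add_grp C) S"
      using subgroup.m_closed[OF sub xy(1), of "- y"] by simp
  qed
qed

text \<open>The \<open>add_monoid\<close> of a module record keeps a leftover extension field,
  \<open>add_grp\<close> has none; generation depends only on carrier, product and unit.\<close>

lemma generate_extend:
  "generate \<lparr>carrier = C, monoid.mult = (+), one = 0, \<dots> = m\<rparr> S = generate (add_grp C) S"
proof -
  let ?G = "\<lparr>carrier = C, monoid.mult = (+), one = 0, \<dots> = m\<rparr>"
  have inv: "m_inv ?G = m_inv (add_grp C)"
    by (simp add: m_inv_def fun_eq_iff)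
  have "x \<in> generate (add_grp C) S" if "x \<in> generate ?G S" for x
    using that
  proof induction
    case (eng a b)
    then show ?case using generate.eng[of a "add_grp C" S b] by simp
  qed (use inv generate.one[of "add_grp C"] in \<open>auto intro: generate.incl generate.inv\<close>)
  moreover have "x \<in> generate ?G S" if "x \<in> generate (add_grp C) S" for x
    using that
  proof induction
    case (eng a b)
    then show ?case using generate.eng[of a ?G S b] by simp
  next
    case (inv h)
    then show ?case using generate.inv[of h S ?G] \<open>m_inv ?G = m_inv (add_grp C)\<close> by simp
  qed (use generate.one[of ?G] in \<open>auto intro: generate.incl\<close>)
  ultimately show ?thesis by blast
qed

text \<open>Applied with \<open>K\<close> the kernel of an additive map, or the set of elements with
  homogeneous coordinates of fixed degrees.\<close>

lemma generate_subset:
  assumes "add_closed C" "S \<subseteq> C" "add_closed K" "S \<subseteq> K"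
  shows "generate (add_grp C) S \<subseteq> K"
proof
  interpret Group.group "add_grp C" by (rule add_grp_group[OF assms(1)])
  have inv: "inv\<^bsub>add_grp C\<^esub> x = - x" if "x \<in> C" for x
    by (rule inv_equality) (use that assms in \<open>auto simp: add_closedD\<close>)
  fix x assume "x \<in> generate (add_grp C) S"
  then show "x \<in> K"
    by induction (use assms inv in \<open>auto simp: add_closedD subset_iff\<close>)
qed

text \<open>With transitivity and symmetry below, \<open>x - y \<in> H\<close> is handled as a
  congruence, so that computations in a tensor product become chains of congruences between formal
  sums.\<close>

lemma add_closed_sum_mod:
  assumes "add_closed H" "\<And>a. a \<in> A \<Longrightarrow> f a - g a \<in> H"
  shows "sum f A - sum g A \<in> H"
  using add_closed_sum[OF assms(1), of A "\<lambda>a. f a - g a"] assms(2) by (simp add: sum_subtractf)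

lemma add_closed_trans:
  "add_closed H \<Longrightarrow> x - y \<in> H \<Longrightarrow> y - z \<in> H \<Longrightarrow> x - z \<in> H"
  using add_closedD(4)[of H "x - y" "y - z"] by simp

lemma add_closed_sym: "add_closed H \<Longrightarrow> x - y \<in> H \<Longrightarrow> y - x \<in> H"
  using add_closedD(3)[of H "x - y"] by simp

text \<open>The isomorphism theorem for a structure \<open>A\<close> that is not itself a module:
  its scalar action is compatible with \<open>\<Phi>\<close>, but the module axioms may hold only
  modulo the kernel \<open>H\<close>. Formal pairs are of this kind.\<close>

locale quotient_coords =
  fixes V :: "nat set" and K :: "'i set" and \<delta> :: "'i \<Rightarrow> int"
    and \<Phi> :: "'a::ab_group_add \<Rightarrow> 'i \<Rightarrow> rpoly" and A :: "'a pmodule" and H :: "'a set"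
  assumes add: "add A = (+)" and zero: "zero A = 0" and C: "add_closed (carrier A)"
    and Phi_add: "\<Phi> (x + y) i = \<Phi> x i + \<Phi> y i"
    and H: "H = {x \<in> carrier A. \<forall>i. \<Phi> x i = 0}"
    and image: "\<Phi> ` carrier A = fam V K"
    and smult: "p \<in> P V \<Longrightarrow> x \<in> carrier A \<Longrightarrow> smult A p x \<in> carrier A"
      "p \<in> P V \<Longrightarrow> x \<in> carrier A \<Longrightarrow> \<Phi> (smult A p x) i = p * \<Phi> x i"
    and grade_sub: "grade A k \<subseteq> carrier A"
    and grade: "\<Phi> ` grade A k = {F \<in> fam V K. \<forall>i. homogeneous (k - \<delta> i) (F i)}"
    and fin: "finite K"
begin

text \<open>The cosets of \<open>H\<close> are the nonempty fibres of \<open>\<Phi>\<close>, and as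
  fibres they are labelled by coordinates.\<close>

definition fib :: "('i \<Rightarrow> rpoly) \<Rightarrow> 'a set" where
  "fib F = {x \<in> carrier A. \<Phi> x = F}"

definition cls :: "'a set \<Rightarrow> 'i \<Rightarrow> rpoly" where
  "cls X = \<Phi> (SOME x. x \<in> X)"

lemma fib_nonempty: "F \<in> fam V K \<Longrightarrow> \<exists>x. x \<in> fib F"
proof -
  assume "F \<in> fam V K"
  then have "F \<in> \<Phi> ` carrier A" by (simp add: image)
  then show ?thesis by (auto simp: fib_def)
qed

lemma cls_fib:
  assumes "F \<in> fam V K"
  shows "cls (fib F) = F"
proof -
  have "(SOME x. x \<in> fib F) \<in> fib F"
    using fib_nonempty[OF assms] by (metis someI_ex)
  then show ?thesis by (simp add: cls_def fib_def)
qed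

lemma Phi_diff: "\<Phi> (x - y) i = \<Phi> x i - \<Phi> y i"
  using Phi_add[of "x - y" y i] by simp

lemma Phi_fam: "x \<in> carrier A \<Longrightarrow> \<Phi> x \<in> fam V K"
  using image by auto

lemma set_add_eq: "set_add A X Y = {x + y | x y. x \<in> X \<and> y \<in> Y}"
  by (auto simp: set_add_def' add)

text \<open>A fibre is a full coset of the kernel, so adding \<open>H\<close> to any nonempty part
  of it fills it up. Scalar multiplication and induced maps on quotients are both defined as
  \<open>H\<close> plus an image and are evaluated in this way.\<close>

lemma coset_absorb:
  assumes "x \<in> X" "X \<subseteq> fib F"
  shows "set_add A H X = fib F"
proof -
  have "\<exists>h \<in> H. y = h + x" if "y \<in> fib F" for y
    using that assms C by (intro bexI[of _ "y - x"])
      (auto simp: H Phi_diff fib_def add_closedD(2) subset_iff)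
  then show ?thesis
    using assms C by (fastforce simp: set_add_eq H fib_def Phi_add add_closedD(4) fun_eq_iff)
qed

lemma coset_eq: "x \<in> carrier A \<Longrightarrow> a_r_coset A H x = fib (\<Phi> x)"
  using coset_absorb[of x "{x}" "\<Phi> x"]
  by (auto simp: a_r_coset_def' set_add_def' fib_def add)

lemma carrier_quot: "carrier (quot_module A H) = fib ` fam V K"
proof -
  have "carrier (quot_module A H) = a_r_coset A H ` carrier A"
    by (auto simp: quot_module_def A_RCOSETS_def')
  also have "\<dots> = (\<lambda>x. fib (\<Phi> x)) ` carrier A"
    by (rule image_cong) (simp_all add: coset_eq)
  also have "\<dots> = fib ` fam V K"
    by (simp only: image[symmetric] image_image)
  finally show ?thesis .
qed

lemma fib_zero: "fib (\<lambda>_. 0) = H"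
  by (auto simp: fib_def H fun_eq_iff)

lemma fam_zero: "(\<lambda>_. 0) \<in> fam V K"
  by (simp add: fam_def)

lemma fam_add: "F \<in> fam V K \<Longrightarrow> G \<in> fam V K \<Longrightarrow> (\<lambda>i. F i + G i) \<in> fam V K"
  by (simp add: fam_def)

lemma fam_smult: "p \<in> P V \<Longrightarrow> F \<in> fam V K \<Longrightarrow> (\<lambda>i. p * F i) \<in> fam V K"
  by (simp add: fam_def)

lemma fib_add:
  assumes "F \<in> fam V K" "G \<in> fam V K"
  shows "set_add A (fib F) (fib G) = fib (\<lambda>i. F i + G i)"
proof -
  obtain y where y: "y \<in> fib G" using fib_nonempty assms(2) by blast
  have "\<exists>x \<in> fib F. z = x + y" if "z \<in> fib (\<lambda>i. F i + G i)" for z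
    using that y C by (intro bexI[of _ "z - y"]) (auto simp: fib_def Phi_diff add_closedD fun_eq_iff)
  then show ?thesis
    using C y by (fastforce simp: set_add_eq fib_def Phi_add add_closedD(4) fun_eq_iff)
qed

lemma fib_smult:
  assumes "p \<in> P V" "F \<in> fam V K"
  shows "smult (quot_module A H) p (fib F) = fib (\<lambda>i. p * F i)"
proof -
  obtain x where "x \<in> fib F" using fib_nonempty assms(2) by blast
  then have "set_add A H (smult A p ` fib F) = fib (\<lambda>i. p * F i)"
    using assms(1) by (intro coset_absorb[of "smult A p x"]) (auto simp: fib_def smult fun_eq_iff)
  then show ?thesis
    by (simp add: quot_module_def)
qed

lemma coords_quot: "coords V K \<delta> cls (quot_module A H)"
proof (rule coords.intro)
  have q: "X \<in> carrier (quot_module A H) \<Longrightarrow> \<exists>F \<in> fam V K. X = fib F" for X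
    by (auto simp: carrier_quot)
  have q': "add (quot_module A H) = set_add A" "zero (quot_module A H) = H"
    by (auto simp: quot_module_def)
  show "bij_betw cls (carrier (quot_module A H)) (fam V K)"
    by (rule bij_betw_byWitness[of _ fib]) (auto simp: carrier_quot cls_fib)
  show "\<zero>\<^bsub>quot_module A H\<^esub> \<in> carrier (quot_module A H)" "cls \<zero>\<^bsub>quot_module A H\<^esub> i = 0" for i
    using fam_zero cls_fib[OF fam_zero] fib_zero by (auto simp: q' carrier_quot)
  fix X assume "X \<in> carrier (quot_module A H)"
  then obtain F where F: "F \<in> fam V K" "X = fib F" using q by blast
  show "p \<odot>\<^bsub>quot_module A H\<^esub> X \<in> carrier (quot_module A H)" if "p \<in> P V" for p
    using that F by (auto simp: fib_smult carrier_quot fam_smult)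
  show "cls (p \<odot>\<^bsub>quot_module A H\<^esub> X) i = p * cls X i" if "p \<in> P V" for p i
    using that F by (auto simp: fib_smult cls_fib fam_smult)
  fix Y assume "Y \<in> carrier (quot_module A H)"
  then obtain G where G: "G \<in> fam V K" "Y = fib G" using q by blast
  show "X \<oplus>\<^bsub>quot_module A H\<^esub> Y \<in> carrier (quot_module A H)"
    using F G by (auto simp: q' fib_add carrier_quot fam_add)
  show "cls (X \<oplus>\<^bsub>quot_module A H\<^esub> Y) i = cls X i + cls Y i" for i
    using F G by (auto simp: q' fib_add cls_fib fam_add)
next
  fix k
  have "grade (quot_module A H) k = (\<lambda>x. fib (\<Phi> x)) ` grade A k"
    using grade_sub[of k] by (auto simp: quot_module_def coset_eq intro!: image_cong)
  also have "\<dots> = fib ` {F \<in> fam V K. \<forall>i. homogeneous (k - \<delta> i) (F i)}"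
    by (simp only: grade[symmetric] image_image)
  also have "\<dots> = {x \<in> carrier (quot_module A H). \<forall>i. homogeneous (k - \<delta> i) (cls x i)}"
    by (auto simp: carrier_quot cls_fib)
  finally show "grade (quot_module A H) k =
      {x \<in> carrier (quot_module A H). \<forall>i. homogeneous (k - \<delta> i) (cls x i)}" .
qed (rule fin)

end

section \<open>Coordinates of formal sums of pairs\<close>

definition pair_coord ::
    "('m \<Rightarrow> 'i \<Rightarrow> rpoly) \<Rightarrow> ('n \<Rightarrow> 'j \<Rightarrow> rpoly) \<Rightarrow> ('m \<times> 'n \<Rightarrow>\<^sub>0 int) \<Rightarrow> 'i \<times> 'j \<Rightarrow> rpoly" where
  "pair_coord \<phi> \<psi> z ij = (\<Sum>a \<in> keys z. of_int (lookup z a) *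
     (\<phi> (fst a) (fst ij) * \<psi> (snd a) (snd ij)))"

lemma pair_coord_frag_of [simp]: "pair_coord \<phi> \<psi> (frag_of (x, y)) (i, j) = \<phi> x i * \<psi> y j"
  by (simp add: pair_coord_def)

lemma pair_coord_add: "pair_coord \<phi> \<psi> (z + z') ij = pair_coord \<phi> \<psi> z ij + pair_coord \<phi> \<psi> z' ij"
proof -
  have *: "pair_coord \<phi> \<psi> z ij = (\<Sum>a \<in> A. of_int (lookup z a) *
     (\<phi> (fst a) (fst ij) * \<psi> (snd a) (snd ij)))" if "finite A" "keys z \<subseteq> A" for A z
    unfolding pair_coord_def using that by (intro sum.mono_neutral_left) (auto simp: in_keys_iff)
  let ?A = "keys z \<union> keys z'"
  show ?thesis
    using keys_add[of z z'] *[of ?A z] *[of ?A z'] *[of ?A "z + z'"]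
    by (simp add: lookup_add ring_distribs sum.distrib)
qed

lemma pair_coord_zero [simp]: "pair_coord \<phi> \<psi> 0 ij = 0"
  by (simp add: pair_coord_def)

lemma pair_coord_diff: "pair_coord \<phi> \<psi> (z - z') ij = pair_coord \<phi> \<psi> z ij - pair_coord \<phi> \<psi> z' ij"
  using pair_coord_add[of \<phi> \<psi> "z - z'" z' ij] by simp

lemma pair_coord_sum: "pair_coord \<phi> \<psi> (sum f A) ij = (\<Sum>a \<in> A. pair_coord \<phi> \<psi> (f a) ij)"
  by (induction A rule: infinite_finite_induct) (auto simp: pair_coord_add)

text \<open>The choice of representative does not matter: \<open>pair_coord\<close> is constant on
  cosets of the relations.\<close>

definition tensor_coord ::
    "('m \<Rightarrow> 'i \<Rightarrow> rpoly) \<Rightarrow> ('n \<Rightarrow> 'j \<Rightarrow> rpoly) \<Rightarrow> ('m \<times> 'n \<Rightarrow>\<^sub>0 int) set \<Rightarrow> 'i \<times> 'j \<Rightarrow> rpoly" where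
  "tensor_coord \<phi> \<psi> X = pair_coord \<phi> \<psi> (SOME z. z \<in> X)"

locale tensor_coords =
  M: coords V1 I \<delta> \<phi> M + N: coords V2 J \<epsilon> \<psi> N
  for V1 V2 :: "nat set" and I :: "'i set" and J :: "'j set" and \<delta> \<epsilon>
    and \<phi> :: "'m \<Rightarrow> 'i \<Rightarrow> rpoly" and \<psi> :: "'n \<Rightarrow> 'j \<Rightarrow> rpoly" and M N
begin

definition C :: "('m \<times> 'n \<Rightarrow>\<^sub>0 int) set" where
  "C = {z. keys z \<subseteq> carrier M \<times> carrier N}"
abbreviation "H \<equiv> tensor_rel V1 V2 M N"
abbreviation "\<Phi> \<equiv> pair_coord \<phi> \<psi>"
abbreviation "FP \<equiv> formal_pairs V1 M N"

lemma C: "add_closed C"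
proof -
  have "keys (x - y) \<subseteq> S" if "keys x \<subseteq> S" "keys y \<subseteq> S"
    for x y :: "'m \<times> 'n \<Rightarrow>\<^sub>0 int" and S
    using that keys_diff[of x y] by blast
  then show ?thesis by (simp add: add_closed_def C_def)
qed

lemma frag_C: "x \<in> carrier M \<Longrightarrow> y \<in> carrier N \<Longrightarrow> frag_of (x, y) \<in> C"
  by (simp add: keys_frag_of C_def)

definition rels :: "('m \<times> 'n \<Rightarrow>\<^sub>0 int) set" where
  "rels = {frag_of (x \<oplus>\<^bsub>M\<^esub> x', y) - frag_of (x, y) - frag_of (x', y) | x x' y.
         x \<in> carrier M \<and> x' \<in> carrier M \<and> y \<in> carrier N} \<union>
      {frag_of (x, y \<oplus>\<^bsub>N\<^esub> y') - frag_of (x, y) - frag_of (x, y') | x y y'.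
         x \<in> carrier M \<and> y \<in> carrier N \<and> y' \<in> carrier N} \<union>
      {frag_of (r \<odot>\<^bsub>M\<^esub> x, y) - frag_of (x, r \<odot>\<^bsub>N\<^esub> y) | r x y.
         r \<in> carrier (poly_ring (V1 \<inter> V2)) \<and> x \<in> carrier M \<and> y \<in> carrier N}"

lemma H_eq: "H = generate (add_grp C) rels"
  unfolding tensor_rel_def rels_def[symmetric]
  by (simp add: formal_pairs_def C_def, rule generate_extend)

lemma P_Int: "r \<in> P (V1 \<inter> V2) \<Longrightarrow> r \<in> P V1" "r \<in> P (V1 \<inter> V2) \<Longrightarrow> r \<in> P V2"
  by (auto intro: P_mono)

lemma rels_C: "rels \<subseteq> C"
  by (auto simp: rels_def intro!: add_closedD(2)[OF C] frag_C
      intro: M.add_closed N.add_closed M.smult_closed N.smult_closed P_Int)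

lemma H: "add_closed H" "H \<subseteq> C"
  unfolding H_eq using generate_add_closed[OF C rels_C] by auto

lemma rels_H: "z \<in> rels \<Longrightarrow> z \<in> H"
  unfolding H_eq by (rule generate.incl)

lemma H_add1: "x \<in> carrier M \<Longrightarrow> x' \<in> carrier M \<Longrightarrow> y \<in> carrier N \<Longrightarrow>
    frag_of (x \<oplus>\<^bsub>M\<^esub> x', y) - (frag_of (x, y) + frag_of (x', y)) \<in> H"
  unfolding diff_diff_eq[symmetric] by (rule rels_H) (auto simp: rels_def)

lemma H_add2: "x \<in> carrier M \<Longrightarrow> y \<in> carrier N \<Longrightarrow> y' \<in> carrier N \<Longrightarrow>
    frag_of (x, y \<oplus>\<^bsub>N\<^esub> y') - (frag_of (x, y) + frag_of (x, y')) \<in> H"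
  unfolding diff_diff_eq[symmetric] by (rule rels_H) (auto simp: rels_def)

lemma H_smult: "r \<in> P (V1 \<inter> V2) \<Longrightarrow> x \<in> carrier M \<Longrightarrow> y \<in> carrier N \<Longrightarrow>
    frag_of (r \<odot>\<^bsub>M\<^esub> x, y) - frag_of (x, r \<odot>\<^bsub>N\<^esub> y) \<in> H"
  by (rule rels_H) (auto simp: rels_def)

text \<open>The easy half of the description of \<open>H\<close>: products of coordinates are
  biadditive and balanced, so the generating relations go to \<open>0\<close>.\<close>

lemma Phi_H: "z \<in> H \<Longrightarrow> \<Phi> z ij = 0"
proof -
  have "H \<subseteq> {z. \<forall>ij. \<Phi> z ij = 0}"
    unfolding H_eq
  proof (rule generate_subset[OF C rels_C])
    show "add_closed {z. \<forall>ij. \<Phi> z ij = 0}"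
      by (simp add: add_closed_def pair_coord_diff)
    show "rels \<subseteq> {z. \<forall>ij. \<Phi> z ij = 0}"
      by (auto simp: rels_def pair_coord_diff M.phi_add N.phi_add M.phi_smult N.phi_smult P_Int ring_distribs mult_ac)
  qed
  then show "z \<in> H \<Longrightarrow> \<Phi> z ij = 0" by blast
qed

lemma H_zero1: "y \<in> carrier N \<Longrightarrow> frag_of (\<zero>\<^bsub>M\<^esub>, y) \<in> H"
proof -
  assume y: "y \<in> carrier N"
  have "\<zero>\<^bsub>M\<^esub> \<oplus>\<^bsub>M\<^esub> \<zero>\<^bsub>M\<^esub> = \<zero>\<^bsub>M\<^esub>"
    by (rule M.eqI) (auto simp: M.zero_closed M.add_closed M.phi_add M.phi_zero)
  then have "- frag_of (\<zero>\<^bsub>M\<^esub>, y) \<in> H"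
    using H_add1[OF M.zero_closed M.zero_closed y] by simp
  then show ?thesis using add_closedD(3)[OF H(1)] by fastforce
qed

lemma H_zero2: "x \<in> carrier M \<Longrightarrow> frag_of (x, \<zero>\<^bsub>N\<^esub>) \<in> H"
proof -
  assume x: "x \<in> carrier M"
  have "\<zero>\<^bsub>N\<^esub> \<oplus>\<^bsub>N\<^esub> \<zero>\<^bsub>N\<^esub> = \<zero>\<^bsub>N\<^esub>"
    by (rule N.eqI) (auto simp: N.zero_closed N.add_closed N.phi_add N.phi_zero)
  then have "- frag_of (x, \<zero>\<^bsub>N\<^esub>) \<in> H"
    using H_add2[OF x N.zero_closed N.zero_closed] by simp
  then show ?thesis using add_closedD(3)[OF H(1)] by fastforce
qed

lemma H_finsum1:
  assumes "finite A" "f \<in> A \<rightarrow> carrier M" "y \<in> carrier N"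
  shows "frag_of (finsum M f A, y) - (\<Sum>a \<in> A. frag_of (f a, y)) \<in> H"
  using assms
proof (induction A)
  case empty
  interpret abelian_group M by (rule M.abelian_group)
  show ?case using H_zero1 empty by simp
next
  case (insert a A)
  interpret abelian_group M by (rule M.abelian_group)
  have f: "f a \<in> carrier M" "f \<in> A \<rightarrow> carrier M" using insert by auto
  have "frag_of (finsum M f (insert a A), y) - (frag_of (f a, y) + frag_of (finsum M f A, y)) \<in> H"
    using insert f by (simp add: H_add1)
  moreover have "(frag_of (f a, y) + frag_of (finsum M f A, y)) - (\<Sum>a \<in> insert a A. frag_of (f a, y)) \<in> H"
    using insert f by simp
  ultimately show ?case by (rule add_closed_trans[OF H(1)])
qed

lemma H_finsum2:
  assumes "finite A" "f \<in> A \<rightarrow> carrier N" "x \<in> carrier M"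
  shows "frag_of (x, finsum N f A) - (\<Sum>a \<in> A. frag_of (x, f a)) \<in> H"
  using assms
proof (induction A)
  case empty
  interpret abelian_group N by (rule N.abelian_group)
  show ?case using H_zero2 empty by simp
next
  case (insert a A)
  interpret abelian_group N by (rule N.abelian_group)
  have f: "f a \<in> carrier N" "f \<in> A \<rightarrow> carrier N" using insert by auto
  have "frag_of (x, finsum N f (insert a A)) - (frag_of (x, f a) + frag_of (x, finsum N f A)) \<in> H"
    using insert f by (simp add: H_add2)
  moreover have "(frag_of (x, f a) + frag_of (x, finsum N f A)) - (\<Sum>a \<in> insert a A. frag_of (x, f a)) \<in> H"
    using insert f by simp
  ultimately show ?case by (rule add_closed_trans[OF H(1)])
qed

definition tm :: "(nat \<Rightarrow>\<^sub>0 nat) \<Rightarrow> rat \<Rightarrow> 'm \<Rightarrow> 'n \<Rightarrow> ('m \<times> 'n \<Rightarrow>\<^sub>0 int)" where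
  "tm t c x y = frag_of (single (mono_part V1 t) c \<odot>\<^bsub>M\<^esub> x,
     single (mono_part (- V1) t) 1 \<odot>\<^bsub>N\<^esub> y)"

text \<open>The action of \<open>p\<close> on a single pair before passing to the quotient. As a sum
  over the monomials of \<open>p\<close>, it is additive in \<open>p\<close> only modulo
  \<open>H\<close>.\<close>

definition Sm :: "rpoly \<Rightarrow> 'm \<Rightarrow> 'n \<Rightarrow> ('m \<times> 'n \<Rightarrow>\<^sub>0 int)" where
  "Sm p x y = (\<Sum>t \<in> keys p. tm t (lookup p t) x y)"

lemma formal_smult_frag_of: "formal_smult V1 M N p (frag_of (x, y)) = Sm p x y"
  by (simp add: formal_smult_def Sm_def tm_def)

lemma mono_P:
  assumes "keys t \<subseteq> V1 \<union> V2"
  shows "single (mono_part V1 t) c \<in> P V1" "single (mono_part (- V1) t) c \<in> P V2"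
  using assms by (auto intro!: P_single simp: keys_mono_part)

lemma tm_C:
  "keys t \<subseteq> V1 \<union> V2 \<Longrightarrow> x \<in> carrier M \<Longrightarrow> y \<in> carrier N \<Longrightarrow> tm t c x y \<in> C"
  unfolding tm_def by (intro frag_C M.smult_closed N.smult_closed mono_P)

lemma Phi_tm:
  assumes "keys t \<subseteq> V1 \<union> V2" "x \<in> carrier M" "y \<in> carrier N"
  shows "\<Phi> (tm t c x y) (i, j) = single t c * (\<phi> x i * \<psi> y j)"
proof -
  have "single t c = single (mono_part V1 t) c * single (mono_part (- V1) t) 1"
    by (simp add: mult_single mono_part_split)
  then show ?thesis
    using assms by (simp add: tm_def M.phi_smult N.phi_smult mono_P mult_ac)
qed

lemma Sm_C: "p \<in> P (V1 \<union> V2) \<Longrightarrow> x \<in> carrier M \<Longrightarrow> y \<in> carrier N \<Longrightarrow> Sm p x y \<in> C"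
  unfolding Sm_def by (rule add_closed_sum[OF C], rule tm_C) (auto simp: P_iff)

lemma Phi_Sm:
  assumes "p \<in> P (V1 \<union> V2)" "x \<in> carrier M" "y \<in> carrier N"
  shows "\<Phi> (Sm p x y) (i, j) = p * (\<phi> x i * \<psi> y j)"
proof -
  have "\<Phi> (Sm p x y) (i, j) = (\<Sum>t \<in> keys p.
      single t (lookup p t) * (\<phi> x i * \<psi> y j))"
    unfolding Sm_def pair_coord_sum using assms by (intro sum.cong refl Phi_tm) (auto simp: P_iff)
  also have "\<dots> = p * (\<phi> x i * \<psi> y j)"
    by (simp only: sum_distrib_right[symmetric] sum_monomials)
  finally show ?thesis .
qed

text \<open>Two defects are absorbed into \<open>H\<close>: the supports of \<open>p\<close>,
  \<open>q\<close> and \<open>p + q\<close> differ, and coefficients are added inside the first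
  entry of a pair. Padding the sums to a common support costs only terms with coefficient
  \<open>0\<close>, which lie in \<open>H\<close>.\<close>

lemma Sm_add:
  assumes "p \<in> P (V1 \<union> V2)" "q \<in> P (V1 \<union> V2)" and xy: "x \<in> carrier M" "y \<in> carrier N"
  shows "Sm (p + q) x y - (Sm p x y + Sm q x y) \<in> H"
proof -
  let ?A = "keys p \<union> keys q"
  have A: "keys t \<subseteq> V1 \<union> V2" if "t \<in> ?A" for t
    using that assms by (auto simp: P_iff)
  have z: "tm t 0 x y \<in> H" if "t \<in> ?A" for t
  proof -
    have "0 \<odot>\<^bsub>M\<^esub> x = \<zero>\<^bsub>M\<^esub>"
      by (rule M.eqI) (auto simp: xy M.smult_closed M.phi_smult M.zero_closed M.phi_zero)
    then show ?thesis
      unfolding tm_def using A[OF that] xy by (simp add: H_zero1 N.smult_closed mono_P)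
  qed
  have sup: "(\<Sum>t \<in> ?A. tm t (lookup r t) x y) - Sm r x y \<in> H"
    if "keys r \<subseteq> ?A" for r
  proof -
    have "(\<Sum>t \<in> ?A. tm t (lookup r t) x y) - Sm r x y =
        (\<Sum>t \<in> ?A - keys r. tm t (lookup r t) x y)"
      unfolding Sm_def using that by (subst sum_diff) auto
    also have "\<dots> \<in> H"
      by (rule add_closed_sum[OF H(1)]) (use z in \<open>auto simp: in_keys_iff\<close>)
    finally show ?thesis .
  qed
  have "tm t (a + b) x y - (tm t a x y + tm t b x y) \<in> H" if "t \<in> ?A" for t a b
  proof -
    have "single (mono_part V1 t) (a + b) \<odot>\<^bsub>M\<^esub> x =
      single (mono_part V1 t) a \<odot>\<^bsub>M\<^esub> x \<oplus>\<^bsub>M\<^esub> single (mono_part V1 t) b \<odot>\<^bsub>M\<^esub> x"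
      using A[OF that] xy
      by (intro M.eqI) (auto simp: M.smult_closed M.phi_smult M.add_closed M.phi_add mono_P single_add ring_distribs)
    then show ?thesis
      unfolding tm_def using A[OF that] xy by (simp add: H_add1 M.smult_closed N.smult_closed mono_P)
  qed
  then have "(\<Sum>t \<in> ?A. tm t (lookup (p + q) t) x y) -
      (\<Sum>t \<in> ?A. tm t (lookup p t) x y + tm t (lookup q t) x y) \<in> H"
    by (intro add_closed_sum_mod[OF H(1)]) (simp add: lookup_add)
  note add_closed_trans[OF H(1) add_closed_sym[OF H(1) sup[OF keys_add[of p q]]] this]
  then have "Sm (p + q) x y - ((\<Sum>t \<in> ?A. tm t (lookup p t) x y) +
      (\<Sum>t \<in> ?A. tm t (lookup q t) x y)) \<in> H"
    unfolding sum.distrib .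
  moreover have "((\<Sum>t \<in> ?A. tm t (lookup p t) x y) +
      (\<Sum>t \<in> ?A. tm t (lookup q t) x y)) - (Sm p x y + Sm q x y) \<in> H"
    using add_closedD(4)[OF H(1) sup[of p] sup[of q]] by (simp add: algebra_simps)
  ultimately show ?thesis by (rule add_closed_trans[OF H(1)])
qed

lemma P_Un: "p \<in> P V1 \<Longrightarrow> p \<in> P (V1 \<union> V2)" "p \<in> P V2 \<Longrightarrow> p \<in> P (V1 \<union> V2)"
  by (auto intro: P_mono)

lemma Sm_zero [simp]: "Sm 0 x y = 0"
  by (simp add: Sm_def)

text \<open>\<open>formal_smult\<close> moves all variables of \<open>V1\<close> to the left entry,
  while \<open>q\<close> may contain variables common to both rings. On monomials the common part of
  \<open>q\<close> is carried across by a balancing relation; the rest is additivity in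
  \<open>q\<close> and in \<open>p\<close>.\<close>

lemma Sm_mult:
  assumes p: "p \<in> P V1" and q: "q \<in> P V2" and xy: "x \<in> carrier M" "y \<in> carrier N"
  shows "Sm (p * q) x y - frag_of (p \<odot>\<^bsub>M\<^esub> x, q \<odot>\<^bsub>N\<^esub> y) \<in> H"
proof -
  have "0 \<odot>\<^bsub>M\<^esub> x = \<zero>\<^bsub>M\<^esub>" "0 \<odot>\<^bsub>N\<^esub> y = \<zero>\<^bsub>N\<^esub>"
    by (rule M.eqI N.eqI; auto simp: xy M.smult_closed M.phi_smult M.zero_closed M.phi_zero
        N.smult_closed N.phi_smult N.zero_closed N.phi_zero)+
  then have z1: "\<And>y'. y' \<in> carrier N \<Longrightarrow> frag_of (0 \<odot>\<^bsub>M\<^esub> x, y') \<in> H"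
    and z2: "\<And>x'. x' \<in> carrier M \<Longrightarrow> frag_of (x', 0 \<odot>\<^bsub>N\<^esub> y) \<in> H"
    by (simp_all add: H_zero1 H_zero2)
  have 1: "Sm (single t a * single u b) x y
      - frag_of (single t a \<odot>\<^bsub>M\<^esub> x, single u b \<odot>\<^bsub>N\<^esub> y) \<in> H"
    if t: "keys t \<subseteq> V1" and u: "keys u \<subseteq> V2" for t u a b
  \<comment> \<open>A product with coefficient \<open>0\<close> has no monomials, so
    \<open>Sm\<close> is the empty sum and the general computation does not cover it.\<close>
  proof (cases "a * b = 0")
    case True
    then have "a = 0 \<or> b = 0" by simp
    then show ?thesis
      using z1[of "single u b \<odot>\<^bsub>N\<^esub> y"] z2[of "single t a \<odot>\<^bsub>M\<^esub> x"] t u xy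
        add_closedD(3)[OF H(1)]
      by (auto simp: N.smult_closed M.smult_closed P_single)
  next
    case False
    \<comment> \<open>\<open>u'\<close> collects the variables shared by both rings,
      \<open>u''\<close> those of the second ring alone.\<close>
    define u' where "u' = mono_part V1 u"
    define u'' where "u'' = mono_part (- V1) u"
    have mp: "mono_part V1 (t + u) = t + u'" "mono_part (- V1) (t + u) = u''"
      using t by (auto simp: u'_def u''_def mono_part_add mono_part_id mono_part_none disjoint_iff subset_iff)
    have r: "single u' b \<in> P (V1 \<inter> V2)" "single u'' 1 \<in> P V2"
      using u by (auto intro!: P_single simp: u'_def u''_def keys_mono_part)
    have pt: "single t a \<in> P V1" "single u b \<in> P V2"
      using t u by (auto intro!: P_single)
    have uu: "single u' b * single u'' 1 = single u b"
      by (simp add: mult_single u'_def u''_def mono_part_split)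
    have "Sm (single t a * single u b) x y =
        frag_of ((single u' b * single t a) \<odot>\<^bsub>M\<^esub> x, single u'' 1 \<odot>\<^bsub>N\<^esub> y)"
      using False by (simp add: Sm_def tm_def mult_single mp add.commute mult.commute)
    also have "(single u' b * single t a) \<odot>\<^bsub>M\<^esub> x =
        single u' b \<odot>\<^bsub>M\<^esub> (single t a \<odot>\<^bsub>M\<^esub> x)"
      using xy r P_Int pt by (intro M.eqI) (auto simp: M.smult_closed M.phi_smult mult.assoc)
    finally have e: "Sm (single t a * single u b) x y = frag_of
        (single u' b \<odot>\<^bsub>M\<^esub> (single t a \<odot>\<^bsub>M\<^esub> x), single u'' 1 \<odot>\<^bsub>N\<^esub> y)" .
    have "single u' b \<odot>\<^bsub>N\<^esub> (single u'' 1 \<odot>\<^bsub>N\<^esub> y) = single u b \<odot>\<^bsub>N\<^esub> y"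
      using xy r P_Int pt by (intro N.eqI) (auto simp: N.smult_closed N.phi_smult simp flip: mult.assoc uu)
    then show ?thesis
      using H_smult[OF r(1), of "single t a \<odot>\<^bsub>M\<^esub> x" "single u'' 1 \<odot>\<^bsub>N\<^esub> y"]
        xy r pt by (simp add: e M.smult_closed N.smult_closed)
  qed
  have 2: "Sm (single t a * q) x y
      - frag_of (single t a \<odot>\<^bsub>M\<^esub> x, q \<odot>\<^bsub>N\<^esub> y) \<in> H \<and> q \<in> P V2"
    if t: "keys t \<subseteq> V1" for t a
    using q
  proof (induction rule: sum_monomials_induct)
    case (monomial u b)
    then show ?case using 1 t by (auto intro: P_single)
  next
    case zero
    show ?case
      using z2[of "single t a \<odot>\<^bsub>M\<^esub> x"] t xy add_closedD(3)[OF H(1)]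
      by (auto simp: M.smult_closed P_single)
  next
    case (add q r)
    let ?t = "single t a"
    have pt: "?t \<in> P V1" using t by (auto intro!: P_single)
    have "Sm (?t * q + ?t * r) x y - (Sm (?t * q) x y + Sm (?t * r) x y) \<in> H"
      using add pt xy by (intro Sm_add P_mult) (auto intro: P_Un)
    moreover have "(Sm (?t * q) x y + Sm (?t * r) x y)
        - (frag_of (?t \<odot>\<^bsub>M\<^esub> x, q \<odot>\<^bsub>N\<^esub> y) + frag_of (?t \<odot>\<^bsub>M\<^esub> x, r \<odot>\<^bsub>N\<^esub> y)) \<in> H"
      using add_closedD(4)[OF H(1) conjunct1[OF add(1)] conjunct1[OF add(2)]] by (simp add: algebra_simps)
    moreover have "(frag_of (?t \<odot>\<^bsub>M\<^esub> x, q \<odot>\<^bsub>N\<^esub> y) + frag_of (?t \<odot>\<^bsub>M\<^esub> x, r \<odot>\<^bsub>N\<^esub> y)) - frag_of (?t \<odot>\<^bsub>M\<^esub> x, (q + r) \<odot>\<^bsub>N\<^esub> y) \<in> H"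
    proof -
      have eq: "(q + r) \<odot>\<^bsub>N\<^esub> y = q \<odot>\<^bsub>N\<^esub> y \<oplus>\<^bsub>N\<^esub> r \<odot>\<^bsub>N\<^esub> y"
        using add xy by (intro N.eqI) (auto simp: N.smult_closed N.phi_smult N.add_closed N.phi_add ring_distribs)
      show ?thesis
        unfolding eq using conjunct2[OF add(1)] conjunct2[OF add(2)] pt xy
        by (intro add_closed_sym[OF H(1) H_add2] M.smult_closed N.smult_closed)
    qed
    ultimately show ?case
      unfolding distrib_left
      using conjunct2[OF add(1)] conjunct2[OF add(2)]
      by (intro conjI P_add) (erule add_closed_trans[OF H(1)], erule add_closed_trans[OF H(1)])
  qed
  have "Sm (p * q) x y - frag_of (p \<odot>\<^bsub>M\<^esub> x, q \<odot>\<^bsub>N\<^esub> y) \<in> H \<and> p \<in> P V1"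
    using p
  proof (induction rule: sum_monomials_induct)
    case (monomial u b)
    then show ?case using 2 by (auto intro: P_single)
  next
    case zero
    show ?case
      using z1[of "q \<odot>\<^bsub>N\<^esub> y"] q xy add_closedD(3)[OF H(1)]
      by (auto simp: N.smult_closed)
  next
    case (add p r)
    have "Sm (p * q + r * q) x y - (Sm (p * q) x y + Sm (r * q) x y) \<in> H"
      using add q xy by (intro Sm_add P_mult) (auto intro: P_Un)
    moreover have "(Sm (p * q) x y + Sm (r * q) x y)
        - (frag_of (p \<odot>\<^bsub>M\<^esub> x, q \<odot>\<^bsub>N\<^esub> y) + frag_of (r \<odot>\<^bsub>M\<^esub> x, q \<odot>\<^bsub>N\<^esub> y)) \<in> H"
      using add_closedD(4)[OF H(1) conjunct1[OF add(1)] conjunct1[OF add(2)]] by (simp add: algebra_simps)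
    moreover have "(frag_of (p \<odot>\<^bsub>M\<^esub> x, q \<odot>\<^bsub>N\<^esub> y) + frag_of (r \<odot>\<^bsub>M\<^esub> x, q \<odot>\<^bsub>N\<^esub> y)) - frag_of ((p + r) \<odot>\<^bsub>M\<^esub> x, q \<odot>\<^bsub>N\<^esub> y) \<in> H"
    proof -
      have eq: "(p + r) \<odot>\<^bsub>M\<^esub> x = p \<odot>\<^bsub>M\<^esub> x \<oplus>\<^bsub>M\<^esub> r \<odot>\<^bsub>M\<^esub> x"
        using add xy by (intro M.eqI) (auto simp: M.smult_closed M.phi_smult M.add_closed M.phi_add ring_distribs)
      show ?thesis
        unfolding eq using conjunct2[OF add(1)] conjunct2[OF add(2)] q xy
        by (intro add_closed_sym[OF H(1) H_add1] M.smult_closed N.smult_closed)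
    qed
    ultimately show ?case
      unfolding distrib_right
      using conjunct2[OF add(1)] conjunct2[OF add(2)]
      by (intro conjI P_add) (erule add_closed_trans[OF H(1)], erule add_closed_trans[OF H(1)])
  qed
  then show ?thesis ..
qed

definition eM :: "'i \<Rightarrow> 'm" where "eM i = M.elt (\<lambda>i'. if i' = i then 1 else 0)"
definition eN :: "'j \<Rightarrow> 'n" where "eN j = N.elt (\<lambda>j'. if j' = j then 1 else 0)"

lemma eM: "i \<in> I \<Longrightarrow> eM i \<in> carrier M" "i \<in> I \<Longrightarrow> \<phi> (eM i) i' = (if i' = i then 1 else 0)"
  and eN: "j \<in> J \<Longrightarrow> eN j \<in> carrier N" "j \<in> J \<Longrightarrow> \<psi> (eN j) j' = (if j' = j then 1 else 0)"
proof -
  have "(\<lambda>i'. if i' = i then 1 else 0) \<in> fam V1 I" if "i \<in> I" for i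
    using that by (auto simp: fam_def)
  then show "i \<in> I \<Longrightarrow> eM i \<in> carrier M" "i \<in> I \<Longrightarrow> \<phi> (eM i) i' = (if i' = i then 1 else 0)"
    by (auto simp: eM_def M.elt)
  have "(\<lambda>i'. if i' = i then 1 else 0) \<in> fam V2 J" if "i \<in> J" for i
    using that by (auto simp: fam_def)
  then show "j \<in> J \<Longrightarrow> eN j \<in> carrier N" "j \<in> J \<Longrightarrow> \<psi> (eN j) j' = (if j' = j then 1 else 0)"
    by (auto simp: eN_def N.elt)
qed

text \<open>A normal form with prescribed coordinates. Every formal sum is congruent to the normal
  form of its own coordinates (\<open>C_nf\<close>); this is the hard half of the claim that
  \<open>H\<close> is the kernel of the coordinate map.\<close>

definition nf :: "('i \<times> 'j \<Rightarrow> rpoly) \<Rightarrow> ('m \<times> 'n \<Rightarrow>\<^sub>0 int)" where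
  "nf F = (\<Sum>(i, j) \<in> I \<times> J. Sm (F (i, j)) (eM i) (eN j))"

lemma nf_C: "F \<in> fam (V1 \<union> V2) (I \<times> J) \<Longrightarrow> nf F \<in> C"
  unfolding nf_def by (rule add_closed_sum[OF C]) (use eM eN Sm_C in \<open>force simp: fam_def\<close>)

lemma Phi_nf:
  assumes "F \<in> fam (V1 \<union> V2) (I \<times> J)"
  shows "\<Phi> (nf F) = F"
proof
  fix ij :: "'i \<times> 'j" obtain i j where ij: "ij = (i, j)" by fastforce
  have "\<Phi> (nf F) (i, j) = (\<Sum>a \<in> I \<times> J. if a = (i, j) then F (i, j) else 0)"
    unfolding nf_def pair_coord_sum
  proof (rule sum.cong[OF refl], clarify)
    fix i' j' assume "i' \<in> I" "j' \<in> J"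
    moreover have "F (i', j') \<in> P (V1 \<union> V2)" using assms by (simp add: fam_def)
    ultimately show "\<Phi> (Sm (F (i', j')) (eM i') (eN j')) (i, j) = (if (i', j') = (i, j) then F (i, j) else 0)"
      by (simp add: Phi_Sm eM eN)
  qed
  also have "\<dots> = F (i, j)"
    using assms M.finite_I N.finite_I by (auto simp: fam_def)
  finally show "\<Phi> (nf F) ij = F ij" by (simp add: ij)
qed

lemma Phi_fam: "z \<in> C \<Longrightarrow> \<Phi> z \<in> fam (V1 \<union> V2) (I \<times> J)"
proof -
  assume "z \<in> C"
  then have "keys z \<subseteq> carrier M \<times> carrier N" by (simp add: C_def)
  then show ?thesis
  proof (induction z rule: frag_induction)
    case (one a)
    then show ?case
      by (cases a) (auto simp: fam_def M.phi_off N.phi_off intro!: P_mult[OF P_Un(1)[OF M.phi_P] P_Un(2)[OF N.phi_P]])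
  qed (auto simp: fam_def pair_coord_diff)
qed

lemma nf_diff:
  assumes "F \<in> fam (V1 \<union> V2) (I \<times> J)" "G \<in> fam (V1 \<union> V2) (I \<times> J)"
  shows "(nf F - nf G) - nf (\<lambda>ij. F ij - G ij) \<in> H"
proof -
  have "(Sm p x y - Sm q x y) - Sm (p - q) x y \<in> H"
    if "p \<in> P (V1 \<union> V2)" "q \<in> P (V1 \<union> V2)" "x \<in> carrier M" "y \<in> carrier N" for p q x y
    using Sm_add[of "p - q" q x y] that by (simp add: algebra_simps)
  then have "(\<Sum>(i, j) \<in> I \<times> J. Sm (F (i, j)) (eM i) (eN j) - Sm (G (i, j)) (eM i) (eN j)) - nf (\<lambda>ij. F ij - G ij) \<in> H"
    unfolding nf_def using assms eM eN by (intro add_closed_sum_mod[OF H(1)]) (auto simp: fam_def)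
  then show ?thesis by (simp add: nf_def sum_subtractf split_def)
qed

text \<open>Expand both entries in the bases, distribute the pair over the two sums, and gather the
  coefficients into one scalar with \<open>Sm_mult\<close>.\<close>

lemma frag_nf:
  assumes xy: "x \<in> carrier M" "y \<in> carrier N"
  shows "frag_of (x, y) - nf (\<Phi> (frag_of (x, y))) \<in> H"
proof -
  let ?X = "\<lambda>i. \<phi> x i \<odot>\<^bsub>M\<^esub> eM i" and ?Y = "\<lambda>j. \<psi> y j \<odot>\<^bsub>N\<^esub> eN j"
  have X: "?X \<in> I \<rightarrow> carrier M" and Y: "?Y \<in> J \<rightarrow> carrier N"
    using xy eM eN by (auto intro!: M.smult_closed N.smult_closed M.phi_P N.phi_P)
  have "(\<Sum>i' \<in> I. \<phi> (?X i') i) = \<phi> x i" for i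
  proof -
    have "(\<Sum>i' \<in> I. \<phi> (?X i') i) = (\<Sum>i' \<in> I. if i' = i then \<phi> x i else 0)"
      using xy eM by (intro sum.cong refl) (auto simp: M.phi_smult M.phi_P)
    then show ?thesis using M.finite_I M.phi_off[OF xy(1)] by simp
  qed
  then have x: "finsum M ?X I = x"
    using xy by (intro M.eqI M.phi_finsum(1)[OF M.finite_I X]) (auto simp: M.phi_finsum(2)[OF M.finite_I X])
  have "(\<Sum>j' \<in> J. \<psi> (?Y j') j) = \<psi> y j" for j
  proof -
    have "(\<Sum>j' \<in> J. \<psi> (?Y j') j) = (\<Sum>j' \<in> J. if j' = j then \<psi> y j else 0)"
      using xy eN by (intro sum.cong refl) (auto simp: N.phi_smult N.phi_P)
    then show ?thesis using N.finite_I N.phi_off[OF xy(2)] by simp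
  qed
  then have y: "finsum N ?Y J = y"
    using xy by (intro N.eqI N.phi_finsum(1)[OF N.finite_I Y]) (auto simp: N.phi_finsum(2)[OF N.finite_I Y])
  have 1: "frag_of (x, y) - (\<Sum>i \<in> I. frag_of (?X i, y)) \<in> H"
    using H_finsum1[OF M.finite_I X xy(2)] by (simp add: x)
  have 2: "(\<Sum>i \<in> I. frag_of (?X i, y)) - (\<Sum>i \<in> I. \<Sum>j \<in> J. frag_of (?X i, ?Y j)) \<in> H"
  proof (rule add_closed_sum_mod[OF H(1)])
    fix i assume "i \<in> I"
    then show "frag_of (?X i, y) - (\<Sum>j \<in> J. frag_of (?X i, ?Y j)) \<in> H"
      using H_finsum2[OF N.finite_I Y, of "?X i"] X by (auto simp: y)
  qed
  have "(\<Sum>i \<in> I. \<Sum>j \<in> J. Sm (\<phi> x i * \<psi> y j) (eM i) (eN j)) - (\<Sum>i \<in> I. \<Sum>j \<in> J. frag_of (?X i, ?Y j)) \<in> H"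
    by (intro add_closed_sum_mod[OF H(1)] Sm_mult M.phi_P N.phi_P eM eN xy)
  then have 3: "(\<Sum>i \<in> I. \<Sum>j \<in> J. frag_of (?X i, ?Y j)) - (\<Sum>i \<in> I. \<Sum>j \<in> J. Sm (\<phi> x i * \<psi> y j) (eM i) (eN j)) \<in> H"
    by (rule add_closed_sym[OF H(1)])
  have 4: "(\<Sum>i \<in> I. \<Sum>j \<in> J. Sm (\<phi> x i * \<psi> y j) (eM i) (eN j)) = nf (\<Phi> (frag_of (x, y)))"
    by (simp add: nf_def sum.cartesian_product)
  show ?thesis
    using add_closed_trans[OF H(1) add_closed_trans[OF H(1) 1 2] 3] unfolding 4 .
qed

lemma C_nf: "z \<in> C \<Longrightarrow> z - nf (\<Phi> z) \<in> H"
proof -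
  assume "z \<in> C"
  then have "keys z \<subseteq> carrier M \<times> carrier N" by (simp add: C_def)
  then have "z \<in> C \<and> z - nf (\<Phi> z) \<in> H"
  proof (induction z rule: frag_induction)
    case zero
    show ?case using add_closedD(1)[OF H(1)] add_closedD(1)[OF C]
      by (simp add: nf_def Sm_def split_def)
  next
    case (one a)
    then show ?case using frag_nf frag_C by (cases a) (auto)
  next
    case (diff a b)
    have 1: "(a - b) - (nf (\<Phi> a) - nf (\<Phi> b)) \<in> H"
      using diff add_closedD(2)[OF H(1), of "a - nf (\<Phi> a)" "b - nf (\<Phi> b)"] by (simp add: algebra_simps)
    have 2: "(nf (\<Phi> a) - nf (\<Phi> b)) - nf (\<lambda>ij. \<Phi> a ij - \<Phi> b ij) \<in> H"
      using diff by (intro nf_diff Phi_fam) auto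
    have "\<Phi> (a - b) = (\<lambda>ij. \<Phi> a ij - \<Phi> b ij)"
      by (simp add: pair_coord_diff fun_eq_iff)
    then have "a - b - nf (\<Phi> (a - b)) \<in> H"
      using add_closed_trans[OF H(1) 1 2] by (simp only:)
    then show ?case
      using add_closedD(2)[OF C] diff by blast
  qed
  then show ?thesis ..
qed

lemma H_kernel: "H = {z \<in> C. \<forall>ij. \<Phi> z ij = 0}"
proof (intro equalityI subsetI)
  fix z assume "z \<in> {z \<in> C. \<forall>ij. \<Phi> z ij = 0}"
  then have "z \<in> C" "\<Phi> z = (\<lambda>_. 0)" by (auto simp: fun_eq_iff)
  then show "z \<in> H" using C_nf[of z] by (simp add: nf_def Sm_def split_def)
qed (use H(2) Phi_H in blast)

lemma smult_C_Phi:
  assumes "p \<in> P (V1 \<union> V2)" "z \<in> C"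
  shows "formal_smult V1 M N p z \<in> C" "\<Phi> (formal_smult V1 M N p z) ij = p * \<Phi> z ij"
proof -
  have "keys z \<subseteq> carrier M \<times> carrier N" using assms by (simp add: C_def)
  then have "formal_smult V1 M N p z \<in> C \<and> (\<forall>ij. \<Phi> (formal_smult V1 M N p z) ij = p * \<Phi> z ij)"
  proof (induction z rule: frag_induction)
    case zero
    then show ?case using add_closedD(1)[OF C] by (simp add: formal_smult_def)
  next
    case (one a)
    then show ?case
      using Sm_C[OF assms(1)] Phi_Sm[OF assms(1)] by (cases a) (auto simp: formal_smult_frag_of)
  next
    case (diff a b)
    have "formal_smult V1 M N p (a - b) = formal_smult V1 M N p a - formal_smult V1 M N p b"
      by (simp add: formal_smult_def frag_extend_diff)
    then show ?case
      using diff add_closedD(2)[OF C] by (simp add: pair_coord_diff right_diff_distrib)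
  qed
  then show "formal_smult V1 M N p z \<in> C" "\<Phi> (formal_smult V1 M N p z) ij = p * \<Phi> z ij" by blast+
qed

definition gens :: "int \<Rightarrow> ('m \<times> 'n \<Rightarrow>\<^sub>0 int) set" where
  "gens k = {frag_of (x, y) | x y. \<exists>i j. i + j = k \<and> x \<in> grade M i \<and> y \<in> grade N j}"

lemma gensI: "x \<in> grade M i \<Longrightarrow> y \<in> grade N j \<Longrightarrow> i + j = k \<Longrightarrow> frag_of (x, y) \<in> gens k"
  by (auto simp: gens_def)

lemma grade_FP: "grade FP k = generate (add_grp C) (gens k)"
  by (simp add: formal_pairs_def gens_def C_def)

lemma gens_C: "gens k \<subseteq> C"
  unfolding gens_def by (clarify, rule frag_C) (auto simp: M.grade_eq N.grade_eq)

text \<open>Every homogeneous family is reached by its normal form, whose terms are pairs of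
  homogeneous elements: the degree of a monomial is divided between its two parts.\<close>

lemma Phi_grade:
  "\<Phi> ` grade FP k = {F \<in> fam (V1 \<union> V2) (I \<times> J). \<forall>ij. homogeneous (k - (\<delta> (fst ij) + \<epsilon> (snd ij))) (F ij)}"
    (is "_ = ?R")
proof (intro equalityI subsetI)
  fix F assume "F \<in> \<Phi> ` grade FP k"
  then obtain z where z: "z \<in> grade FP k" "F = \<Phi> z" by auto
  have "grade FP k \<subseteq> {z. \<forall>ij. homogeneous (k - (\<delta> (fst ij) + \<epsilon> (snd ij))) (\<Phi> z ij)}"
    unfolding grade_FP
  proof (rule generate_subset[OF C gens_C])
    show "gens k \<subseteq> {z. \<forall>ij. homogeneous (k - (\<delta> (fst ij) + \<epsilon> (snd ij))) (\<Phi> z ij)}"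
      by (auto simp: gens_def M.grade_eq N.grade_eq intro!: homogeneous_mult')
  qed (auto simp: add_closed_def pair_coord_diff homogeneous_diff)
  moreover have "z \<in> C" using z generate_add_closed(2)[OF C gens_C, of k] unfolding grade_FP by blast
  ultimately show "F \<in> ?R" using z Phi_fam by auto
next
  fix F assume F: "F \<in> ?R"
  have "nf F \<in> grade FP k"
    unfolding nf_def Sm_def grade_FP split_def
  proof (intro add_closed_sum generate_add_closed[OF C gens_C])
    fix ij t assume ij: "ij \<in> I \<times> J" and t: "t \<in> keys (F (fst ij, snd ij))"
    have "F (fst ij, snd ij) \<in> P (V1 \<union> V2)"
      using F unfolding fam_def by blast
    then have "keys t \<subseteq> V1 \<union> V2"
      using t unfolding P_iff by blast
    note tP = mono_P[OF this]
    have deg: "mono_deg t = k - (\<delta> (fst ij) + \<epsilon> (snd ij))"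
      using F t unfolding homogeneous_def by auto
    let ?t' = "mono_part V1 t" and ?t'' = "mono_part (- V1) t"
    let ?c = "lookup (F (fst ij, snd ij)) t"
    have "mono_deg ?t' + mono_deg ?t'' = mono_deg t"
      by (simp add: mono_part_split flip: mono_deg_add)
    then have "(mono_deg ?t' + \<delta> (fst ij)) + (mono_deg ?t'' + \<epsilon> (snd ij)) = k"
      using deg by simp
    moreover have "single ?t' ?c \<odot>\<^bsub>M\<^esub> eM (fst ij) \<in> grade M (mono_deg ?t' + \<delta> (fst ij))"
      using ij tP by (auto simp: M.grade_eq eM M.smult_closed M.phi_smult homogeneous_single)
    moreover have "single ?t'' 1 \<odot>\<^bsub>N\<^esub> eN (snd ij) \<in> grade N (mono_deg ?t'' + \<epsilon> (snd ij))"
      using ij tP by (auto simp: N.grade_eq eN N.smult_closed N.phi_smult homogeneous_single)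
    ultimately have "tm t ?c (eM (fst ij)) (eN (snd ij)) \<in> gens k"
      unfolding tm_def by (intro gensI)
    then show "tm t ?c (eM (fst ij)) (eN (snd ij)) \<in> generate (add_grp C) (gens k)"
      by (rule generate.incl)
  qed
  moreover have "F = \<Phi> (nf F)" using F Phi_nf by auto
  ultimately show "F \<in> \<Phi> ` grade FP k" by blast
qed

sublocale quotient_coords "V1 \<union> V2" "I \<times> J" "\<lambda>ij. \<delta> (fst ij) + \<epsilon> (snd ij)" \<Phi> FP H
proof
  have car: "carrier FP = C" by (simp add: formal_pairs_def C_def)
  show "add_closed (carrier FP)" using C by (simp add: car)
  show "H = {x \<in> carrier FP. \<forall>i. \<Phi> x i = 0}" unfolding car by (rule H_kernel)
  show "\<Phi> ` carrier FP = fam (V1 \<union> V2) (I \<times> J)"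
    unfolding car
  proof (intro equalityI image_subsetI subsetI)
    fix F assume F: "F \<in> fam (V1 \<union> V2) (I \<times> J)"
    show "F \<in> \<Phi> ` C"
      using imageI[OF nf_C[OF F], of \<Phi>] by (simp only: Phi_nf[OF F])
  qed (rule Phi_fam)
  show "smult FP p x \<in> carrier FP" if "p \<in> P (V1 \<union> V2)" "x \<in> carrier FP" for p x
    using smult_C_Phi(1)[OF that(1), of x] that(2) unfolding car by (simp add: formal_pairs_def)
  show "\<Phi> (smult FP p x) i = p * \<Phi> x i" if "p \<in> P (V1 \<union> V2)" "x \<in> carrier FP" for p x i
    using smult_C_Phi(2)[OF that(1), of x] that(2) unfolding car by (simp add: formal_pairs_def)
  show "grade FP k \<subseteq> carrier FP" for k
    unfolding car grade_FP by (rule generate_add_closed(2)[OF C gens_C])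
  show "\<Phi> ` grade FP k = {F \<in> fam (V1 \<union> V2) (I \<times> J). \<forall>ij. homogeneous (k - (\<delta> (fst ij) + \<epsilon> (snd ij))) (F ij)}" for k
    by (rule Phi_grade)
qed (simp_all add: formal_pairs_def pair_coord_add M.finite_I N.finite_I)

lemma coords_tensor: "coords (V1 \<union> V2) (I \<times> J) (\<lambda>ij. \<delta> (fst ij) + \<epsilon> (snd ij)) (tensor_coord \<phi> \<psi>)
    (tensor_module V1 V2 M N)"
  using coords_quot unfolding tensor_module_def tensor_coord_def cls_def[abs_def] .

end

text \<open>An additive map of formal sums is determined by its values on single pairs, so an
  additive \<open>L\<close> that is right on products of coordinates describes the induced map
  everywhere.\<close>

lemma tensor_map_coord:
  assumes "tensor_coords V1 V2 I J \<delta> \<epsilon> \<phi> \<psi> M N"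
    and "tensor_coords V1 V2 I' J' \<delta>' \<epsilon>' \<phi>' \<psi>' M' N'"
    and f: "f \<in> carrier M \<rightarrow> carrier M'" and g: "g \<in> carrier N \<rightarrow> carrier N'"
    and L0: "\<And>ij. L (\<lambda>_. 0) ij = 0"
    and Ldiff: "\<And>F G ij. L (\<lambda>ij. F ij - G ij) ij = L F ij - L G ij"
    and L: "\<And>x y i j. x \<in> carrier M \<Longrightarrow> y \<in> carrier N \<Longrightarrow>
      L (\<lambda>ij. \<phi> x (fst ij) * \<psi> y (snd ij)) (i, j) = \<phi>' (f x) i * \<psi>' (g y) j"
    and X: "X \<in> carrier (tensor_module V1 V2 M N)"
  shows "tensor_map V1 V2 M' N' f g X \<in> carrier (tensor_module V1 V2 M' N')"
    "tensor_coord \<phi>' \<psi>' (tensor_map V1 V2 M' N' f g X) = L (tensor_coord \<phi> \<psi> X)"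
proof -
  interpret T: tensor_coords V1 V2 I J \<delta> \<epsilon> \<phi> \<psi> M N by fact
  interpret T': tensor_coords V1 V2 I' J' \<delta>' \<epsilon>' \<phi>' \<psi>' M' N' by fact
  obtain F where F: "F \<in> fam (V1 \<union> V2) (I \<times> J)" "X = T.fib F"
    using X T.carrier_quot unfolding tensor_module_def by auto
  then obtain z where z: "z \<in> T.fib F" using T.fib_nonempty by blast
  let ?m = "frag_extend (\<lambda>(x, y). frag_of (f x, g y))"
  have m: "?m z \<in> T'.C \<and> T'.\<Phi> (?m z) = L (T.\<Phi> z)" if "z \<in> T.C" for z
  proof -
    have "keys z \<subseteq> carrier M \<times> carrier N" using that by (simp add: T.C_def)
    then show ?thesis
    proof (induction z rule: frag_induction)
      case zero
      have "T.\<Phi> 0 = (\<lambda>_. 0)" by (simp add: fun_eq_iff)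
      then show ?case using L0 add_closedD(1)[OF T'.C] by (simp add: fun_eq_iff)
    next
      case (one a)
      then obtain x y where a: "a = (x, y)" "x \<in> carrier M" "y \<in> carrier N" by auto
      have eq: "T.\<Phi> (frag_of (x, y)) = (\<lambda>ij. \<phi> x (fst ij) * \<psi> y (snd ij))"
        by (auto simp: fun_eq_iff)
      have "T'.\<Phi> (frag_of (f x, g y)) = L (T.\<Phi> (frag_of (x, y)))"
        unfolding eq using L[OF a(2,3)] by (intro ext, clarify) simp
      moreover have "frag_of (f x, g y) \<in> T'.C"
        using a f g by (intro T'.frag_C) auto
      ultimately show ?case
        by (simp add: a(1))
    next
      case (diff a b)
      have "T.\<Phi> (a - b) = (\<lambda>ij. T.\<Phi> a ij - T.\<Phi> b ij)"
        by (simp add: pair_coord_diff fun_eq_iff)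
      then show ?case
        using diff add_closedD(2)[OF T'.C]
        by (simp add: frag_extend_diff pair_coord_diff fun_eq_iff Ldiff)
    qed
  qed
  have car: "carrier T'.FP = T'.C" "carrier T.FP = T.C"
    by (simp_all add: formal_pairs_def T.C_def T'.C_def)
  \<comment> \<open>A whole fibre is sent into one fibre: this is the well-definedness of
    \<open>f \<otimes> g\<close>.\<close>
  have mz: "?m ` T.fib F \<subseteq> T'.fib (L F)"
    using m unfolding T.fib_def T'.fib_def car by auto
  have LF: "L F \<in> fam (V1 \<union> V2) (I' \<times> J')"
  proof -
    have "?m z \<in> T'.fib (L F)" using mz z by (rule subsetD[OF _ imageI])
    then have "?m z \<in> T'.C" "T'.\<Phi> (?m z) = L F"
      unfolding T'.fib_def car by simp_all
    then show ?thesis using T'.Phi_fam[of "?m z"] car by simp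
  qed
  have "tensor_map V1 V2 M' N' f g X = T'.fib (L F)"
    unfolding tensor_map_def quot_map_def F(2)
    by (rule T'.coset_absorb[OF _ mz]) (use z in blast)
  then show "tensor_map V1 V2 M' N' f g X \<in> carrier (tensor_module V1 V2 M' N')"
    "tensor_coord \<phi>' \<psi>' (tensor_map V1 V2 M' N' f g X) = L (tensor_coord \<phi> \<psi> X)"
    using LF F T'.carrier_quot T'.cls_fib[OF LF] T.cls_fib[OF F(1)]
    unfolding tensor_module_def T'.cls_def T.cls_def tensor_coord_def by auto
qed

section \<open>Factorizations in coordinates\<close>

declare add_bit_eq_xor [simp del]

lemma bit_simps [simp]: "(k :: bit) + 1 + 1 = k" "(k :: bit) - 1 = k + 1" "k + k = 0"
  by (cases k; simp)+

lemma bit_neq: "(k :: bit) \<noteq> l \<longleftrightarrow> k = l + 1"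
  by (cases k; cases l; simp)

section \<open>Coordinates on shifts, sums and relabellings\<close>

lemma coords_shift:
  assumes "coords V I \<delta> \<phi> M"
  shows "coords V I (\<lambda>i. \<delta> i + m) \<phi> (shift_module m M)"
proof -
  interpret coords V I \<delta> \<phi> M by fact
  show ?thesis
    by (rule coords.intro)
      (simp_all add: shift_module_def bij zero_closed phi_zero add_closed phi_add smult_closed phi_smult grade_eq finite_I
        diff_diff_eq add.commute)
qed

lemma coords_poly_module: "coords V {k} (\<lambda>_. 0) (\<lambda>x i. if i = k then x else 0) (poly_module V)"
proof (rule coords.intro)
  show "bij_betw (\<lambda>x i. if i = k then x else 0) (carrier (poly_module V)) (fam V {k})"
    by (rule bij_betw_byWitness[of _ "\<lambda>F. F k"]) (auto simp: poly_module_def fam_def fun_eq_iff)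
qed (auto simp: poly_module_def split: if_splits)

text \<open>The two coordinate maps share an index type and have disjoint supports, so they can
  simply be added. This fits the two summands in each part of a tensor factorization.\<close>

lemma coords_sum_disjoint:
  assumes "coords V I \<delta> \<phi> M" "coords V J \<delta> \<psi> N" "I \<inter> J = {}"
  shows "coords V (I \<union> J) \<delta> (\<lambda>xy i. \<phi> (fst xy) i + \<psi> (snd xy) i) (sum_module M N)"
proof -
  interpret M: coords V I \<delta> \<phi> M by fact
  interpret N: coords V J \<delta> \<psi> N by fact
  let ?\<phi> = "\<lambda>xy i. \<phi> (fst xy) i + \<psi> (snd xy) i"
  have r: "(\<lambda>i. if i \<in> I then F i else 0) \<in> fam V I" "(\<lambda>i. if i \<in> J then F i else 0) \<in> fam V J"
    if "F \<in> fam V (I \<union> J)" for F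
    using that by (auto simp: fam_def)
  show ?thesis
  proof (rule coords.intro)
    show "bij_betw ?\<phi> (carrier (sum_module M N)) (fam V (I \<union> J))"
    proof (rule bij_betw_byWitness[of _ "\<lambda>F. (M.elt (\<lambda>i. if i \<in> I then F i else 0), N.elt (\<lambda>i. if i \<in> J then F i else 0))"])
      show "\<forall>a\<in>carrier (sum_module M N). (M.elt (\<lambda>i. if i \<in> I then ?\<phi> a i else 0), N.elt (\<lambda>i. if i \<in> J then ?\<phi> a i else 0)) = a"
      proof
        fix a assume "a \<in> carrier (sum_module M N)"
        then obtain x y where a: "a = (x, y)" "x \<in> carrier M" "y \<in> carrier N" by (auto simp: sum_module_def)
        have "(\<lambda>i. if i \<in> I then ?\<phi> a i else 0) = \<phi> x" "(\<lambda>i. if i \<in> J then ?\<phi> a i else 0) = \<psi> y"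
          using assms(3) a M.phi_off[OF a(2)] N.phi_off[OF a(3)] by (auto simp: fun_eq_iff)
        then show "(M.elt (\<lambda>i. if i \<in> I then ?\<phi> a i else 0), N.elt (\<lambda>i. if i \<in> J then ?\<phi> a i else 0)) = a"
          using a M.elt N.elt by simp
      qed
      show "\<forall>F\<in>fam V (I \<union> J). ?\<phi> (M.elt (\<lambda>i. if i \<in> I then F i else 0), N.elt (\<lambda>i. if i \<in> J then F i else 0)) = F"
      proof
        fix F assume F: "F \<in> fam V (I \<union> J)"
        show "?\<phi> (M.elt (\<lambda>i. if i \<in> I then F i else 0), N.elt (\<lambda>i. if i \<in> J then F i else 0)) = F"
          using r[OF F] assms(3) F by (auto simp: M.elt N.elt fun_eq_iff fam_def)
      qed
      show "?\<phi> ` carrier (sum_module M N) \<subseteq> fam V (I \<union> J)"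
        by (auto simp: sum_module_def fam_def M.phi_P N.phi_P M.phi_off N.phi_off)
      show "(\<lambda>F. (M.elt (\<lambda>i. if i \<in> I then F i else 0), N.elt (\<lambda>i. if i \<in> J then F i else 0))) ` fam V (I \<union> J)
          \<subseteq> carrier (sum_module M N)"
        using r by (auto simp: sum_module_def M.elt N.elt)
    qed
    fix k
    show "grade (sum_module M N) k =
      {x \<in> carrier (sum_module M N). \<forall>i. homogeneous (k - \<delta> i) (\<phi> (fst x) i + \<psi> (snd x) i)}"
    proof (rule Set.set_eqI, clarify)
      fix x y
      have "homogeneous (k - \<delta> i) (\<phi> x i + \<psi> y i) \<longleftrightarrow>
          homogeneous (k - \<delta> i) (\<phi> x i) \<and> homogeneous (k - \<delta> i) (\<psi> y i)"
        if "x \<in> carrier M" "y \<in> carrier N" for i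
        using disjoint_iff[THEN iffD1, OF assms(3)] M.phi_off[OF that(1), of i] N.phi_off[OF that(2), of i]
        by (cases "i \<in> I") auto
      then show "(x, y) \<in> grade (sum_module M N) k \<longleftrightarrow>
        (x, y) \<in> {x \<in> carrier (sum_module M N). \<forall>i. homogeneous (k - \<delta> i) (\<phi> (fst x) i + \<psi> (snd x) i)}"
        by (auto simp: sum_module_def M.grade_eq N.grade_eq)
    qed
  qed (auto simp: sum_module_def M.zero_closed N.zero_closed M.phi_zero N.phi_zero M.add_closed N.add_closed
      M.phi_add N.phi_add M.smult_closed N.smult_closed M.phi_smult N.phi_smult M.finite_I N.finite_I algebra_simps)
qed

text \<open>Serves to change the index type, for instance to one half of a sum type.\<close>

lemma coords_relabel:
  fixes r :: "'l \<Rightarrow> 'i"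
  assumes "coords V I \<delta> \<phi> M" "bij_betw r K I" "\<And>l. l \<in> K \<Longrightarrow> \<delta>' l = \<delta> (r l)"
  shows "coords V K \<delta>' (\<lambda>x l. if l \<in> K then \<phi> x (r l) else 0) M"
proof -
  interpret coords V I \<delta> \<phi> M by fact
  let ?q = "the_inv_into K r"
  have q: "i \<in> I \<Longrightarrow> ?q i \<in> K" "i \<in> I \<Longrightarrow> r (?q i) = i" "l \<in> K \<Longrightarrow> ?q (r l) = l" "l \<in> K \<Longrightarrow> r l \<in> I" for i l
    using assms(2) by (auto simp: bij_betw_def the_inv_into_f_f f_the_inv_into_f intro!: the_inv_into_into)
  let ?f = "\<lambda>F l. if l \<in> K then F (r l) else 0"
  have "bij_betw ?f (fam V I) (fam V K)"
    by (rule bij_betw_byWitness[of _ "\<lambda>F i. if i \<in> I then F (?q i) else 0"])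
      (auto simp: fam_def fun_eq_iff q)
  then have "bij_betw (?f \<circ> \<phi>) (carrier M) (fam V K)"
    using bij bij_betw_trans by blast
  moreover have "?f \<circ> \<phi> = (\<lambda>x l. if l \<in> K then \<phi> x (r l) else 0)"
    by (simp add: fun_eq_iff)
  moreover have "grade M k = {x \<in> carrier M. \<forall>l. homogeneous (k - \<delta>' l) (if l \<in> K then \<phi> x (r l) else 0)}" for k
    unfolding grade_eq using assms(3) q phi_off by (auto, metis homogeneous_zero)
  moreover have "finite K"
    using finite_I assms(2) bij_betw_finite by blast
  ultimately show ?thesis
    by (intro coords.intro) (auto simp: zero_closed phi_zero add_closed phi_add smult_closed phi_smult)
qed

text \<open>A differential as a matrix on coordinate functions, both parities at once:
  \<open>par\<close> splits the indices. It acts on arbitrary polynomial values, independently of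
  any module, so that identities between operators need no carrier conditions; \<open>D_P\<close>
  supplies those separately.\<close>

locale odd_op =
  fixes n :: nat and V :: "nat set" and par :: "'i \<Rightarrow> bit" and \<delta> :: "'i \<Rightarrow> int"
    and D :: "('i \<Rightarrow> rpoly) \<Rightarrow> 'i \<Rightarrow> rpoly"
  assumes D_diff: "D (\<lambda>i. F i - G i) i = D F i - D G i"
    and D_mult: "D (\<lambda>i. p * F i) i = p * D F i"
    and D_P: "V \<subseteq> U \<Longrightarrow> (\<And>i. F i \<in> P U) \<Longrightarrow> D F i \<in> P U"
    and D_par: "(\<And>i. par i \<noteq> k \<Longrightarrow> F i = 0) \<Longrightarrow> par i \<noteq> k + 1 \<Longrightarrow> D F i = 0"
    and D_graded: "(\<And>i. homogeneous (d - \<delta> i) (F i)) \<Longrightarrow> homogeneous (d + int n + 1 - \<delta> i) (D F i)"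
begin

lemma D_zero: "D (\<lambda>_. 0) i = 0"
  using D_mult[of 0 "\<lambda>_. 0" i] by simp

lemma D_add: "D (\<lambda>i. F i + G i) i = D F i + D G i"
proof -
  have "D (\<lambda>i. - G i) i = - D G i"
    using D_mult[of "- 1" G i] by simp
  then show ?thesis using D_diff[of F "\<lambda>i. - G i" i] by simp
qed

end

locale fact_coords = odd_op n V par \<delta> D
  for n V and par :: "'i \<Rightarrow> bit" and \<delta> D +
  fixes \<phi> :: "bit \<Rightarrow> 'm \<Rightarrow> 'i \<Rightarrow> rpoly" and X :: "'m factorization"
  assumes coords: "coords V {i. par i = k} \<delta> (\<phi> k) (fmod X k)"
    and diff_closed: "x \<in> carrier (fmod X k) \<Longrightarrow> fdiff X k x \<in> carrier (fmod X (k + 1))"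
    and phi_diff: "x \<in> carrier (fmod X k) \<Longrightarrow> \<phi> (k + 1) (fdiff X k x) = D (\<phi> k x)"

lemma odd_op_shift:
  assumes "odd_op n V par \<delta> D"
  shows "odd_op n V par (\<lambda>i. \<delta> i + m) D"
proof -
  interpret odd_op n V par \<delta> D by fact
  have graded: "homogeneous (d + int n + 1 - (\<delta> i + m)) (D F i)"
    if "\<And>i. homogeneous (d - (\<delta> i + m)) (F i)" for d F i
    using D_graded[of "d - m" F i] that by (simp add: algebra_simps)
  show ?thesis
    by (intro odd_op.intro) (simp_all add: D_diff D_mult D_P graded, rule D_par)
qed

lemma fact_coords_shift:
  assumes "fact_coords n V par \<delta> D \<phi> X"
  shows "fact_coords n V par (\<lambda>i. \<delta> i + m) D \<phi> (shift_fact m X)"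
proof -
  interpret fact_coords n V par \<delta> D \<phi> X by fact
  show ?thesis
  proof (intro fact_coords.intro fact_coords_axioms.intro)
    show "odd_op n V par (\<lambda>i. \<delta> i + m) D"
      by (rule odd_op_shift) unfold_locales
    show "coords V {i. par i = k} (\<lambda>i. \<delta> i + m) (\<phi> k) (fmod (shift_fact m X) k)" for k
      using coords_shift[OF coords] by (simp add: shift_fact_def)
  qed (simp_all add: shift_fact_def shift_module_def diff_closed phi_diff)
qed

section \<open>Koszul factorizations in coordinates\<close>

definition koszul_op :: "rpoly \<Rightarrow> rpoly \<Rightarrow> (bit \<Rightarrow> rpoly) \<Rightarrow> bit \<Rightarrow> rpoly" where
  "koszul_op a b F i = (if i = 0 then b * F 1 else a * F 0)"

definition koszul_deg :: "nat \<Rightarrow> int \<Rightarrow> bit \<Rightarrow> int" where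
  "koszul_deg n d i = (if i = 0 then 0 else int n + 1 - d)"

text \<open>\<open>d\<close> is the degree of \<open>a\<close>; the degree of \<open>b\<close> is
  then forced by \<open>deg a + deg b = 2n + 2\<close>.\<close>

lemma odd_op_koszul:
  assumes "a \<in> P V" "b \<in> P V" "homogeneous d a" "homogeneous (2 * int n + 2 - d) b"
  shows "odd_op n V id (koszul_deg n d) (koszul_op a b)"
proof
  fix F :: "bit \<Rightarrow> rpoly" and i k :: bit and e :: int
  show "koszul_op a b F i = 0" if "\<And>i. id i \<noteq> k \<Longrightarrow> F i = 0" "id i \<noteq> k + 1"
    using that(1)[of 0] that(1)[of 1] that(2) by (cases k; cases i) (auto simp: koszul_op_def)
  show "homogeneous (e + int n + 1 - koszul_deg n d i) (koszul_op a b F i)"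
    if "\<And>i. homogeneous (e - koszul_deg n d i) (F i)"
    using that[of 0] that[of 1] assms by (auto simp: koszul_op_def koszul_deg_def intro!: homogeneous_mult')
  show "koszul_op a b F i \<in> P U" if "V \<subseteq> U" "\<And>i. F i \<in> P U" for U
    using that assms P_mono[OF that(1)] by (simp add: koszul_op_def)
qed (auto simp: koszul_op_def algebra_simps)

lemma fact_coords_koszul:
  assumes "a \<in> P V" "b \<in> P V" "homogeneous d a" "poly_deg a = d" "homogeneous (2 * int n + 2 - d) b"
  shows "fact_coords n V id (koszul_deg n d) (koszul_op a b) (\<lambda>k x i. if i = k then x else 0) (koszul n V a b)"
proof (intro fact_coords.intro fact_coords_axioms.intro)
  show "odd_op n V id (koszul_deg n d) (koszul_op a b)"
    by (rule odd_op_koszul[OF assms(1,2,3,5)])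
  fix k :: bit
  have "{i. id i = k} = {k}" by auto
  moreover have "koszul_deg n d k = (if k = 0 then 0 else int n + 1 - d)" by (simp add: koszul_deg_def)
  ultimately show "coords V {i. id i = k} (koszul_deg n d) (\<lambda>x i. if i = k then x else 0) (fmod (koszul n V a b) k)"
    using coords_relabel[OF coords_poly_module[of V k], of id "{k}" "\<lambda>_. 0"]
      coords_relabel[OF coords_shift[OF coords_poly_module[of V k], of "int n + 1 - d"], of id "{k}" "koszul_deg n d"]
      coords_relabel[OF coords_poly_module[of V k], of id "{k}" "koszul_deg n d"]
    by (auto simp: koszul_def koszul_deg_def assms(4) cong: if_cong)
  show "fdiff (koszul n V a b) k x \<in> carrier (fmod (koszul n V a b) (k + 1))"
    if "x \<in> carrier (fmod (koszul n V a b) k)" for x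
    using that assms by (cases k) (auto simp: koszul_def shift_module_def poly_module_def)
  show "(\<lambda>i. if i = k + 1 then fdiff (koszul n V a b) k x else 0) = koszul_op a b (\<lambda>i. if i = k then x else 0)"
    if "x \<in> carrier (fmod (koszul n V a b) k)" for x
  proof
    fix i show "(if i = k + 1 then fdiff (koszul n V a b) k x else 0) = koszul_op a b (\<lambda>i. if i = k then x else 0) i"
      by (cases k; cases i) (auto simp: koszul_def koszul_op_def)
  qed
qed

section \<open>Tensor products and sums of factorizations in coordinates\<close>

definition tensor_op :: "('i \<Rightarrow> bit) \<Rightarrow> (('i \<Rightarrow> rpoly) \<Rightarrow> 'i \<Rightarrow> rpoly) \<Rightarrow> (('j \<Rightarrow> rpoly) \<Rightarrow> 'j \<Rightarrow> rpoly) \<Rightarrow>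
    ('i \<times> 'j \<Rightarrow> rpoly) \<Rightarrow> 'i \<times> 'j \<Rightarrow> rpoly" where
  "tensor_op par D E F = (\<lambda>(i, j). D (\<lambda>i'. F (i', j)) i +
     (if par i = 0 then E (\<lambda>j'. F (i, j')) j else - E (\<lambda>j'. F (i, j')) j))"

text \<open>Each operator acts with the other index held fixed, which merely shifts the parity and
  the degree that it sees.\<close>

lemma odd_op_tensor:
  assumes "odd_op n V1 par \<delta> D" "odd_op n V2 par' \<epsilon> E"
  shows "odd_op n (V1 \<union> V2) (\<lambda>ij. par (fst ij) + par' (snd ij)) (\<lambda>ij. \<delta> (fst ij) + \<epsilon> (snd ij)) (tensor_op par D E)"
proof -
  interpret D: odd_op n V1 par \<delta> D by fact
  interpret E: odd_op n V2 par' \<epsilon> E by fact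
  show ?thesis
  proof
    fix F G :: "'a \<times> 'b \<Rightarrow> rpoly" and ij :: "'a \<times> 'b" and p :: rpoly and k :: bit and d :: int
    obtain i j where ij: "ij = (i, j)" by fastforce
    show "tensor_op par D E (\<lambda>i. F i - G i) ij = tensor_op par D E F ij - tensor_op par D E G ij"
      by (simp add: ij tensor_op_def D.D_diff E.D_diff)
    show "tensor_op par D E (\<lambda>i. p * F i) ij = p * tensor_op par D E F ij"
      by (simp add: ij tensor_op_def D.D_mult E.D_mult algebra_simps)
    show "tensor_op par D E F ij \<in> P U" if "V1 \<union> V2 \<subseteq> U" "\<And>ij. F ij \<in> P U" for U
      using that by (auto simp: ij tensor_op_def intro!: P_add P_diff D.D_P E.D_P)
    show "tensor_op par D E F ij = 0" if F: "\<And>ij. par (fst ij) + par' (snd ij) \<noteq> k \<Longrightarrow> F ij = 0"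
      "par (fst ij) + par' (snd ij) \<noteq> k + 1"
    proof -
      have "D (\<lambda>i'. F (i', j)) i = 0"
      proof (rule D.D_par[of "k + par' j"])
        show "F (i', j) = 0" if "par i' \<noteq> k + par' j" for i'
          by (rule F(1)) (use that in \<open>cases k; cases "par i'"; cases "par' j"; auto\<close>)
        show "par i \<noteq> k + par' j + 1"
          using F(2) by (cases k; cases "par i"; cases "par' j") (auto simp: ij)
      qed
      moreover have "E (\<lambda>j'. F (i, j')) j = 0"
      proof (rule E.D_par[of "k + par i"])
        show "F (i, j') = 0" if "par' j' \<noteq> k + par i" for j'
          by (rule F(1)) (use that in \<open>cases k; cases "par i"; cases "par' j'"; auto\<close>)
        show "par' j \<noteq> k + par i + 1"
          using F(2) by (cases k; cases "par i"; cases "par' j") (auto simp: ij)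
      qed
      ultimately show ?thesis by (simp add: ij tensor_op_def)
    qed
    show "homogeneous (d + int n + 1 - (\<delta> (fst ij) + \<epsilon> (snd ij))) (tensor_op par D E F ij)"
      if F: "\<And>ij. homogeneous (d - (\<delta> (fst ij) + \<epsilon> (snd ij))) (F ij)"
    proof -
      have "homogeneous (d - \<epsilon> j + int n + 1 - \<delta> i) (D (\<lambda>i'. F (i', j)) i)"
        by (rule D.D_graded) (use F[of "(_, j)"] in \<open>simp add: algebra_simps\<close>)
      moreover have "homogeneous (d - \<delta> i + int n + 1 - \<epsilon> j) (E (\<lambda>j'. F (i, j')) j)"
        by (rule E.D_graded) (use F[of "(i, _)"] in \<open>simp add: algebra_simps\<close>)
      ultimately show ?thesis
        by (auto simp: ij tensor_op_def algebra_simps intro!: homogeneous_add homogeneous_diff)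
    qed
  qed
qed

definition tensor_fact_coord ::
  "(bit \<Rightarrow> 'm \<Rightarrow> 'i \<Rightarrow> rpoly) \<Rightarrow> (bit \<Rightarrow> 'n \<Rightarrow> 'j \<Rightarrow> rpoly) \<Rightarrow> bit \<Rightarrow>
     ('m \<times> 'n \<Rightarrow>\<^sub>0 int) set \<times> ('m \<times> 'n \<Rightarrow>\<^sub>0 int) set \<Rightarrow> 'i \<times> 'j \<Rightarrow> rpoly" where
  "tensor_fact_coord \<phi> \<psi> k = (\<lambda>xy ij. tensor_coord (\<phi> 0) (\<psi> k) (fst xy) ij + tensor_coord (\<phi> 1) (\<psi> (k + 1)) (snd xy) ij)"

text \<open>By \<open>tensor_map_coord\<close> the maps \<open>d \<otimes> 1\<close> and
  \<open>1 \<otimes> d\<close> act in one index only. The module of index \<open>k\<close> has the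
  coordinates with \<open>par i + par' j = k\<close>, divided between its two summands by the value
  of \<open>par i\<close>.\<close>

lemma fact_coords_tensor:
  assumes "fact_coords n V1 par \<delta> D \<phi> X" "fact_coords n V2 par' \<epsilon> E \<psi> Y"
  shows "fact_coords n (V1 \<union> V2) (\<lambda>ij. par (fst ij) + par' (snd ij)) (\<lambda>ij. \<delta> (fst ij) + \<epsilon> (snd ij))
    (tensor_op par D E) (tensor_fact_coord \<phi> \<psi>) (tensor_fact V1 V2 X Y)"
proof -
  interpret X: fact_coords n V1 par \<delta> D \<phi> X by fact
  interpret Y: fact_coords n V2 par' \<epsilon> E \<psi> Y by fact
  interpret odd_op n "V1 \<union> V2" "\<lambda>ij. par (fst ij) + par' (snd ij)" "\<lambda>ij. \<delta> (fst ij) + \<epsilon> (snd ij)" "tensor_op par D E"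
    by (rule odd_op_tensor) unfold_locales
  have TC: "tensor_coords V1 V2 {i. par i = a} {j. par' j = b} \<delta> \<epsilon> (\<phi> a) (\<psi> b) (fmod X a) (fmod Y b)" for a b
    by (intro tensor_coords.intro X.coords Y.coords)
  define T where "T a b = tensor_module V1 V2 (fmod X a) (fmod Y b)" for a b
  define \<tau> where "\<tau> a b = tensor_coord (\<phi> a) (\<psi> b)" for a b
  have T: "coords (V1 \<union> V2) ({i. par i = a} \<times> {j. par' j = b}) (\<lambda>ij. \<delta> (fst ij) + \<epsilon> (snd ij)) (\<tau> a b) (T a b)" for a b
    unfolding T_def \<tau>_def by (rule tensor_coords.coords_tensor[OF TC])
  define dl where "dl a b = tensor_map V1 V2 (fmod X (a + 1)) (fmod Y b) (fdiff X a) id" for a b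
  define dr where "dr a b = tensor_map V1 V2 (fmod X a) (fmod Y (b + 1)) id (fdiff Y b)" for a b
  have dl: "dl a b x \<in> carrier (T (a + 1) b)"
    "\<tau> (a + 1) b (dl a b x) = (\<lambda>(i, j). D (\<lambda>i'. \<tau> a b x (i', j)) i)" if "x \<in> carrier (T a b)" for a b x
  proof -
    let ?L = "\<lambda>F. \<lambda>(i, j). D (\<lambda>i'. F (i', j)) i"
    have "?L (\<lambda>ij. \<phi> a x (fst ij) * \<psi> b y (snd ij)) (i, j) = \<phi> (a + 1) (fdiff X a x) i * \<psi> b (id y) j"
      if "x \<in> carrier (fmod X a)" "y \<in> carrier (fmod Y b)" for x y i j
      using X.phi_diff[OF that(1)] X.D_mult[of "\<psi> b y j" "\<phi> a x" i] by (simp add: mult.commute)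
    then have "dl a b x \<in> carrier (T (a + 1) b) \<and> \<tau> (a + 1) b (dl a b x) = ?L (\<tau> a b x)"
      using that unfolding dl_def T_def \<tau>_def
      by (intro conjI tensor_map_coord[OF TC TC, where L = ?L])
        (simp_all add: X.D_zero X.D_diff X.diff_closed split: prod.split)
    then show "dl a b x \<in> carrier (T (a + 1) b)" "\<tau> (a + 1) b (dl a b x) = (\<lambda>(i, j). D (\<lambda>i'. \<tau> a b x (i', j)) i)"
      by auto
  qed
  have dr: "dr a b x \<in> carrier (T a (b + 1))"
    "\<tau> a (b + 1) (dr a b x) = (\<lambda>(i, j). E (\<lambda>j'. \<tau> a b x (i, j')) j)" if "x \<in> carrier (T a b)" for a b x
  proof -
    let ?L = "\<lambda>F. \<lambda>(i, j). E (\<lambda>j'. F (i, j')) j"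
    have "?L (\<lambda>ij. \<phi> a x (fst ij) * \<psi> b y (snd ij)) (i, j) = \<phi> a (id x) i * \<psi> (b + 1) (fdiff Y b y) j"
      if "x \<in> carrier (fmod X a)" "y \<in> carrier (fmod Y b)" for x y i j
      using Y.phi_diff[OF that(2)] Y.D_mult[of "\<phi> a x i" "\<psi> b y" j] by simp
    then have "dr a b x \<in> carrier (T a (b + 1)) \<and> \<tau> a (b + 1) (dr a b x) = ?L (\<tau> a b x)"
      using that unfolding dr_def T_def \<tau>_def
      by (intro conjI tensor_map_coord[OF TC TC, where L = ?L])
        (simp_all add: Y.D_zero Y.D_diff Y.diff_closed split: prod.split)
    then show "dr a b x \<in> carrier (T a (b + 1))" "\<tau> a (b + 1) (dr a b x) = (\<lambda>(i, j). E (\<lambda>j'. \<tau> a b x (i, j')) j)"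
      by auto
  qed
  let ?Z = "tensor_fact V1 V2 X Y"
  have Z: "fmod ?Z k = sum_module (T 0 k) (T 1 (k + 1))"
    "fdiff ?Z k = (\<lambda>(x, y). (dl 1 (k + 1) y \<oplus>\<^bsub>T 0 (k + 1)\<^esub> dr 0 k x, dl 0 k x \<ominus>\<^bsub>T 1 k\<^esub> dr 1 (k + 1) y))" for k
    by (simp_all add: tensor_fact_def T_def dl_def dr_def Let_def)
  have tfc: "tensor_fact_coord \<phi> \<psi> k = (\<lambda>xy ij. \<tau> 0 k (fst xy) ij + \<tau> 1 (k + 1) (snd xy) ij)" for k
    by (simp add: tensor_fact_coord_def \<tau>_def)
  show ?thesis
  proof (intro fact_coords.intro fact_coords_axioms.intro)
    show "odd_op n (V1 \<union> V2) (\<lambda>ij. par (fst ij) + par' (snd ij)) (\<lambda>ij. \<delta> (fst ij) + \<epsilon> (snd ij)) (tensor_op par D E)"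
      by unfold_locales
    fix k
    have "{ij. par (fst ij) + par' (snd ij) = k} =
        {i. par i = 0} \<times> {j. par' j = k} \<union> {i. par i = 1} \<times> {j. par' j = k + 1}"
    proof (rule Set.set_eqI, clarify)
      fix i j show "(i, j) \<in> {ij. par (fst ij) + par' (snd ij) = k} \<longleftrightarrow>
        (i, j) \<in> {i. par i = 0} \<times> {j. par' j = k} \<union> {i. par i = 1} \<times> {j. par' j = k + 1}"
        by (cases k; cases "par i"; cases "par' j") auto
    qed
    then show "coords (V1 \<union> V2) {ij. par (fst ij) + par' (snd ij) = k} (\<lambda>ij. \<delta> (fst ij) + \<epsilon> (snd ij))
        (tensor_fact_coord \<phi> \<psi> k) (fmod ?Z k)"
      unfolding tfc Z by (simp only:) (rule coords_sum_disjoint[OF T T], auto)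
    fix xy assume "xy \<in> carrier (fmod ?Z k)"
    then obtain x y where xy: "xy = (x, y)" and x: "x \<in> carrier (T 0 k)" and y: "y \<in> carrier (T 1 (k + 1))"
      by (auto simp: Z sum_module_def)
    note c = dl[OF y] dr[OF x] dl[OF x] dr[OF y]
    note c = c[simplified]
    have 1: "dl 1 (k + 1) y \<oplus>\<^bsub>T 0 (k + 1)\<^esub> dr 0 k x \<in> carrier (T 0 (k + 1))"
      "\<tau> 0 (k + 1) (dl 1 (k + 1) y \<oplus>\<^bsub>T 0 (k + 1)\<^esub> dr 0 k x) ij = \<tau> 0 (k + 1) (dl 1 (k + 1) y) ij + \<tau> 0 (k + 1) (dr 0 k x) ij" for ij
      using coords.add_closed[OF T] coords.phi_add[OF T] c by auto
    have 2: "dl 0 k x \<ominus>\<^bsub>T 1 k\<^esub> dr 1 (k + 1) y \<in> carrier (T 1 k)"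
      "\<tau> 1 k (dl 0 k x \<ominus>\<^bsub>T 1 k\<^esub> dr 1 (k + 1) y) ij = \<tau> 1 k (dl 0 k x) ij - \<tau> 1 k (dr 1 (k + 1) y) ij" for ij
      using coords.phi_minus[OF T] c by auto
    show "fdiff ?Z k xy \<in> carrier (fmod ?Z (k + 1))"
      using 1 2 by (simp add: Z xy sum_module_def)
    show "tensor_fact_coord \<phi> \<psi> (k + 1) (fdiff ?Z k xy) = tensor_op par D E (tensor_fact_coord \<phi> \<psi> k xy)"
    proof (rule ext, clarify)
      fix i j
      \<comment> \<open>\<open>x\<close> is supported where \<open>par i = 0\<close> and
        \<open>y\<close> where \<open>par i = 1\<close>, so the case distinction in
        \<open>tensor_op\<close> reproduces the sign in the second component of the
        differential.\<close>
      have ox: "\<tau> 0 k x (i, j') = 0" if "par i \<noteq> 0" for j'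
        using coords.phi_off[OF T x] that by auto
      have oy: "\<tau> 1 (k + 1) y (i, j') = 0" if "par i = 0" for j'
        using coords.phi_off[OF T y] that by auto
      show "tensor_fact_coord \<phi> \<psi> (k + 1) (fdiff ?Z k xy) (i, j) = tensor_op par D E (tensor_fact_coord \<phi> \<psi> k xy) (i, j)"
        using ox oy
        by (simp add: tfc Z xy 1 2 c tensor_op_def X.D_add Y.D_add Y.D_zero)
    qed
  qed
qed

text \<open>The summands are separated by a sum type and not by disjoint supports, since two shifts
  of the same wide edge will be added.\<close>

lemma fact_coords_sum:
  assumes "fact_coords n V par \<delta> D \<phi> X" "fact_coords n V par' \<epsilon> E \<psi> Y"
  shows "fact_coords n V (case_sum par par') (case_sum \<delta> \<epsilon>)
    (\<lambda>F. case_sum (D (\<lambda>i. F (Inl i))) (E (\<lambda>j. F (Inr j))))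
    (\<lambda>k (x, y). case_sum (\<phi> k x) (\<psi> k y)) (sum_fact X Y)"
proof -
  interpret X: fact_coords n V par \<delta> D \<phi> X by fact
  interpret Y: fact_coords n V par' \<epsilon> E \<psi> Y by fact
  let ?par = "case_sum par par'" and ?\<delta> = "case_sum \<delta> \<epsilon>"
  show ?thesis
  proof (intro fact_coords.intro odd_op.intro fact_coords_axioms.intro)
    fix k
    let ?I = "{i. par i = k}" and ?J = "{j. par' j = k}"
    have l: "coords V (Inl ` ?I) ?\<delta> (\<lambda>x l. if l \<in> Inl ` ?I then \<phi> k x (projl l) else 0) (fmod X k)"
      by (rule coords_relabel[OF X.coords]) (auto simp: bij_betw_def inj_on_def image_image)
    have r: "coords V (Inr ` ?J) ?\<delta> (\<lambda>x l. if l \<in> Inr ` ?J then \<psi> k x (projr l) else 0) (fmod Y k)"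
      by (rule coords_relabel[OF Y.coords]) (auto simp: bij_betw_def inj_on_def image_image)
    interpret S: coords V "Inl ` ?I \<union> Inr ` ?J" ?\<delta> "\<lambda>xy l. (if l \<in> Inl ` ?I then \<phi> k (fst xy) (projl l) else 0) +
        (if l \<in> Inr ` ?J then \<psi> k (snd xy) (projr l) else 0)" "sum_module (fmod X k) (fmod Y k)"
      by (rule coords_sum_disjoint[OF l r]) auto
    have I: "{l. ?par l = k} = Inl ` ?I \<union> Inr ` ?J"
    proof (rule Set.set_eqI)
      fix l show "l \<in> {l. ?par l = k} \<longleftrightarrow> l \<in> Inl ` ?I \<union> Inr ` ?J" by (cases l) auto
    qed
    have eq: "(case_prod (\<lambda>x y. case_sum (\<phi> k x) (\<psi> k y)) xy) = (\<lambda>l. (if l \<in> Inl ` ?I then \<phi> k (fst xy) (projl l) else 0) +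
        (if l \<in> Inr ` ?J then \<psi> k (snd xy) (projr l) else 0))"
      if "xy \<in> carrier (sum_module (fmod X k) (fmod Y k))" for xy
    proof
      fix l
      from that obtain x y where xy: "xy = (x, y)" "x \<in> carrier (fmod X k)" "y \<in> carrier (fmod Y k)"
        by (auto simp: sum_module_def)
      show "(case_prod (\<lambda>x y. case_sum (\<phi> k x) (\<psi> k y)) xy) l = (if l \<in> Inl ` ?I then \<phi> k (fst xy) (projl l) else 0) +
        (if l \<in> Inr ` ?J then \<psi> k (snd xy) (projr l) else 0)"
        using xy coords.phi_off[OF X.coords xy(2)] coords.phi_off[OF Y.coords xy(3)] by (cases l) (auto simp: image_iff)
    qed
    have fm: "fmod (sum_fact X Y) k = sum_module (fmod X k) (fmod Y k)"
      by (simp add: sum_fact_def)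
    show "coords V {l. ?par l = k} ?\<delta> (case_prod (\<lambda>x y. case_sum (\<phi> k x) (\<psi> k y))) (fmod (sum_fact X Y) k)"
      unfolding fm I
    proof (rule coords.intro)
      show "bij_betw (case_prod (\<lambda>x y. case_sum (\<phi> k x) (\<psi> k y))) (carrier (sum_module (fmod X k) (fmod Y k))) (fam V (Inl ` ?I \<union> Inr ` ?J))"
        using S.bij by (subst bij_betw_cong[OF eq])
      show "grade (sum_module (fmod X k) (fmod Y k)) d = {x \<in> carrier (sum_module (fmod X k) (fmod Y k)).
         \<forall>i. homogeneous (d - ?\<delta> i) ((case_prod (\<lambda>x y. case_sum (\<phi> k x) (\<psi> k y)) x) i)}" for d
        unfolding S.grade_eq by (intro Collect_cong conj_cong refl) (simp only: eq)
    qed (use eq S.zero_closed S.phi_zero S.add_closed S.phi_add S.smult_closed S.phi_smult S.finite_I in \<open>simp_all only:\<close>)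
    fix xy assume "xy \<in> carrier (fmod (sum_fact X Y) k)"
    then obtain x y where xy: "xy = (x, y)" "x \<in> carrier (fmod X k)" "y \<in> carrier (fmod Y k)"
      by (auto simp: fm sum_module_def)
    then show "fdiff (sum_fact X Y) k xy \<in> carrier (fmod (sum_fact X Y) (k + 1))"
      by (simp add: sum_fact_def sum_module_def X.diff_closed Y.diff_closed)
    show "(case fdiff (sum_fact X Y) k xy of (x, y) \<Rightarrow> case_sum (\<phi> (k + 1) x) (\<psi> (k + 1) y)) =
       case_sum (D (\<lambda>i. (case xy of (x, y) \<Rightarrow> case_sum (\<phi> k x) (\<psi> k y)) (Inl i)))
         (E (\<lambda>j. (case xy of (x, y) \<Rightarrow> case_sum (\<phi> k x) (\<psi> k y)) (Inr j)))"
      using xy by (simp add: sum_fact_def X.phi_diff Y.phi_diff)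
  next
    fix F :: "'a + 'c \<Rightarrow> rpoly" and k i
    assume F: "\<And>i. ?par i \<noteq> k \<Longrightarrow> F i = 0" and i: "?par i \<noteq> k + 1"
    show "case_sum (D (\<lambda>i. F (Inl i))) (E (\<lambda>j. F (Inr j))) i = 0"
      using i F[of "Inl _"] F[of "Inr _"] X.D_par[of k "\<lambda>i. F (Inl i)"] Y.D_par[of k "\<lambda>j. F (Inr j)"] by (cases i) auto
  next
    fix F :: "'a + 'c \<Rightarrow> rpoly" and d i
    assume F: "\<And>i. homogeneous (d - ?\<delta> i) (F i)"
    show "homogeneous (d + int n + 1 - ?\<delta> i) (case_sum (D (\<lambda>i. F (Inl i))) (E (\<lambda>j. F (Inr j))) i)"
      using F[of "Inl _"] F[of "Inr _"] by (cases i) (auto intro: X.D_graded Y.D_graded)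
  next
    fix F :: "'a + 'c \<Rightarrow> rpoly" and U i
    assume "V \<subseteq> U" "\<And>i. F i \<in> P U"
    then show "case_sum (D (\<lambda>i. F (Inl i))) (E (\<lambda>j. F (Inr j))) i \<in> P U"
      by (cases i) (auto intro: X.D_P Y.D_P)
  qed (auto simp: X.D_diff X.D_mult Y.D_diff Y.D_mult split: sum.split)
qed

text \<open>The scalars are restricted to \<open>\<rat>[V']\<close>: freeness over the smaller ring
  is \<open>free_graded_module\<close>, the remaining conditions are operator identities read in
  coordinates.\<close>

lemma (in fact_coords) graded_factorization:
  assumes "V' \<subseteq> V" "finite V'" "w \<in> P V'" "homogeneous (2 * (int n + 1)) w"
    and DD: "\<And>F i. D (D F) i = w * F i"
  shows "graded_factorization n V' w X"
  unfolding graded_factorization_def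
proof (intro conjI allI ballI assms)
  fix k
  interpret C: coords V "{i. par i = k}" \<delta> "\<phi> k" "fmod X k" by (rule coords)
  interpret C': coords V "{i. par i = k + 1}" \<delta> "\<phi> (k + 1)" "fmod X (k + 1)" by (rule coords)
  show "free_graded_module V' (fmod X k)"
    by (rule C.free_graded_module[OF assms(1)])
  have sub: "p \<in> P V' \<Longrightarrow> p \<in> P V" for p using assms(1) by (rule P_mono)
  have eq: "\<phi> k (x \<oplus>\<^bsub>fmod X k\<^esub> y) = (\<lambda>i. \<phi> k x i + \<phi> k y i)"
     "p \<in> P V' \<Longrightarrow> \<phi> k (p \<odot>\<^bsub>fmod X k\<^esub> x) = (\<lambda>i. p * \<phi> k x i)"
    if "x \<in> carrier (fmod X k)" "y \<in> carrier (fmod X k)" for x y p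
    using that by (simp_all add: fun_eq_iff C.phi_add C.phi_smult sub)
  show "fdiff X k \<in> graded_hom V' (int n + 1) (fmod X k) (fmod X (k + 1))"
    unfolding graded_hom_def
  proof (intro CollectI conjI ballI allI subsetI)
    fix x y p assume "x \<in> carrier (fmod X k)" "y \<in> carrier (fmod X k)"
    then show "fdiff X k (x \<oplus>\<^bsub>fmod X k\<^esub> y) = fdiff X k x \<oplus>\<^bsub>fmod X (k + 1)\<^esub> fdiff X k y"
      by (intro C'.eqI) (simp_all add: diff_closed C.add_closed C'.add_closed C'.phi_add phi_diff D_add eq)
  next
    fix x p assume "x \<in> carrier (fmod X k)" "p \<in> P V'"
    then show "fdiff X k (p \<odot>\<^bsub>fmod X k\<^esub> x) = p \<odot>\<^bsub>fmod X (k + 1)\<^esub> fdiff X k x"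
      by (intro C'.eqI) (simp_all add: diff_closed C.smult_closed C'.smult_closed C'.phi_smult phi_diff D_mult eq sub)
  next
    fix d y assume "y \<in> fdiff X k ` grade (fmod X k) d"
    then show "y \<in> grade (fmod X (k + 1)) (d + (int n + 1))"
      using D_graded[of d] by (auto simp: C.grade_eq C'.grade_eq diff_closed phi_diff add.assoc)
  qed (auto simp: diff_closed)
  fix x assume x: "x \<in> carrier (fmod X k)"
  then have "fdiff X (k + 1) (fdiff X k x) \<in> carrier (fmod X k)"
    using diff_closed[OF diff_closed[OF x]] by simp
  moreover have "\<phi> k (fdiff X (k + 1) (fdiff X k x)) i = w * \<phi> k x i" for i
    using phi_diff[OF diff_closed[OF x]] phi_diff[OF x] DD by simp
  ultimately show "fdiff X (k + 1) (fdiff X k x) = w \<odot>\<^bsub>fmod X k\<^esub> x"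
    using x assms(3) by (intro C.eqI) (auto simp: C.smult_closed C.phi_smult sub)
qed

section \<open>Finite-dimensionality of the cohomology\<close>

lemma set_add_eqI:
  assumes "\<And>h z. h \<in> H \<Longrightarrow> z \<in> Y \<Longrightarrow> h \<oplus>\<^bsub>M\<^esub> g z \<in> X"
    and "\<And>y. y \<in> X \<Longrightarrow> \<exists>h \<in> H. \<exists>z \<in> Y. y = h \<oplus>\<^bsub>M\<^esub> g z"
  shows "set_add M H (g ` Y) = X"
proof (intro equalityI subsetI)
  fix y assume "y \<in> set_add M H (g ` Y)"
  then obtain h z where "h \<in> H" "z \<in> Y" "y = h \<oplus>\<^bsub>M\<^esub> g z"
    by (auto simp: set_add_def')
  then show "y \<in> X" using assms(1) by simp
next
  fix y assume "y \<in> X"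
  then obtain h z where "h \<in> H" "z \<in> Y" "y = h \<oplus>\<^bsub>M\<^esub> g z"
    using assms(2) by blast
  then show "y \<in> set_add M H (g ` Y)"
    by (auto simp: set_add_def')
qed

locale submodule_quotient = module "poly_ring V" M for V and M :: "'m pmodule" +
  fixes H :: "'m set"
  assumes sub: "submodule H (poly_ring V) M"
begin

sublocale H: abelian_subgroup H M
  by (intro abelian_subgroupI3 additive_subgroup.intro submodule.axioms(1)[OF sub]) unfold_locales

abbreviation "\<pi> \<equiv> a_r_coset M H"

lemma H_smult: "p \<in> P V \<Longrightarrow> x \<in> H \<Longrightarrow> p \<odot>\<^bsub>M\<^esub> x \<in> H"
  using submodule.smult_closed[OF sub] by simp

lemma mem_coset: "x \<in> carrier M \<Longrightarrow> y \<in> \<pi> x \<longleftrightarrow> y \<in> carrier M \<and> y \<ominus>\<^bsub>M\<^esub> x \<in> H"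
  using H.a_rcos_module[of x y] H.a_elemrcos_carrier[of x y] by (auto simp: a_minus_def)

lemma coset_cong: "x \<in> carrier M \<Longrightarrow> y \<in> carrier M \<Longrightarrow> x \<ominus>\<^bsub>M\<^esub> y \<in> H \<Longrightarrow> \<pi> x = \<pi> y"
  using a_repr_independence[of x H y] mem_coset[of y x] H.a_subgroup by simp

lemma coset_zero: "x \<in> H \<Longrightarrow> \<pi> x = H"
  by (rule H.a_rcos_const)

lemma coset_eq_H: "x \<in> carrier M \<Longrightarrow> \<pi> x = H \<longleftrightarrow> x \<in> H"
  using coset_zero H.a_rcos_self by blast

lemma coset_smult:
  assumes "p \<in> P V" "x \<in> carrier M"
  shows "set_add M H ((\<lambda>x. p \<odot>\<^bsub>M\<^esub> x) ` \<pi> x) = \<pi> (p \<odot>\<^bsub>M\<^esub> x)"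
proof -
  have "h \<oplus>\<^bsub>M\<^esub> p \<odot>\<^bsub>M\<^esub> z \<in> \<pi> (p \<odot>\<^bsub>M\<^esub> x)" if h: "h \<in> H" and "z \<in> \<pi> x" for h z
  proof -
    have z: "z \<in> carrier M" "z \<ominus>\<^bsub>M\<^esub> x \<in> H" using that assms mem_coset by auto
    have "p \<odot>\<^bsub>M\<^esub> z \<ominus>\<^bsub>M\<^esub> p \<odot>\<^bsub>M\<^esub> x = p \<odot>\<^bsub>M\<^esub> (z \<ominus>\<^bsub>M\<^esub> x)"
      using assms z by (simp add: a_minus_def smult_r_distr smult_r_minus)
    then have "\<pi> (p \<odot>\<^bsub>M\<^esub> z) = \<pi> (p \<odot>\<^bsub>M\<^esub> x)"
      using assms z by (intro coset_cong) (simp_all add: H_smult)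
    moreover have "h \<oplus>\<^bsub>M\<^esub> p \<odot>\<^bsub>M\<^esub> z \<in> \<pi> (p \<odot>\<^bsub>M\<^esub> z)"
      using h by (auto simp: a_r_coset_def')
    ultimately show ?thesis by simp
  qed
  moreover have "\<exists>h \<in> H. \<exists>z \<in> \<pi> x. y = h \<oplus>\<^bsub>M\<^esub> p \<odot>\<^bsub>M\<^esub> z" if "y \<in> \<pi> (p \<odot>\<^bsub>M\<^esub> x)" for y
  proof -
    from that obtain h where "h \<in> H" "y = h \<oplus>\<^bsub>M\<^esub> p \<odot>\<^bsub>M\<^esub> x"
      by (auto simp: a_r_coset_def')
    then show ?thesis using H.a_rcos_self[OF assms(2)] by blast
  qed
  ultimately show ?thesis by (rule set_add_eqI)
qed

abbreviation "Q \<equiv> quot_module M H"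

lemma carrier_Q: "carrier Q = \<pi> ` carrier M"
  by (auto simp: quot_module_def A_RCOSETS_def')

lemma zero_Q: "\<zero>\<^bsub>Q\<^esub> = H"
  by (simp add: quot_module_def)

lemma add_Q: "x \<in> carrier M \<Longrightarrow> y \<in> carrier M \<Longrightarrow> \<pi> x \<oplus>\<^bsub>Q\<^esub> \<pi> y = \<pi> (x \<oplus>\<^bsub>M\<^esub> y)"
  by (simp add: quot_module_def H.a_rcos_sum)

lemma smult_Q: "p \<in> P V \<Longrightarrow> x \<in> carrier M \<Longrightarrow> p \<odot>\<^bsub>Q\<^esub> \<pi> x = \<pi> (p \<odot>\<^bsub>M\<^esub> x)"
  by (simp add: quot_module_def coset_smult)

lemma zero_Q': "\<zero>\<^bsub>Q\<^esub> = \<pi> \<zero>\<^bsub>M\<^esub>"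
  by (simp add: zero_Q coset_zero)

lemma pi_closed: "x \<in> carrier M \<Longrightarrow> \<pi> x \<in> carrier Q"
  by (simp add: carrier_Q)

lemma module_Q: "module (poly_ring V) Q"
proof (rule moduleI)
  show "cring (poly_ring V)" by (rule cring_poly_ring)
  have rep: "X \<in> carrier Q \<Longrightarrow> \<exists>x \<in> carrier M. X = \<pi> x" for X by (auto simp: carrier_Q)
  show "Ring.abelian_group Q"
  proof (rule abelian_groupI)
    fix X Y assume "X \<in> carrier Q" "Y \<in> carrier Q"
    then obtain x y where xy: "x \<in> carrier M" "y \<in> carrier M" "X = \<pi> x" "Y = \<pi> y" using rep by blast
    then show "X \<oplus>\<^bsub>Q\<^esub> Y \<in> carrier Q" by (simp add: add_Q pi_closed)
    show "X \<oplus>\<^bsub>Q\<^esub> Y = Y \<oplus>\<^bsub>Q\<^esub> X" using xy by (simp add: add_Q a_comm)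
    fix Z assume "Z \<in> carrier Q"
    then obtain z where z: "z \<in> carrier M" "Z = \<pi> z" using rep by blast
    show "X \<oplus>\<^bsub>Q\<^esub> Y \<oplus>\<^bsub>Q\<^esub> Z = X \<oplus>\<^bsub>Q\<^esub> (Y \<oplus>\<^bsub>Q\<^esub> Z)" using xy z by (simp add: add_Q a_assoc)
  next
    fix X assume "X \<in> carrier Q"
    then obtain x where x: "x \<in> carrier M" "X = \<pi> x" using rep by blast
    show "\<zero>\<^bsub>Q\<^esub> \<oplus>\<^bsub>Q\<^esub> X = X" using x by (simp add: zero_Q' add_Q)
    show "\<exists>Y\<in>carrier Q. Y \<oplus>\<^bsub>Q\<^esub> X = \<zero>\<^bsub>Q\<^esub>"
      using x by (intro bexI[of _ "\<pi> (\<ominus>\<^bsub>M\<^esub> x)"]) (simp_all add: zero_Q' add_Q pi_closed l_neg)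
  qed (simp add: zero_Q' pi_closed)
  show "\<one>\<^bsub>poly_ring V\<^esub> \<odot>\<^bsub>Q\<^esub> X = X" if X: "X \<in> carrier Q" for X
  proof -
    obtain x where "x \<in> carrier M" "X = \<pi> x" using rep[OF X] by blast
    then show ?thesis using smult_Q[of 1 x] smult_one[of x] by simp
  qed
  fix p X assume p: "p \<in> P V" and "X \<in> carrier Q"
  then obtain x where x: "x \<in> carrier M" "X = \<pi> x" using rep by blast
  show "p \<odot>\<^bsub>Q\<^esub> X \<in> carrier Q" using x p by (simp add: smult_Q pi_closed)
  show "(p \<oplus>\<^bsub>poly_ring V\<^esub> q) \<odot>\<^bsub>Q\<^esub> X = p \<odot>\<^bsub>Q\<^esub> X \<oplus>\<^bsub>Q\<^esub> q \<odot>\<^bsub>Q\<^esub> X" if "q \<in> P V" for q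
    using x p that smult_l_distr[of p q x] smult_Q[of "p + q"] by (simp add: smult_Q add_Q)
  show "(p \<otimes>\<^bsub>poly_ring V\<^esub> q) \<odot>\<^bsub>Q\<^esub> X = p \<odot>\<^bsub>Q\<^esub> (q \<odot>\<^bsub>Q\<^esub> X)" if "q \<in> P V" for q
    using x p that smult_assoc1[of p q x] smult_Q[of "p * q"] by (simp add: smult_Q)
  fix Y assume "Y \<in> carrier Q"
  then obtain y where y: "y \<in> carrier M" "Y = \<pi> y" using rep by blast
  show "p \<odot>\<^bsub>Q\<^esub> (X \<oplus>\<^bsub>Q\<^esub> Y) = p \<odot>\<^bsub>Q\<^esub> X \<oplus>\<^bsub>Q\<^esub> p \<odot>\<^bsub>Q\<^esub> Y"
    using x y p by (simp add: smult_Q add_Q smult_r_distr)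
qed

end

lemma module_sub_module:
  assumes "module (poly_ring V) M" "submodule Z (poly_ring V) M"
  shows "module (poly_ring V) (sub_module M Z)"
proof -
  interpret M: module "poly_ring V" M by fact
  note E = M.submoduleE[OF assms(2)]
  have c: "x \<in> Z \<Longrightarrow> x \<in> carrier M" for x using E(1) by blast
  have z: "\<zero>\<^bsub>M\<^esub> \<in> Z"
    using subgroup.one_closed[OF submodule.axioms(1)[OF assms(2)]] by simp
  show ?thesis
  proof (rule moduleI)
    show "cring (poly_ring V)" by (rule cring_poly_ring)
    show "Ring.abelian_group (sub_module M Z)"
    proof (rule abelian_groupI)
      fix x assume "x \<in> carrier (sub_module M Z)"
      then show "\<exists>y\<in>carrier (sub_module M Z). y \<oplus>\<^bsub>sub_module M Z\<^esub> x = \<zero>\<^bsub>sub_module M Z\<^esub>"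
        using E(3) c by (intro bexI[of _ "\<ominus>\<^bsub>M\<^esub> x"]) (auto simp: sub_module_def M.l_neg)
    qed (auto simp: sub_module_def E z c M.a_ac)
  qed (use M.smult_l_distr M.smult_r_distr M.smult_assoc1 M.smult_one c E in \<open>auto simp: sub_module_def\<close>)
qed

lemma span_add:
  assumes "module (poly_ring V) M" "finite T" "T \<subseteq> carrier M" "t \<in> T"
  shows "finsum M (\<lambda>s. Const ((c(t := c t + a)) s) \<odot>\<^bsub>M\<^esub> s) T = Const a \<odot>\<^bsub>M\<^esub> t \<oplus>\<^bsub>M\<^esub> finsum M (\<lambda>s. Const (c s) \<odot>\<^bsub>M\<^esub> s) T"
proof -
  interpret M: module "poly_ring V" M by fact
  define U where "U = T - {t}"
  have T: "T = insert t U" "t \<notin> U" "finite U" "U \<subseteq> carrier M" "t \<in> carrier M"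
    using assms by (auto simp: U_def)
  have cl: "(\<lambda>s. Const (c s) \<odot>\<^bsub>M\<^esub> s) \<in> U \<rightarrow> carrier M" for c
    using T by (auto intro!: M.smult_closed)
  have "finsum M (\<lambda>s. Const ((c(t := c t + a)) s) \<odot>\<^bsub>M\<^esub> s) U = finsum M (\<lambda>s. Const (c s) \<odot>\<^bsub>M\<^esub> s) U"
    using T cl[of c] by (intro M.finsum_cong') auto
  moreover have "Const (c t + a) \<odot>\<^bsub>M\<^esub> t = Const (c t) \<odot>\<^bsub>M\<^esub> t \<oplus>\<^bsub>M\<^esub> Const a \<odot>\<^bsub>M\<^esub> t"
    using M.smult_l_distr[of "Const (c t)" "Const a" t] T by (simp add: Const_simps)
  ultimately show ?thesis
    using T cl[of c] cl[of "c(t := c t + a)"] M.finsum_closed[OF cl[of c]]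
    by (simp add: T(1) M.finsum_insert M.a_ac)
qed

text \<open>Different elements of \<open>S\<close> may have the same image, so their coefficients
  are accumulated by \<open>span_add\<close>.\<close>

lemma span_image:
  assumes "module (poly_ring V) M" "finite S" "\<And>s. s \<in> S \<Longrightarrow> \<eta> s \<in> carrier M"
  shows "\<exists>c'. finsum M (\<lambda>s. Const (c s) \<odot>\<^bsub>M\<^esub> \<eta> s) S = finsum M (\<lambda>t. Const (c' t) \<odot>\<^bsub>M\<^esub> t) (\<eta> ` S)"
proof -
  interpret M: module "poly_ring V" M by fact
  have T: "finite (\<eta> ` S)" "\<eta> ` S \<subseteq> carrier M" using assms by auto
  have "\<exists>c'. finsum M (\<lambda>s. Const (c s) \<odot>\<^bsub>M\<^esub> \<eta> s) A = finsum M (\<lambda>t. Const (c' t) \<odot>\<^bsub>M\<^esub> t) (\<eta> ` S)"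
    if "finite A" "A \<subseteq> S" for A
    using that
  proof (induction A)
    case empty
    have "0 \<odot>\<^bsub>M\<^esub> t = \<zero>\<^bsub>M\<^esub>" if "t \<in> carrier M" for t
      using M.smult_l_null[OF that] by simp
    then have "finsum M (\<lambda>t. Const 0 \<odot>\<^bsub>M\<^esub> t) (\<eta> ` S) = finsum M (\<lambda>t. \<zero>\<^bsub>M\<^esub>) (\<eta> ` S)"
      using T by (intro M.finsum_cong') (auto simp: Const_simps)
    then show ?case by (intro exI[of _ "\<lambda>_. 0"]) (simp add: M.finsum_zero)
  next
    case (insert s A)
    then obtain c' where c': "finsum M (\<lambda>s. Const (c s) \<odot>\<^bsub>M\<^esub> \<eta> s) A = finsum M (\<lambda>t. Const (c' t) \<odot>\<^bsub>M\<^esub> t) (\<eta> ` S)"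
      by auto
    have "finsum M (\<lambda>s. Const (c s) \<odot>\<^bsub>M\<^esub> \<eta> s) (insert s A) = Const (c s) \<odot>\<^bsub>M\<^esub> \<eta> s \<oplus>\<^bsub>M\<^esub> finsum M (\<lambda>s. Const (c s) \<odot>\<^bsub>M\<^esub> \<eta> s) A"
      using insert assms(3) by (intro M.finsum_insert) (auto intro!: M.smult_closed)
    also have "\<dots> = finsum M (\<lambda>t. Const ((c'(\<eta> s := c' (\<eta> s) + c s)) t) \<odot>\<^bsub>M\<^esub> t) (\<eta> ` S)"
      using insert unfolding c' by (intro span_add[OF assms(1) T, symmetric]) auto
    finally show ?case by (intro exI) assumption
  qed
  then show ?thesis using assms(2) by blast
qed

lemma graded_homD:
  assumes "f \<in> graded_hom V d M N"
  shows "x \<in> carrier M \<Longrightarrow> f x \<in> carrier N"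
    "x \<in> carrier M \<Longrightarrow> y \<in> carrier M \<Longrightarrow> f (x \<oplus>\<^bsub>M\<^esub> y) = f x \<oplus>\<^bsub>N\<^esub> f y"
    "p \<in> P V \<Longrightarrow> x \<in> carrier M \<Longrightarrow> f (p \<odot>\<^bsub>M\<^esub> x) = p \<odot>\<^bsub>N\<^esub> f x"
  using assms unfolding graded_hom_def by auto

lemma graded_hom_zero:
  assumes "f \<in> graded_hom V d M N" "module (poly_ring V) M" "module (poly_ring V) N"
  shows "f \<zero>\<^bsub>M\<^esub> = \<zero>\<^bsub>N\<^esub>" "x \<in> carrier M \<Longrightarrow> f (\<ominus>\<^bsub>M\<^esub> x) = \<ominus>\<^bsub>N\<^esub> f x"
    "x \<in> carrier M \<Longrightarrow> y \<in> carrier M \<Longrightarrow> f (x \<ominus>\<^bsub>M\<^esub> y) = f x \<ominus>\<^bsub>N\<^esub> f y"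
proof -
  interpret M: module "poly_ring V" M by fact
  interpret N: module "poly_ring V" N by fact
  note f = graded_homD[OF assms(1)]
  have "f (0 \<odot>\<^bsub>M\<^esub> \<zero>\<^bsub>M\<^esub>) = 0 \<odot>\<^bsub>N\<^esub> f \<zero>\<^bsub>M\<^esub>"
    by (rule f(3)) auto
  then show 0: "f \<zero>\<^bsub>M\<^esub> = \<zero>\<^bsub>N\<^esub>"
    using M.smult_l_null[of "\<zero>\<^bsub>M\<^esub>"] N.smult_l_null[OF f(1), of "\<zero>\<^bsub>M\<^esub>"] by simp
  show n: "f (\<ominus>\<^bsub>M\<^esub> x) = \<ominus>\<^bsub>N\<^esub> f x" if "x \<in> carrier M" for x
    using f(2)[of "\<ominus>\<^bsub>M\<^esub> x" x] that 0 f(1) by (intro N.minus_equality[symmetric]) (simp_all add: M.l_neg)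
  show "x \<in> carrier M \<Longrightarrow> y \<in> carrier M \<Longrightarrow> f (x \<ominus>\<^bsub>M\<^esub> y) = f x \<ominus>\<^bsub>N\<^esub> f y"
    by (simp add: a_minus_def f n)
qed

lemma graded_hom_finsum:
  assumes "f \<in> graded_hom V d M N" "module (poly_ring V) M" "module (poly_ring V) N"
    and "finite A" "u \<in> A \<rightarrow> carrier M"
  shows "f (finsum M u A) = finsum N (\<lambda>a. f (u a)) A"
proof -
  interpret M: module "poly_ring V" M by fact
  interpret N: module "poly_ring V" N by fact
  note f = graded_homD[OF assms(1)]
  show ?thesis using assms(4,5)
  proof (induction A)
    case (insert a A)
    then have "u a \<in> carrier M" "u \<in> A \<rightarrow> carrier M" "(\<lambda>a. f (u a)) \<in> A \<rightarrow> carrier N" using f(1) by auto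
    then show ?case
      using insert f by (simp add: M.finsum_insert N.finsum_insert M.finsum_closed)
  qed (simp add: graded_hom_zero(1)[OF assms(1-3)])
qed

section \<open>The ideal generated by the variables and its multiples\<close>

definition max_ideal :: "nat set \<Rightarrow> rpoly set" where
  "max_ideal V = genideal (poly_ring V) (Var ` V)"

lemma max_ideal: "ideal (max_ideal V) (poly_ring V)" "max_ideal V \<subseteq> P V" "v \<in> V \<Longrightarrow> Var v \<in> max_ideal V"
proof -
  interpret cring "poly_ring V" by (rule cring_poly_ring)
  have sub: "Var ` V \<subseteq> P V" by auto
  show i: "ideal (max_ideal V) (poly_ring V)"
    unfolding max_ideal_def by (rule genideal_ideal[OF sub])
  show "max_ideal V \<subseteq> P V" using ideal.axioms(1)[OF i] additive_subgroup.a_subset by blast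
  show "v \<in> V \<Longrightarrow> Var v \<in> max_ideal V"
    using genideal_self[OF sub] unfolding max_ideal_def by blast
qed

text \<open>A monomial other than \<open>1\<close> is a multiple of a variable, and without constant
  term \<open>p\<close> has no other monomials.\<close>

lemma max_ideal_I:
  assumes "p \<in> P V" "lookup p 0 = 0"
  shows "p \<in> max_ideal V"
proof -
  interpret ideal "max_ideal V" "poly_ring V" by (rule max_ideal)
  have m: "single t c \<in> max_ideal V" if "keys t \<subseteq> V" "t \<noteq> 0" for t c
    using that
  proof (induction t rule: exponent_induct)
    case (add v t)
    then show ?case
      unfolding single_Var using I_r_closed[OF max_ideal(3)[OF add(1)] P_single[OF add(2), of c]] by simp
  qed simp
  have "(\<Sum>t \<in> A. single t (lookup p t)) \<in> max_ideal V"
    if "finite A" "A \<subseteq> keys p" for A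
    using that
  proof (induction A)
    case empty
    show ?case using additive_subgroup.zero_closed[OF ideal.axioms(1)[OF max_ideal(1)], of V] by simp
  next
    case (insert t A)
    then have "single t (lookup p t) \<in> max_ideal V"
      using assms by (intro m) (auto simp: P_iff)
    then show ?case
      using insert additive_subgroup.a_closed[OF ideal.axioms(1)[OF max_ideal(1)], of _ V] by simp
  qed
  from this[of "keys p"] show ?thesis by (simp add: sum_monomials)
qed

lemma max_mult_eq: "max_mult V M = generate (add_monoid M) {p \<odot>\<^bsub>M\<^esub> x | p x. p \<in> max_ideal V \<and> x \<in> carrier M}"
  by (simp add: max_mult_def max_ideal_def)

lemma max_mult_incl: "p \<in> max_ideal V \<Longrightarrow> x \<in> carrier M \<Longrightarrow> p \<odot>\<^bsub>M\<^esub> x \<in> max_mult V M"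
  unfolding max_mult_eq by (rule generate.incl) blast

text \<open>The definition generates an additive subgroup only; closure under scalars comes from the
  ideal property, by induction on the generation.\<close>

lemma max_mult_submodule:
  assumes "module (poly_ring V) M"
  shows "submodule (max_mult V M) (poly_ring V) M"
proof -
  interpret M: module "poly_ring V" M by fact
  interpret I: ideal "max_ideal V" "poly_ring V" by (rule max_ideal)
  let ?S = "{p \<odot>\<^bsub>M\<^esub> x | p x. p \<in> max_ideal V \<and> x \<in> carrier M}"
  have S: "?S \<subseteq> carrier (add_monoid M)"
    using max_ideal(2) by (auto intro!: M.smult_closed)
  have sg: "subgroup (max_mult V M) (add_monoid M)"
    unfolding max_mult_eq by (rule group.generate_is_subgroup[OF M.a_group S])
  have smult: "q \<odot>\<^bsub>M\<^esub> y \<in> max_mult V M" if "y \<in> max_mult V M" and q: "q \<in> P V" for q y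
    using that(1) unfolding max_mult_eq
  proof induction
    case one
    then show ?case using M.smult_r_null[of q] q subgroup.one_closed[OF sg] by (simp add: max_mult_eq)
  next
    case (incl h)
    then obtain p x where "p \<in> max_ideal V" "x \<in> carrier M" "h = p \<odot>\<^bsub>M\<^esub> x" by auto
    moreover have "q * p \<in> max_ideal V" using I.I_l_closed[of p q] calculation q by simp
    ultimately show ?case
      using q max_ideal(2) M.smult_assoc1[of q p x] by (auto intro!: generate.incl exI[of _ "q * p"] exI[of _ x])
  next
    case (inv h)
    then obtain p x where px: "p \<in> max_ideal V" "x \<in> carrier M" "h = p \<odot>\<^bsub>M\<^esub> x" by auto
    have m: "(- (q * p)) \<in> max_ideal V"
    proof -
      have "(- q) * p \<in> max_ideal V" using I.I_l_closed[of p "- q"] px q by simp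
      then show ?thesis by simp
    qed
    have p: "p \<in> P V" "h \<in> carrier M" using px max_ideal(2) by (auto intro!: M.smult_closed)
    have "q \<odot>\<^bsub>M\<^esub> (\<ominus>\<^bsub>M\<^esub> h) = \<ominus>\<^bsub>M\<^esub> (q \<odot>\<^bsub>M\<^esub> h)"
      using q p by (simp add: M.smult_r_minus)
    also have "\<dots> = (- (q * p)) \<odot>\<^bsub>M\<^esub> x"
    proof (rule M.minus_equality)
      have "(- (q * p)) \<odot>\<^bsub>M\<^esub> x \<oplus>\<^bsub>M\<^esub> (q * p) \<odot>\<^bsub>M\<^esub> x = \<zero>\<^bsub>M\<^esub>"
        using M.smult_l_distr[of "- (q * p)" "q * p" x] M.smult_l_null[of x] q p px by simp
      then show "(- (q * p)) \<odot>\<^bsub>M\<^esub> x \<oplus>\<^bsub>M\<^esub> q \<odot>\<^bsub>M\<^esub> h = \<zero>\<^bsub>M\<^esub>"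
        using M.smult_assoc1[of q p x] q p px by simp
    qed (use q p px in \<open>auto intro!: M.smult_closed\<close>)
    finally have "q \<odot>\<^bsub>M\<^esub> (\<ominus>\<^bsub>M\<^esub> h) \<in> ?S" using m px by blast
    then show ?case unfolding a_inv_def[symmetric] by (rule generate.incl)
  next
    case (eng a b)
    then have "a \<in> carrier M" "b \<in> carrier M"
      using subgroup.subset[OF sg] unfolding max_mult_eq by auto
    then show ?case
      using eng q generate.eng[of "q \<odot>\<^bsub>M\<^esub> a" "add_monoid M" ?S "q \<odot>\<^bsub>M\<^esub> b"] by (simp add: M.smult_r_distr)
  qed
  show ?thesis
    by (intro submodule.intro sg submodule_axioms.intro) (simp add: smult)
qed

lemma graded_hom_max_mult:
  assumes "f \<in> graded_hom V d M N" "module (poly_ring V) M" "module (poly_ring V) N" "x \<in> max_mult V M"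
  shows "f x \<in> max_mult V N"
proof -
  interpret M: module "poly_ring V" M by fact
  interpret N: module "poly_ring V" N by fact
  note f = graded_homD[OF assms(1)] and f0 = graded_hom_zero[OF assms(1-3)]
  note sM = M.submoduleE[OF max_mult_submodule[OF assms(2)]]
  note sN = N.submoduleE[OF max_mult_submodule[OF assms(3)]]
  show ?thesis
    using assms(4) unfolding max_mult_eq[of V M]
  proof induction
    case one
    have "\<zero>\<^bsub>N\<^esub> \<in> max_mult V N"
      using subgroup.one_closed[OF submodule.axioms(1)[OF max_mult_submodule[OF assms(3)]]] by simp
    then show ?case by (simp add: f0)
  next
    case (incl h)
    then obtain p x where px: "p \<in> max_ideal V" "x \<in> carrier M" "h = p \<odot>\<^bsub>M\<^esub> x" by auto
    then have "f h = p \<odot>\<^bsub>N\<^esub> f x"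
      using f(3)[of p x] max_ideal(2) by blast
    then show ?case using px f(1) by (simp add: max_mult_incl)
  next
    case (inv h)
    then obtain p x where px: "p \<in> max_ideal V" "x \<in> carrier M" "h = p \<odot>\<^bsub>M\<^esub> x" by auto
    then have "p \<in> P V" "f h = p \<odot>\<^bsub>N\<^esub> f x"
      using f(3)[of p x] max_ideal(2) by blast+
    then have "h \<in> carrier M" "f h \<in> max_mult V N"
      using px f(1) by (simp_all add: max_mult_incl)
    then show ?case using f0(2) sN(3) by (simp flip: a_inv_def)
  next
    case (eng a b)
    then have "a \<in> carrier M" "b \<in> carrier M"
      using sM(1) unfolding max_mult_eq by auto
    then show ?case using eng f sN(5) by simp
  qed
qed

lemma quot_map_coset:
  assumes "submodule_quotient V M H" "submodule_quotient V N K" "f \<in> graded_hom V d M N"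
    and HK: "\<And>x. x \<in> H \<Longrightarrow> f x \<in> K" and x: "x \<in> carrier M"
  shows "quot_map N K f (a_r_coset M H x) = a_r_coset N K (f x)"
proof -
  interpret M: submodule_quotient V M H by fact
  interpret N: submodule_quotient V N K by fact
  note f = graded_homD[OF assms(3)]
  have "k \<oplus>\<^bsub>N\<^esub> f z \<in> N.\<pi> (f x)" if k: "k \<in> K" and "z \<in> M.\<pi> x" for k z
  proof -
    have z: "z \<in> carrier M" "z \<ominus>\<^bsub>M\<^esub> x \<in> H" using that x M.mem_coset by auto
    have "f z \<ominus>\<^bsub>N\<^esub> f x \<in> K"
      using HK[OF z(2)] z x by (simp add: graded_hom_zero(3)[OF assms(3) M.module_axioms N.module_axioms])
    then have "N.\<pi> (f z) = N.\<pi> (f x)"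
      using z x f by (intro N.coset_cong)
    moreover have "k \<oplus>\<^bsub>N\<^esub> f z \<in> N.\<pi> (f z)"
      using k by (auto simp: a_r_coset_def')
    ultimately show ?thesis by simp
  qed
  moreover have "\<exists>h \<in> K. \<exists>z \<in> M.\<pi> x. y = h \<oplus>\<^bsub>N\<^esub> f z" if "y \<in> N.\<pi> (f x)" for y
  proof -
    from that obtain h where "h \<in> K" "y = h \<oplus>\<^bsub>N\<^esub> f x"
      by (auto simp: a_r_coset_def')
    then show ?thesis using M.H.a_rcos_self[OF x] by blast
  qed
  ultimately show ?thesis
    unfolding quot_map_def by (rule set_add_eqI)
qed

definition cocycles :: "nat set \<Rightarrow> 'm factorization \<Rightarrow> bit \<Rightarrow> 'm set" where
  "cocycles V M i = {z \<in> carrier (fmod M i). fdiff M i z \<in> max_mult V (fmod M (i + 1))}"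

text \<open>Spanning of the cohomology, expressed by cocycles upstairs modulo \<open>\<mm>M\<close>
  and boundaries. This avoids the cosets of cosets in \<open>cohomology\<close>.\<close>

definition coh_span :: "nat set \<Rightarrow> 'm factorization \<Rightarrow> bit \<Rightarrow> 'm set \<Rightarrow> bool" where
  "coh_span V M i S \<longleftrightarrow> finite S \<and> S \<subseteq> cocycles V M i \<and> (\<forall>z \<in> cocycles V M i.
     \<exists>c. \<exists>m \<in> max_mult V (fmod M i). \<exists>y \<in> carrier (fmod M (i + 1)).
       z = finsum (fmod M i) (\<lambda>s. Const (c s) \<odot>\<^bsub>fmod M i\<^esub> s) S \<oplus>\<^bsub>fmod M i\<^esub> m \<oplus>\<^bsub>fmod M i\<^esub> fdiff M (i + 1) y)"

text \<open>The two quotients are formed in turn: \<open>M / \<mm>M\<close>, then in it the kernel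
  modulo the image. The composite \<open>\<eta>\<close> maps the cocycles onto the cohomology and
  kills \<open>\<mm>M\<close> and the boundaries, so the images of \<open>S\<close> span.\<close>

lemma finite_dim_cohomology:
  assumes gf: "graded_factorization n V w M" and w: "w \<in> max_ideal V" and S: "coh_span V M i S"
  shows "finite_dim (cohomology V M i)"
proof -
  have mods: "module (poly_ring V) (fmod M k)" for k
    using gf by (auto simp: graded_factorization_def free_graded_module_def graded_module_def)
  have d: "fdiff M k \<in> graded_hom V (int n + 1) (fmod M k) (fmod M (k + 1))" for k
    using gf by (auto simp: graded_factorization_def)
  have d': "fdiff M (k + 1) \<in> graded_hom V (int n + 1) (fmod M (k + 1)) (fmod M k)" for k
    using d[of "k + 1"] by simp
  have dd: "fdiff M (k + 1) (fdiff M k x) = w \<odot>\<^bsub>fmod M k\<^esub> x" if "x \<in> carrier (fmod M k)" for k x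
    using gf that by (auto simp: graded_factorization_def)
  have sq: "submodule_quotient V (fmod M k) (max_mult V (fmod M k))" for k
    by (intro submodule_quotient.intro submodule_quotient_axioms.intro mods max_mult_submodule)
  let ?A = "fmod M i" and ?B = "fmod M (i + 1)"
  let ?H = "max_mult V ?A" and ?K = "max_mult V ?B"
  interpret A: submodule_quotient V ?A ?H by (rule sq)
  interpret B: submodule_quotient V ?B ?K by (rule sq)
  have redm: "red_module V M i = A.Q" "red_module V M (i + 1) = B.Q"
    by (simp_all add: red_module_def)
  have rd: "red_diff V M i (A.\<pi> x) = B.\<pi> (fdiff M i x)" if "x \<in> carrier ?A" for x
    unfolding red_diff_def
    by (rule quot_map_coset[OF sq sq d _ that]) (rule graded_hom_max_mult[OF d mods mods])
  have rd': "red_diff V M (i + 1) (B.\<pi> x) = A.\<pi> (fdiff M (i + 1) x)" if "x \<in> carrier ?B" for x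
    using quot_map_coset[OF sq[of "i + 1"] sq[of i] d' _ that] graded_hom_max_mult[OF d' mods mods]
    by (simp add: red_diff_def)
  let ?Z = "cocycles V M i"
  have rd0: "red_diff V M i (A.\<pi> x) = \<zero>\<^bsub>B.Q\<^esub> \<longleftrightarrow> fdiff M i x \<in> ?K" if "x \<in> carrier ?A" for x
    unfolding rd[OF that] B.zero_Q by (rule B.coset_eq_H[OF graded_homD(1)[OF d that]])
  have ker: "a_kernel A.Q B.Q (red_diff V M i) = A.\<pi> ` ?Z"
    unfolding a_kernel_def' A.carrier_Q cocycles_def using rd0 by blast
  have ZA: "?Z \<subseteq> carrier ?A" by (auto simp: cocycles_def)
  have HZ: "?H \<subseteq> ?Z"
    using graded_hom_max_mult[OF d mods mods] A.submoduleE(1)[OF A.sub] by (auto simp: cocycles_def)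
  \<comment> \<open>Boundaries are cocycles because \<open>d d = w\<close> and
    \<open>w \<in> \<mm>\<close>.\<close>
  have dZ: "fdiff M (i + 1) y \<in> ?Z" if "y \<in> carrier ?B" for y
  proof -
    have "fdiff M i (fdiff M (i + 1) y) = w \<odot>\<^bsub>?B\<^esub> y"
      using dd[of y "i + 1"] that by simp
    then show ?thesis
      using that w graded_homD(1)[OF d'] by (simp add: cocycles_def max_mult_incl)
  qed
  have Zsub: "submodule ?Z (poly_ring V) ?A"
  proof (rule A.submoduleI[OF ZA])
    show "\<zero>\<^bsub>?A\<^esub> \<in> ?Z" using HZ A.H.zero_closed by blast
    show "\<ominus>\<^bsub>?A\<^esub> a \<in> ?Z" if "a \<in> ?Z" for a
      using that B.submoduleE(3)[OF B.sub] by (simp add: cocycles_def graded_hom_zero(2)[OF d mods mods])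
    show "a \<oplus>\<^bsub>?A\<^esub> b \<in> ?Z" if "a \<in> ?Z" "b \<in> ?Z" for a b
      using that by (simp add: cocycles_def graded_homD(2)[OF d])
    show "p \<odot>\<^bsub>?A\<^esub> x \<in> ?Z" if "p \<in> P V" "x \<in> ?Z" for p x
      using that B.H_smult by (simp add: cocycles_def graded_homD(3)[OF d])
  qed
  note Ze = A.submoduleE[OF Zsub]
  let ?QZ = "A.\<pi> ` ?Z"
  have piZ: "x \<in> ?Z \<Longrightarrow> x \<in> carrier ?A" for x using ZA by blast
  interpret Q: module "poly_ring V" A.Q by (rule A.module_Q)
  have neg: "\<ominus>\<^bsub>A.Q\<^esub> A.\<pi> x = A.\<pi> (\<ominus>\<^bsub>?A\<^esub> x)" if "x \<in> carrier ?A" for x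
    using that by (intro Q.minus_equality) (simp_all add: A.pi_closed A.add_Q A.zero_Q' A.l_neg)
  have QZ: "submodule ?QZ (poly_ring V) A.Q"
  proof (rule Q.submoduleI)
    show "?QZ \<subseteq> carrier A.Q" using piZ A.pi_closed by blast
    show "\<zero>\<^bsub>A.Q\<^esub> \<in> ?QZ"
      unfolding A.zero_Q' by (rule imageI) (rule subsetD[OF HZ A.H.zero_closed])
  qed (auto simp: neg piZ A.add_Q A.smult_Q Ze)
  define R where "R = sub_module A.Q ?QZ"
  have R: "carrier R = ?QZ" "\<And>X Y. X \<oplus>\<^bsub>R\<^esub> Y = X \<oplus>\<^bsub>A.Q\<^esub> Y" "\<And>p X. p \<odot>\<^bsub>R\<^esub> X = p \<odot>\<^bsub>A.Q\<^esub> X" "\<zero>\<^bsub>R\<^esub> = \<zero>\<^bsub>A.Q\<^esub>"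
    by (simp_all add: R_def sub_module_def)
  interpret R: module "poly_ring V" R
    unfolding R_def by (rule module_sub_module[OF A.module_Q QZ])
  define T where "T = red_diff V M (i + 1) ` carrier B.Q"
  have T: "T = (\<lambda>y. A.\<pi> (fdiff M (i + 1) y)) ` carrier ?B"
    by (auto simp: T_def B.carrier_Q rd' image_image)
  have negR: "\<ominus>\<^bsub>R\<^esub> A.\<pi> x = A.\<pi> (\<ominus>\<^bsub>?A\<^esub> x)" if "x \<in> ?Z" for x
    using that piZ[OF that] Ze(3)
    by (intro R.minus_equality) (auto simp: R A.add_Q A.zero_Q' A.l_neg)
  have dc: "y \<in> carrier ?B \<Longrightarrow> fdiff M (i + 1) y \<in> carrier ?A" for y
    by (rule graded_homD(1)[OF d'])
  have Tsub: "submodule T (poly_ring V) R"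
  proof (rule R.submoduleI)
    show "T \<subseteq> carrier R" unfolding T R using dZ by blast
    have "\<zero>\<^bsub>R\<^esub> = A.\<pi> (fdiff M (i + 1) \<zero>\<^bsub>?B\<^esub>)"
      by (simp add: R A.zero_Q' graded_hom_zero(1)[OF d' mods mods])
    then show "\<zero>\<^bsub>R\<^esub> \<in> T" unfolding T by (simp add: image_eqI[of _ _ "\<zero>\<^bsub>?B\<^esub>"])
    show "\<ominus>\<^bsub>R\<^esub> a \<in> T" if "a \<in> T" for a
    proof -
      from that obtain y where y: "y \<in> carrier ?B" "a = A.\<pi> (fdiff M (i + 1) y)" by (auto simp: T)
      then have "\<ominus>\<^bsub>R\<^esub> a = A.\<pi> (fdiff M (i + 1) (\<ominus>\<^bsub>?B\<^esub> y))"
        using negR[OF dZ[OF y(1)]] by (simp add: graded_hom_zero(2)[OF d' mods mods])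
      then show ?thesis using y unfolding T by blast
    qed
    show "a \<oplus>\<^bsub>R\<^esub> b \<in> T" if "a \<in> T" "b \<in> T" for a b
    proof -
      from that obtain y z where y: "y \<in> carrier ?B" "a = A.\<pi> (fdiff M (i + 1) y)"
        and z: "z \<in> carrier ?B" "b = A.\<pi> (fdiff M (i + 1) z)" by (auto simp: T)
      then have "a \<oplus>\<^bsub>R\<^esub> b = A.\<pi> (fdiff M (i + 1) (y \<oplus>\<^bsub>?B\<^esub> z))"
        by (simp add: R A.add_Q dc graded_homD(2)[OF d'])
      then show ?thesis using y z unfolding T by blast
    qed
    show "p \<odot>\<^bsub>R\<^esub> a \<in> T" if "p \<in> P V" "a \<in> T" for p a
    proof -
      from that obtain y where y: "y \<in> carrier ?B" "a = A.\<pi> (fdiff M (i + 1) y)" by (auto simp: T)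
      then have "p \<odot>\<^bsub>R\<^esub> a = A.\<pi> (fdiff M (i + 1) (p \<odot>\<^bsub>?B\<^esub> y))"
        using that by (simp add: R A.smult_Q dc graded_homD(3)[OF d'])
      then show ?thesis using y that unfolding T by (intro image_eqI[of _ _ "p \<odot>\<^bsub>?B\<^esub> y"]) simp_all
    qed
  qed
  interpret C: submodule_quotient V R T
    by (intro submodule_quotient.intro submodule_quotient_axioms.intro R.module_axioms Tsub)
  have coh: "cohomology V M i = C.Q"
    unfolding cohomology_def bit_simps redm ker R_def[symmetric] T_def[symmetric] ..
  define \<eta> where "\<eta> x = C.\<pi> (A.\<pi> x)" for x
  interpret CQ: module "poly_ring V" C.Q by (rule C.module_Q)
  have \<eta>: "x \<in> ?Z \<Longrightarrow> \<eta> x \<in> carrier C.Q" "x \<in> ?Z \<Longrightarrow> y \<in> ?Z \<Longrightarrow> \<eta> (x \<oplus>\<^bsub>?A\<^esub> y) = \<eta> x \<oplus>\<^bsub>C.Q\<^esub> \<eta> y"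
    "p \<in> P V \<Longrightarrow> x \<in> ?Z \<Longrightarrow> \<eta> (p \<odot>\<^bsub>?A\<^esub> x) = p \<odot>\<^bsub>C.Q\<^esub> \<eta> x" for p x y
    using piZ by (auto simp: \<eta>_def C.pi_closed C.add_Q C.smult_Q R A.add_Q A.smult_Q Ze simp flip: A.add_Q A.smult_Q)
  have \<eta>H: "\<eta> m = \<zero>\<^bsub>C.Q\<^esub>" if "m \<in> ?H" for m
    using A.coset_zero[OF that] C.zero_Q' by (simp add: \<eta>_def R A.zero_Q)
  have \<eta>d: "\<eta> (fdiff M (i + 1) y) = \<zero>\<^bsub>C.Q\<^esub>" if "y \<in> carrier ?B" for y
    unfolding \<eta>_def C.zero_Q by (rule C.coset_zero) (use that in \<open>auto simp: T\<close>)
  have fS: "finite S" "S \<subseteq> ?Z" using S by (auto simp: coh_span_def)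
  have \<eta>sum: "finsum ?A (\<lambda>s. Const (c s) \<odot>\<^bsub>?A\<^esub> s) A \<in> ?Z \<and>
      \<eta> (finsum ?A (\<lambda>s. Const (c s) \<odot>\<^bsub>?A\<^esub> s) A) = finsum C.Q (\<lambda>s. Const (c s) \<odot>\<^bsub>C.Q\<^esub> \<eta> s) A"
    if "finite A" "A \<subseteq> S" for A c
    using that
  proof (induction A)
    case empty
    show ?case using \<eta>H[of "\<zero>\<^bsub>?A\<^esub>"] A.H.zero_closed HZ by auto
  next
    case (insert s A)
    have s: "s \<in> ?Z" "A \<subseteq> ?Z" using insert fS by auto
    have 1: "finsum ?A (\<lambda>s. Const (c s) \<odot>\<^bsub>?A\<^esub> s) (insert s A) = Const (c s) \<odot>\<^bsub>?A\<^esub> s \<oplus>\<^bsub>?A\<^esub> finsum ?A (\<lambda>s. Const (c s) \<odot>\<^bsub>?A\<^esub> s) A"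
      using insert s piZ by (intro A.finsum_insert) (auto intro!: A.smult_closed)
    have 2: "finsum C.Q (\<lambda>s. Const (c s) \<odot>\<^bsub>C.Q\<^esub> \<eta> s) (insert s A) = Const (c s) \<odot>\<^bsub>C.Q\<^esub> \<eta> s \<oplus>\<^bsub>C.Q\<^esub> finsum C.Q (\<lambda>s. Const (c s) \<odot>\<^bsub>C.Q\<^esub> \<eta> s) A"
      using insert s \<eta>(1) by (intro CQ.finsum_insert) (auto intro!: CQ.smult_closed)
    have 3: "Const (c s) \<odot>\<^bsub>?A\<^esub> s \<in> ?Z" using s Ze(4) by simp
    show ?case
      unfolding 1 2 using insert 3 s Ze(5) \<eta> by simp
  qed
  have "\<exists>c. X = finsum C.Q (\<lambda>t. Const (c t) \<odot>\<^bsub>C.Q\<^esub> t) (\<eta> ` S)" if X: "X \<in> carrier C.Q" for X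
  proof -
    have "X \<in> C.\<pi> ` A.\<pi> ` ?Z"
      using X unfolding C.carrier_Q R(1) .
    then obtain z where z: "z \<in> ?Z" "X = \<eta> z"
      unfolding \<eta>_def by blast
    then obtain c m y where cmy: "m \<in> ?H" "y \<in> carrier ?B"
      "z = finsum ?A (\<lambda>s. Const (c s) \<odot>\<^bsub>?A\<^esub> s) S \<oplus>\<^bsub>?A\<^esub> m \<oplus>\<^bsub>?A\<^esub> fdiff M (i + 1) y"
      using S unfolding coh_span_def by blast
    define F where "F = finsum ?A (\<lambda>s. Const (c s) \<odot>\<^bsub>?A\<^esub> s) S"
    have F: "F \<in> ?Z" "\<eta> F = finsum C.Q (\<lambda>s. Const (c s) \<odot>\<^bsub>C.Q\<^esub> \<eta> s) S"
      using \<eta>sum[OF fS(1) subset_refl, of c] by (simp_all add: F_def)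
    have m: "m \<in> ?Z" "fdiff M (i + 1) y \<in> ?Z" using cmy(1,2) HZ dZ by auto
    have "X = \<eta> F \<oplus>\<^bsub>C.Q\<^esub> \<eta> m \<oplus>\<^bsub>C.Q\<^esub> \<eta> (fdiff M (i + 1) y)"
      unfolding z(2) cmy(3) F_def[symmetric] using F(1) m Ze(5) by (simp add: \<eta>(2))
    then have "X = \<eta> F"
      using \<eta>(1)[OF F(1)] by (simp add: \<eta>H[OF cmy(1)] \<eta>d[OF cmy(2)])
    moreover have "\<exists>c'. finsum C.Q (\<lambda>s. Const (c s) \<odot>\<^bsub>C.Q\<^esub> \<eta> s) S = finsum C.Q (\<lambda>t. Const (c' t) \<odot>\<^bsub>C.Q\<^esub> t) (\<eta> ` S)"
      by (rule span_image[OF C.module_Q fS(1)]) (rule \<eta>(1)[OF subsetD[OF fS(2)]])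
    ultimately show ?thesis by (simp only: F(2))
  qed
  moreover have "\<eta> ` S \<subseteq> carrier C.Q"
    using fS(2) \<eta>(1) by blast
  ultimately show ?thesis
    unfolding coh finite_dim_def using fS(1)
    by (intro exI[of _ "\<eta> ` S"] conjI ballI finite_imageI)
qed

text \<open>Linear algebra without a vector space: \<open>Z\<close> is a set whose values under the
  rational functionals are closed under \<open>z - r z'\<close>. Induction on the functionals, with
  at most one further element outside the zero set of the new one.\<close>

lemma finite_spanning:
  fixes l :: "'i \<Rightarrow> 'z \<Rightarrow> rat"
  assumes "finite I" "\<And>z z' r. z \<in> Z \<Longrightarrow> z' \<in> Z \<Longrightarrow> \<exists>y \<in> Z. \<forall>a. l a y = l a z - r * l a z'"
  shows "\<exists>S \<subseteq> Z. finite S \<and> (\<forall>z \<in> Z. \<exists>c. \<forall>a \<in> I. l a z = (\<Sum>s \<in> S. c s * l a s))"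
  using assms
proof (induction I arbitrary: Z)
  case empty
  then show ?case by (intro exI[of _ "{}"]) auto
next
  case (insert i I)
  define Z' where "Z' = {z \<in> Z. l i z = 0}"
  have "\<exists>y \<in> Z'. \<forall>a. l a y = l a z - r * l a z'" if zz: "z \<in> Z'" "z' \<in> Z'" for z z' r
  proof -
    obtain y where "y \<in> Z" "\<forall>a. l a y = l a z - r * l a z'" using insert.prems[of z z' r] zz by (auto simp: Z'_def)
    then show ?thesis using zz by (intro bexI[of _ y]) (auto simp: Z'_def)
  qed
  then have "\<exists>S \<subseteq> Z'. finite S \<and> (\<forall>z \<in> Z'. \<exists>c. \<forall>a \<in> I. l a z = (\<Sum>s \<in> S. c s * l a s))"
    by (rule insert.IH)
  then obtain S where S: "S \<subseteq> Z'" "finite S" "\<forall>z \<in> Z'. \<exists>c. \<forall>a \<in> I. l a z = (\<Sum>s \<in> S. c s * l a s)"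
    by (elim exE conjE) simp
  have S0: "(\<Sum>s \<in> S. c s * l i s) = 0" for c
    using S(1) by (intro sum.neutral) (auto simp: Z'_def)
  show ?case
  proof (cases "Z' = Z")
    case True
    then show ?thesis
      using S S0 by (intro exI[of _ S]) (auto simp: Z'_def)
  next
    case False
    then obtain z0 where z0: "z0 \<in> Z" "l i z0 \<noteq> 0" by (auto simp: Z'_def)
    then have n: "z0 \<notin> S" using S(1) by (auto simp: Z'_def)
    have "\<exists>c. \<forall>a \<in> insert i I. l a z = (\<Sum>s \<in> insert z0 S. c s * l a s)" if z: "z \<in> Z" for z
    proof -
      \<comment> \<open>Chosen so that subtracting \<open>r\<close> times \<open>z0\<close> lands in
        the zero set of the new functional.\<close>
      define r where "r = l i z / l i z0"
      obtain y where y: "y \<in> Z" "\<forall>a. l a y = l a z - r * l a z0" using insert.prems[OF z z0(1)] by blast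
      then have "y \<in> Z'" using z0 by (simp add: Z'_def r_def)
      then obtain c where c: "\<forall>a \<in> I. l a y = (\<Sum>s \<in> S. c s * l a s)" using bspec[OF S(3)] by blast
      have e: "(\<Sum>s \<in> insert z0 S. (c(z0 := r)) s * l a s) = r * l a z0 + (\<Sum>s \<in> S. c s * l a s)" for a
        using n S(2) by (auto intro!: sum.cong)
      have "l a z = (\<Sum>s \<in> insert z0 S. (c(z0 := r)) s * l a s)" if "a \<in> insert i I" for a
      proof (cases "a = i")
        case True
        then show ?thesis unfolding e using S0[of c] z0 by (simp add: r_def)
      next
        case False
        then have "l a y = (\<Sum>s \<in> S. c s * l a s)" using c that by auto
        then show ?thesis unfolding e using y(2) by simp
      qed
      then show ?thesis by blast
    qed
    then show ?thesis
      using S(1,2) z0 by (intro exI[of _ "insert z0 S"]) (auto simp: Z'_def)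
  qed
qed

section \<open>Homotopy equivalences in coordinates\<close>

lemma lookup_Const_mult: "lookup (Const r * p) t = r * lookup p t"
  using P_UNIV[of p]
  by (induction rule: sum_monomials_induct)
    (auto simp: Const_def mult_single lookup_single lookup_add ring_distribs when_def)

lemma submodule_finsum:
  assumes "module (poly_ring V) M" "submodule H (poly_ring V) M" "finite A" "\<And>a. a \<in> A \<Longrightarrow> u a \<in> H"
  shows "finsum M u A \<in> H"
proof -
  interpret M: module "poly_ring V" M by fact
  note E = M.submoduleE[OF assms(2)]
  have "finsum M u A \<in> H \<and> u \<in> A \<rightarrow> carrier M"
    using assms(3,4)
  proof (induction A)
    case empty
    have "\<zero>\<^bsub>M\<^esub> \<in> H"
      using subgroup.one_closed[OF submodule.axioms(1)[OF assms(2)]] by simp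
    then show ?case by simp
  next
    case (insert a A)
    then have "u a \<in> H" "u a \<in> carrier M" "u \<in> A \<rightarrow> carrier M" "finsum M u A \<in> H" using E(1) by auto
    then show ?case using insert E(5) by (auto simp: M.finsum_insert)
  qed
  then show ?thesis ..
qed

text \<open>In the expansion of \<open>x\<close> in the basis all coefficients lie in
  \<open>\<mm>\<close>.\<close>

lemma (in coords) max_mult_I:
  assumes x: "x \<in> carrier M" "\<And>i. lookup (\<phi> x i) 0 = 0"
  shows "x \<in> max_mult V M"
proof -
  define e where "e i = elt (\<lambda>i'. if i' = i then 1 else 0)" for i
  have e: "e i \<in> carrier M" "\<phi> (e i) i' = (if i' = i then 1 else 0)" if "i \<in> I" for i i'
  proof -
    have "(\<lambda>i'. if i' = i then 1 else 0) \<in> fam V I" using that by (auto simp: fam_def)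
    then show "e i \<in> carrier M" "\<phi> (e i) i' = (if i' = i then 1 else 0)" by (auto simp: e_def elt)
  qed
  let ?u = "\<lambda>i. \<phi> x i \<odot>\<^bsub>M\<^esub> e i"
  have u: "?u \<in> I \<rightarrow> carrier M" using e phi_P[OF x(1)] by (auto intro: smult_closed)
  have "(\<Sum>i' \<in> I. \<phi> (?u i') i) = \<phi> x i" for i
  proof -
    have "(\<Sum>i' \<in> I. \<phi> (?u i') i) = (\<Sum>i' \<in> I. if i' = i then \<phi> x i else 0)"
      using e phi_P[OF x(1)] by (intro sum.cong refl) (auto simp: phi_smult)
    then show ?thesis using finite_I phi_off[OF x(1)] by simp
  qed
  then have "finsum M ?u I = x"
    using x by (intro eqI phi_finsum(1)[OF finite_I u]) (auto simp: phi_finsum(2)[OF finite_I u])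
  moreover have "finsum M ?u I \<in> max_mult V M"
    using e x phi_P[OF x(1)]
    by (intro submodule_finsum[OF module[OF subset_refl] max_mult_submodule[OF module[OF subset_refl]] finite_I]
        max_mult_incl max_ideal_I)
  ultimately show ?thesis by simp
qed

lemma graded_factorizationD:
  assumes "graded_factorization n V w M"
  shows "module (poly_ring V) (fmod M k)"
    "fdiff M k \<in> graded_hom V (int n + 1) (fmod M k) (fmod M (k + 1))"
    "fdiff M (k + 1) \<in> graded_hom V (int n + 1) (fmod M (k + 1)) (fmod M k)"
proof -
  show "module (poly_ring V) (fmod M k)"
    using assms by (auto simp: graded_factorization_def free_graded_module_def graded_module_def)
  show d: "fdiff M k \<in> graded_hom V (int n + 1) (fmod M k) (fmod M (k + 1))" for k
    using assms by (auto simp: graded_factorization_def)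
  show "fdiff M (k + 1) \<in> graded_hom V (int n + 1) (fmod M (k + 1)) (fmod M k)"
    using d[of "k + 1"] by simp
qed

text \<open>Here the scalars are the full ring \<open>\<rat>[V]\<close>, over which the rank is
  finite. Modulo \<open>\<mm>M\<close> an element is its finite vector of constant terms, and these
  are the functionals for \<open>finite_spanning\<close>.\<close>

lemma (in fact_coords) coh_span_exists:
  assumes gf: "graded_factorization n V w X"
  shows "\<exists>S. coh_span V X k S"
proof -
  note mods = graded_factorizationD(1)[OF gf] and d = graded_factorizationD(2,3)[OF gf]
  let ?A = "fmod X k" and ?B = "fmod X (k + 1)" and ?Z = "cocycles V X k" and ?I = "{i. par i = k}"
  interpret A: coords V ?I \<delta> "\<phi> k" ?A by (rule coords)
  interpret mA: module "poly_ring V" ?A by (rule mods)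
  interpret mB: module "poly_ring V" ?B by (rule mods)
  note sB = mB.submoduleE[OF max_mult_submodule[OF mods]]
  define l where "l i z = lookup (\<phi> k z i) 0" for i z
  have ZA: "z \<in> ?Z \<Longrightarrow> z \<in> carrier ?A" for z by (simp add: cocycles_def)
  have "\<exists>y \<in> ?Z. \<forall>a. l a y = l a z - r * l a z'" if z: "z \<in> ?Z" "z' \<in> ?Z" for z z' r
  proof (intro bexI[of _ "z \<ominus>\<^bsub>?A\<^esub> Const r \<odot>\<^bsub>?A\<^esub> z'"] allI)
    have c: "Const r \<odot>\<^bsub>?A\<^esub> z' \<in> carrier ?A" using ZA[OF z(2)] by (simp add: A.smult_closed)
    show "l a (z \<ominus>\<^bsub>?A\<^esub> Const r \<odot>\<^bsub>?A\<^esub> z') = l a z - r * l a z'" for a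
      using ZA[OF z(1)] ZA[OF z(2)] c by (simp add: l_def A.phi_minus A.phi_smult lookup_minus lookup_Const_mult)
    have "fdiff X k (z \<ominus>\<^bsub>?A\<^esub> Const r \<odot>\<^bsub>?A\<^esub> z') = fdiff X k z \<ominus>\<^bsub>?B\<^esub> Const r \<odot>\<^bsub>?B\<^esub> fdiff X k z'"
      using ZA[OF z(1)] ZA[OF z(2)] c
      by (simp add: graded_hom_zero(3)[OF d(1) mods mods] graded_homD(3)[OF d(1)])
    also have "\<dots> \<in> max_mult V ?B"
      unfolding a_minus_def using z by (intro sB(5) sB(3) sB(4)) (auto simp: cocycles_def)
    finally show "z \<ominus>\<^bsub>?A\<^esub> Const r \<odot>\<^bsub>?A\<^esub> z' \<in> ?Z"
      using ZA[OF z(1)] c by (simp add: cocycles_def A.phi_minus(1))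
  qed
  then have "\<exists>S \<subseteq> ?Z. finite S \<and> (\<forall>z \<in> ?Z. \<exists>c. \<forall>a \<in> ?I. l a z = (\<Sum>s \<in> S. c s * l a s))"
    by (rule finite_spanning[OF A.finite_I])
  then obtain S where S: "S \<subseteq> ?Z" "finite S" "\<forall>z \<in> ?Z. \<exists>c. \<forall>a \<in> ?I. l a z = (\<Sum>s \<in> S. c s * l a s)"
    by (elim exE conjE) simp
  have "\<exists>c. \<exists>m \<in> max_mult V ?A. \<exists>y \<in> carrier ?B.
       z = finsum ?A (\<lambda>s. Const (c s) \<odot>\<^bsub>?A\<^esub> s) S \<oplus>\<^bsub>?A\<^esub> m \<oplus>\<^bsub>?A\<^esub> fdiff X (k + 1) y" if z: "z \<in> ?Z" for z
  proof -
    obtain c where c: "\<forall>a \<in> ?I. l a z = (\<Sum>s \<in> S. c s * l a s)" using bspec[OF S(3) z] by blast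
    let ?u = "\<lambda>s. Const (c s) \<odot>\<^bsub>?A\<^esub> s"
    have u: "?u \<in> S \<rightarrow> carrier ?A" using S(1) ZA by (auto intro!: A.smult_closed)
    define F where "F = finsum ?A ?u S"
    have F: "F \<in> carrier ?A" "\<phi> k F a = (\<Sum>s \<in> S. \<phi> k (?u s) a)" for a
      unfolding F_def using A.phi_finsum[OF S(2) u] by auto
    have m: "z \<ominus>\<^bsub>?A\<^esub> F \<in> carrier ?A" using ZA[OF z] F(1) by (rule A.phi_minus(1))
    have "lookup (\<phi> k (z \<ominus>\<^bsub>?A\<^esub> F) a) 0 = 0" for a
    proof (cases "a \<in> ?I")
      case True
      have "lookup (\<phi> k F a) 0 = (\<Sum>s \<in> S. c s * l a s)"
        unfolding F(2) lookup_sum using S(1) ZA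
        by (intro sum.cong refl) (auto simp: A.phi_smult lookup_Const_mult l_def subset_iff)
      then show ?thesis
        using c True ZA[OF z] F(1) by (simp add: A.phi_minus(2) lookup_minus l_def)
    next
      case False
      then show ?thesis using A.phi_off[OF m] by simp
    qed
    then have "z \<ominus>\<^bsub>?A\<^esub> F \<in> max_mult V ?A" by (rule A.max_mult_I[OF m])
    \<comment> \<open>The constant terms already settle everything, so the boundary is the
      differential of \<open>0\<close>.\<close>
    moreover have "z = F \<oplus>\<^bsub>?A\<^esub> (z \<ominus>\<^bsub>?A\<^esub> F) \<oplus>\<^bsub>?A\<^esub> fdiff X (k + 1) \<zero>\<^bsub>?B\<^esub>"
      unfolding graded_hom_zero(1)[OF d(2) mods mods]
      using ZA[OF z] F(1) m
      by (intro A.eqI) (simp_all add: A.add_closed A.zero_closed A.phi_add A.phi_minus A.phi_zero)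
    ultimately show ?thesis
      unfolding F_def using mB.zero_closed by blast
  qed
  then show ?thesis
    using S(1,2) unfolding coh_span_def by blast
qed

text \<open>The modules of \<open>X\<close> may have infinite rank over \<open>\<rat>[V]\<close>,
  where counting constant terms fails. The homotopy compares a cocycle \<open>z\<close> with
  \<open>g (f z)\<close>: they differ by a boundary and by \<open>h (d z)\<close>, which lies in
  \<open>\<mm>M\<close> because \<open>d z\<close> is a multiple from \<open>\<mm>\<close> and
  \<open>h\<close> is linear.\<close>

lemma coh_span_transfer:
  assumes gX: "graded_factorization n V w X" and gY: "graded_factorization n V w Y"
    and f: "f \<in> fact_hom V X Y" and g: "g \<in> fact_hom V Y X"
    and fg: "\<And>k y. y \<in> carrier (fmod Y k) \<Longrightarrow> f k (g k y) = y"
    and h: "\<And>k. h k \<in> graded_hom V e (fmod X k) (fmod X (k + 1))"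
    and hom: "\<And>k x. x \<in> carrier (fmod X k) \<Longrightarrow>
       g k (f k x) \<ominus>\<^bsub>fmod X k\<^esub> x = h (k + 1) (fdiff X k x) \<oplus>\<^bsub>fmod X k\<^esub> fdiff X (k + 1) (h k x)"
    and S: "coh_span V Y k S"
  shows "coh_span V X k (g k ` S)"
proof -
  let ?X = "fmod X k" and ?X' = "fmod X (k + 1)" and ?Y = "fmod Y k" and ?Y' = "fmod Y (k + 1)"
  note mX = graded_factorizationD(1)[OF gX] and dX = graded_factorizationD(2,3)[OF gX]
  note mY = graded_factorizationD(1)[OF gY] and dY = graded_factorizationD(2,3)[OF gY]
  have fh: "f k \<in> graded_hom V 0 (fmod X k) (fmod Y k)" "x \<in> carrier (fmod X k) \<Longrightarrow> f (k + 1) (fdiff X k x) = fdiff Y k (f k x)"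
    and gh: "g k \<in> graded_hom V 0 (fmod Y k) (fmod X k)" "y \<in> carrier (fmod Y k) \<Longrightarrow> g (k + 1) (fdiff Y k y) = fdiff X k (g k y)" for k x y
    using f g by (auto simp: fact_hom_def)
  have h': "h (k + 1) \<in> graded_hom V e ?X' ?X" using h[of "k + 1"] by simp
  interpret X: module "poly_ring V" ?X by (rule mX)
  interpret X': module "poly_ring V" ?X' by (rule mX)
  interpret Y: module "poly_ring V" ?Y by (rule mY)
  note mmX = X.submoduleE[OF max_mult_submodule[OF mX]]
  have fS: "finite S" "S \<subseteq> cocycles V Y k" using S by (auto simp: coh_span_def)
  have SY: "s \<in> S \<Longrightarrow> s \<in> carrier ?Y" for s using fS(2) by (auto simp: cocycles_def)
  have inj: "inj_on (g k) S"
    using fg SY by (metis inj_onI)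
  have Z: "g k ` S \<subseteq> cocycles V X k"
  proof
    fix x assume "x \<in> g k ` S"
    then obtain s where s: "s \<in> S" "x = g k s" by auto
    then have "fdiff Y k s \<in> max_mult V ?Y'" using fS(2) by (auto simp: cocycles_def)
    then have "g (k + 1) (fdiff Y k s) \<in> max_mult V ?X'"
      by (rule graded_hom_max_mult[OF gh(1) mY mX])
    then show "x \<in> cocycles V X k"
      using s SY graded_homD(1)[OF gh(1)] gh(2) by (simp add: cocycles_def)
  qed
  have "\<exists>c. \<exists>m \<in> max_mult V ?X. \<exists>y \<in> carrier ?X'.
       z = finsum ?X (\<lambda>s. Const (c s) \<odot>\<^bsub>?X\<^esub> s) (g k ` S) \<oplus>\<^bsub>?X\<^esub> m \<oplus>\<^bsub>?X\<^esub> fdiff X (k + 1) y"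
    if z: "z \<in> cocycles V X k" for z
  proof -
    have zc: "z \<in> carrier ?X" "fdiff X k z \<in> max_mult V ?X'" using z by (auto simp: cocycles_def)
    have fz: "f k z \<in> carrier ?Y" using graded_homD(1)[OF fh(1) zc(1)] .
    have "fdiff Y k (f k z) \<in> max_mult V ?Y'"
      using graded_hom_max_mult[OF fh(1) mX mY zc(2)] fh(2)[OF zc(1)] by simp
    then have "f k z \<in> cocycles V Y k" using fz by (simp add: cocycles_def)
    then obtain c m y where cmy: "m \<in> max_mult V ?Y" "y \<in> carrier ?Y'"
      "f k z = finsum ?Y (\<lambda>s. Const (c s) \<odot>\<^bsub>?Y\<^esub> s) S \<oplus>\<^bsub>?Y\<^esub> m \<oplus>\<^bsub>?Y\<^esub> fdiff Y (k + 1) y"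
      using S unfolding coh_span_def by blast
    let ?u = "\<lambda>s. Const (c s) \<odot>\<^bsub>?Y\<^esub> s"
    define F where "F = finsum ?Y ?u S"
    have u: "?u \<in> S \<rightarrow> carrier ?Y" using SY by (auto intro!: Y.smult_closed)
    have Fc: "F \<in> carrier ?Y" unfolding F_def by (rule Y.finsum_closed[OF u])
    have mc: "m \<in> carrier ?Y" using cmy(1) Y.submoduleE(1)[OF max_mult_submodule[OF mY]] by blast
    have dy: "fdiff Y (k + 1) y \<in> carrier ?Y" using graded_homD(1)[OF dY(2) cmy(2)] .
    have gdy: "g k (fdiff Y (k + 1) y) = fdiff X (k + 1) (g (k + 1) y)"
      using gh(2)[of y "k + 1"] cmy(2) by simp
    define c' where "c' t = c (the_inv_into S (g k) t)" for t
    have "g k F = finsum ?X (\<lambda>s. g k (?u s)) S"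
      unfolding F_def by (rule graded_hom_finsum[OF gh(1) mY mX fS(1) u])
    also have "\<dots> = finsum ?X (\<lambda>s. Const (c' (g k s)) \<odot>\<^bsub>?X\<^esub> g k s) S"
      using SY graded_homD(1)[OF gh(1)]
      by (intro X.finsum_cong') (auto simp: graded_homD(3)[OF gh(1)] c'_def the_inv_into_f_f[OF inj] intro!: X.smult_closed)
    also have "\<dots> = finsum ?X (\<lambda>t. Const (c' t) \<odot>\<^bsub>?X\<^esub> t) (g k ` S)"
      using SY graded_homD(1)[OF gh(1)]
      by (intro X.finsum_reindex[symmetric] inj) (auto intro!: X.smult_closed)
    finally have gF: "g k F = finsum ?X (\<lambda>t. Const (c' t) \<odot>\<^bsub>?X\<^esub> t) (g k ` S)" .
    \<comment> \<open>The two halves of the homotopy are absorbed, one into the element of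
      \<open>\<mm>M\<close> and the other into the boundary.\<close>
    define m' where "m' = g k m \<ominus>\<^bsub>?X\<^esub> h (k + 1) (fdiff X k z)"
    define y' where "y' = g (k + 1) y \<ominus>\<^bsub>?X'\<^esub> h k z"
    have hz: "h k z \<in> carrier ?X'" using graded_homD(1)[OF h zc(1)] .
    have hdz: "h (k + 1) (fdiff X k z) \<in> max_mult V ?X"
      by (rule graded_hom_max_mult[OF h' mX mX zc(2)])
    have gm: "g k m \<in> max_mult V ?X" by (rule graded_hom_max_mult[OF gh(1) mY mX cmy(1)])
    have gy: "g (k + 1) y \<in> carrier ?X'" using graded_homD(1)[OF gh(1) cmy(2)] .
    have m': "m' \<in> max_mult V ?X" unfolding m'_def a_minus_def using gm hdz by (intro mmX(5) mmX(3))
    have y': "y' \<in> carrier ?X'" unfolding y'_def using gy hz by simp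
    have dy': "fdiff X (k + 1) y' = fdiff X (k + 1) (g (k + 1) y) \<ominus>\<^bsub>?X\<^esub> fdiff X (k + 1) (h k z)"
      unfolding y'_def by (rule graded_hom_zero(3)[OF dX(2) mX mX gy hz])
    let ?a = "h (k + 1) (fdiff X k z)" and ?b = "fdiff X (k + 1) (h k z)"
    let ?p = "g k m" and ?q = "fdiff X (k + 1) (g (k + 1) y)"
    have cl: "?a \<in> carrier ?X" "?b \<in> carrier ?X" "?p \<in> carrier ?X" "?q \<in> carrier ?X" "g k F \<in> carrier ?X"
      using hdz gm mmX(1) graded_homD(1)[OF dX(2) hz] graded_homD(1)[OF dX(2) gy] graded_homD(1)[OF gh(1) Fc] by auto
    have gfz: "g k (f k z) = g k F \<oplus>\<^bsub>?X\<^esub> ?p \<oplus>\<^bsub>?X\<^esub> ?q"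
      unfolding cmy(3) F_def[symmetric] using Fc mc dy by (simp add: graded_homD(2)[OF gh(1)] gdy)
    then have gfc: "g k (f k z) \<in> carrier ?X" using cl by simp
    have "z = g k (f k z) \<ominus>\<^bsub>?X\<^esub> (g k (f k z) \<ominus>\<^bsub>?X\<^esub> z)"
      using zc(1) gfc by (simp add: a_minus_def X.minus_add X.minus_minus X.a_assoc[symmetric] X.r_neg)
    also have "\<dots> = g k F \<oplus>\<^bsub>?X\<^esub> ?p \<oplus>\<^bsub>?X\<^esub> ?q \<ominus>\<^bsub>?X\<^esub> (?a \<oplus>\<^bsub>?X\<^esub> ?b)"
      unfolding hom[OF zc(1)] by (simp only: gfz)
    also have "\<dots> = g k F \<oplus>\<^bsub>?X\<^esub> m' \<oplus>\<^bsub>?X\<^esub> fdiff X (k + 1) y'"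
      unfolding dy' m'_def using cl by (simp add: a_minus_def X.minus_add X.a_ac)
    finally show ?thesis
      unfolding gF using m' y' by blast
  qed
  then show ?thesis
    using fS(1) Z unfolding coh_span_def by blast
qed

section \<open>Morphisms in coordinates\<close>

definition vals :: "nat set \<Rightarrow> ('i \<Rightarrow> rpoly) set" where
  "vals V = {F. \<forall>i. F i \<in> P V}"

text \<open>The counterpart of \<open>graded_hom\<close> on coordinate functions: linear over the
  scalars \<open>\<rat>[V']\<close>, while source and target have entries in the possibly larger
  rings \<open>\<rat>[V]\<close> and \<open>\<rat>[U]\<close>; \<open>e\<close> shifts the parity
  and \<open>d\<close> the degree.\<close>

definition model_hom :: "nat set \<Rightarrow> nat set \<Rightarrow> ('i \<Rightarrow> bit) \<Rightarrow> ('i \<Rightarrow> int) \<Rightarrow> nat set \<Rightarrow> ('j \<Rightarrow> bit) \<Rightarrow> ('j \<Rightarrow> int) \<Rightarrow>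
    bit \<Rightarrow> int \<Rightarrow> (('i \<Rightarrow> rpoly) \<Rightarrow> 'j \<Rightarrow> rpoly) \<Rightarrow> bool" where
  "model_hom V' V par \<delta> U par' \<delta>' e d f \<longleftrightarrow>
     (\<forall>F \<in> vals V. f F \<in> vals U) \<and>
     (\<forall>F \<in> vals V. \<forall>G \<in> vals V. \<forall>j. f (\<lambda>i. F i + G i) j = f F j + f G j) \<and>
     (\<forall>p \<in> P V'. \<forall>F \<in> vals V. \<forall>j. f (\<lambda>i. p * F i) j = p * f F j) \<and>
     (\<forall>k. \<forall>F \<in> vals V. (\<forall>i. par i \<noteq> k \<longrightarrow> F i = 0) \<longrightarrow> (\<forall>j. par' j \<noteq> k + e \<longrightarrow> f F j = 0)) \<and>
     (\<forall>k. \<forall>F \<in> vals V. (\<forall>i. homogeneous (k - \<delta> i) (F i)) \<longrightarrow> (\<forall>j. homogeneous (k + d - \<delta>' j) (f F j)))"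

lemma lift_model_hom:
  assumes "fact_coords n V par \<delta> D \<phi> X" "fact_coords n U par' \<delta>' E \<psi> Y" "V' \<subseteq> V" "V' \<subseteq> U"
    and f: "model_hom V' V par \<delta> U par' \<delta>' e d f"
  shows "\<exists>F. \<forall>k. F k \<in> graded_hom V' d (fmod X k) (fmod Y (k + e)) \<and>
    (\<forall>x \<in> carrier (fmod X k). \<psi> (k + e) (F k x) = f (\<phi> k x))"
proof -
  interpret X: fact_coords n V par \<delta> D \<phi> X by fact
  interpret Y: fact_coords n U par' \<delta>' E \<psi> Y by fact
  define F where "F k x = coords.elt (\<psi> (k + e)) (fmod Y (k + e)) (f (\<phi> k x))" for k x
  have "F k \<in> graded_hom V' d (fmod X k) (fmod Y (k + e)) \<and>
    (\<forall>x \<in> carrier (fmod X k). \<psi> (k + e) (F k x) = f (\<phi> k x))" for k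
  proof -
    interpret A: coords V "{i. par i = k}" \<delta> "\<phi> k" "fmod X k" by (rule X.coords)
    interpret B: coords U "{i. par' i = k + e}" \<delta>' "\<psi> (k + e)" "fmod Y (k + e)" by (rule Y.coords)
    have vals: "\<phi> k x \<in> vals V" if "x \<in> carrier (fmod X k)" for x
      using A.phi_P[OF that] by (simp add: vals_def)
    have fam: "f (\<phi> k x) \<in> fam U {i. par' i = k + e}" if x: "x \<in> carrier (fmod X k)" for x
    proof -
      have "\<forall>i. par i \<noteq> k \<longrightarrow> \<phi> k x i = 0" using A.phi_off[OF x] by simp
      then have "\<forall>j. par' j \<noteq> k + e \<longrightarrow> f (\<phi> k x) j = 0" "f (\<phi> k x) \<in> vals U"
        using f vals[OF x] unfolding model_hom_def by blast+
      then show ?thesis by (auto simp: fam_def vals_def)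
    qed
    have F: "F k x \<in> carrier (fmod Y (k + e))" "\<psi> (k + e) (F k x) = f (\<phi> k x)" if "x \<in> carrier (fmod X k)" for x
      using B.elt(1,2)[OF fam[OF that]] by (simp_all add: F_def)
    have sub: "p \<in> P V" "p \<in> P U" if "p \<in> P V'" for p using that assms(3,4) by (auto intro: P_mono)
    have "F k \<in> graded_hom V' d (fmod X k) (fmod Y (k + e))"
      unfolding graded_hom_def
    proof (intro CollectI conjI ballI allI subsetI)
      fix x y assume xy: "x \<in> carrier (fmod X k)" "y \<in> carrier (fmod X k)"
      have "\<phi> k (x \<oplus>\<^bsub>fmod X k\<^esub> y) = (\<lambda>i. \<phi> k x i + \<phi> k y i)"
        using xy by (simp add: fun_eq_iff A.phi_add)
      moreover have "f (\<lambda>i. \<phi> k x i + \<phi> k y i) j = f (\<phi> k x) j + f (\<phi> k y) j" for j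
        using f vals[OF xy(1)] vals[OF xy(2)] unfolding model_hom_def by blast
      ultimately show "F k (x \<oplus>\<^bsub>fmod X k\<^esub> y) = F k x \<oplus>\<^bsub>fmod Y (k + e)\<^esub> F k y"
        using xy by (intro B.eqI) (simp_all add: F A.add_closed B.add_closed B.phi_add)
    next
      fix p x assume p: "p \<in> P V'" and x: "x \<in> carrier (fmod X k)"
      have "\<phi> k (p \<odot>\<^bsub>fmod X k\<^esub> x) = (\<lambda>i. p * \<phi> k x i)"
        using x sub[OF p] by (simp add: fun_eq_iff A.phi_smult)
      moreover have "f (\<lambda>i. p * \<phi> k x i) j = p * f (\<phi> k x) j" for j
        using f vals[OF x] p unfolding model_hom_def by blast
      ultimately show "F k (p \<odot>\<^bsub>fmod X k\<^esub> x) = p \<odot>\<^bsub>fmod Y (k + e)\<^esub> F k x"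
        using x sub[OF p] by (intro B.eqI) (simp_all add: F A.smult_closed B.smult_closed B.phi_smult)
    next
      fix d' y assume "y \<in> F k ` grade (fmod X k) d'"
      then obtain x where x: "x \<in> carrier (fmod X k)" "\<forall>i. homogeneous (d' - \<delta> i) (\<phi> k x i)" "y = F k x"
        by (auto simp: A.grade_eq)
      then have "\<forall>j. homogeneous (d' + d - \<delta>' j) (f (\<phi> k x) j)"
        using f vals[OF x(1)] unfolding model_hom_def by blast
      then show "y \<in> grade (fmod Y (k + e)) (d' + d)"
        using x by (simp add: B.grade_eq F)
    qed (simp add: F)
    then show ?thesis using F by blast
  qed
  then show ?thesis by blast
qed

text \<open>\<open>f \<circ> g\<close> is the identity on the nose, so a homotopy is needed on
  \<open>X\<close> only. \<open>Y\<close> has entries in \<open>\<rat>[V']\<close>, hence finite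
  rank over the scalars and finite-dimensional cohomology; that of \<open>X\<close> follows by
  transfer.\<close>

lemma hmf_isomorphic_models:
  assumes X: "fact_coords n V par \<delta> D \<phi> X" and Y: "fact_coords n V' par' \<delta>' E \<psi> Y"
    and V: "V' \<subseteq> V" "finite V'" and w: "w \<in> P V'" "homogeneous (2 * (int n + 1)) w"
    and DD: "\<And>F i. D (D F) i = w * F i" and EE: "\<And>G j. E (E G) j = w * G j"
    and f: "model_hom V' V par \<delta> V' par' \<delta>' 0 0 f" and g: "model_hom V' V' par' \<delta>' V par \<delta> 0 0 g"
    and h: "model_hom V' V par \<delta> V par \<delta> 1 (- int n - 1) h"
    and fD: "\<And>F. F \<in> vals V \<Longrightarrow> f (D F) = E (f F)" and gE: "\<And>G. G \<in> vals V' \<Longrightarrow> g (E G) = D (g G)"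
    and fg: "\<And>G. G \<in> vals V' \<Longrightarrow> f (g G) = G"
    and hom: "\<And>F i. F \<in> vals V \<Longrightarrow> g (f F) i - F i = h (D F) i + D (h F) i"
  shows "hmf_isomorphic n V' w X Y"
proof -
  interpret X: fact_coords n V par \<delta> D \<phi> X by fact
  interpret Y: fact_coords n V' par' \<delta>' E \<psi> Y by fact
  have gX: "graded_factorization n V' w X"
    by (rule X.graded_factorization[OF V w DD])
  have gY: "graded_factorization n V' w Y"
    by (rule Y.graded_factorization[OF subset_refl V(2) w EE])
  have vX: "\<phi> k x \<in> vals V" if "x \<in> carrier (fmod X k)" for k x
    using coords.phi_P[OF X.coords that] by (simp add: vals_def)
  have vY: "\<psi> k y \<in> vals V'" if "y \<in> carrier (fmod Y k)" for k y
    using coords.phi_P[OF Y.coords that] by (simp add: vals_def)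
  obtain f' where f': "\<And>k. f' k \<in> graded_hom V' 0 (fmod X k) (fmod Y k)"
    "\<And>k x. x \<in> carrier (fmod X k) \<Longrightarrow> \<psi> k (f' k x) = f (\<phi> k x)"
    using lift_model_hom[OF X Y V(1) subset_refl f] by auto
  obtain g' where g': "\<And>k. g' k \<in> graded_hom V' 0 (fmod Y k) (fmod X k)"
    "\<And>k y. y \<in> carrier (fmod Y k) \<Longrightarrow> \<phi> k (g' k y) = g (\<psi> k y)"
    using lift_model_hom[OF Y X subset_refl V(1) g] by auto
  obtain h' where h': "\<And>k. h' k \<in> graded_hom V' (- int n - 1) (fmod X k) (fmod X (k + 1))"
    "\<And>k x. x \<in> carrier (fmod X k) \<Longrightarrow> \<phi> (k + 1) (h' k x) = h (\<phi> k x)"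
    using lift_model_hom[OF X X V(1) V(1) h] by blast
  have c: "f' k x \<in> carrier (fmod Y k)" "h' k x \<in> carrier (fmod X (k + 1))" if "x \<in> carrier (fmod X k)" for k x
    using that graded_homD(1)[OF f'(1)] graded_homD(1)[OF h'(1)] by auto
  have cg: "g' k y \<in> carrier (fmod X k)" if "y \<in> carrier (fmod Y k)" for k y
    using that graded_homD(1)[OF g'(1)] by auto
  have fh: "f' \<in> fact_hom V' X Y"
    unfolding fact_hom_def
  proof (intro CollectI allI conjI ballI f'(1))
    fix k x assume x: "x \<in> carrier (fmod X k)"
    have "\<psi> (k + 1) (f' (k + 1) (fdiff X k x)) = E (f (\<phi> k x))"
      using f'(2)[OF X.diff_closed[OF x]] X.phi_diff[OF x] fD[OF vX[OF x]] by simp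
    moreover have "\<psi> (k + 1) (fdiff Y k (f' k x)) = E (f (\<phi> k x))"
      using Y.phi_diff[OF c(1)[OF x]] f'(2)[OF x] by simp
    ultimately show "f' (k + 1) (fdiff X k x) = fdiff Y k (f' k x)"
      by (intro coords.eqI[OF Y.coords c(1)[OF X.diff_closed[OF x]] Y.diff_closed[OF c(1)[OF x]]]) simp
  qed
  have gh: "g' \<in> fact_hom V' Y X"
    unfolding fact_hom_def
  proof (intro CollectI allI conjI ballI g'(1))
    fix k y assume y: "y \<in> carrier (fmod Y k)"
    have "\<phi> (k + 1) (g' (k + 1) (fdiff Y k y)) = D (g (\<psi> k y))"
      using g'(2)[OF Y.diff_closed[OF y]] Y.phi_diff[OF y] gE[OF vY[OF y]] by simp
    moreover have "\<phi> (k + 1) (fdiff X k (g' k y)) = D (g (\<psi> k y))"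
      using X.phi_diff[OF cg[OF y]] g'(2)[OF y] by simp
    ultimately show "g' (k + 1) (fdiff Y k y) = fdiff X k (g' k y)"
      by (intro coords.eqI[OF X.coords cg[OF Y.diff_closed[OF y]] X.diff_closed[OF cg[OF y]]]) simp
  qed
  have fg': "f' k (g' k y) = y" if y: "y \<in> carrier (fmod Y k)" for k y
  proof -
    have "\<psi> k (f' k (g' k y)) = \<psi> k y"
      using f'(2)[OF cg[OF y]] g'(2)[OF y] fg[OF vY[OF y]] by simp
    then show ?thesis
      by (intro coords.eqI[OF Y.coords c(1)[OF cg[OF y]] y]) simp
  qed
  have hom': "g' k (f' k x) \<ominus>\<^bsub>fmod X k\<^esub> x = h' (k + 1) (fdiff X k x) \<oplus>\<^bsub>fmod X k\<^esub> fdiff X (k + 1) (h' k x)"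
    if x: "x \<in> carrier (fmod X k)" for k x
  proof -
    interpret A: coords V "{i. par i = k}" \<delta> "\<phi> k" "fmod X k" by (rule X.coords)
    have 1: "h' (k + 1) (fdiff X k x) \<in> carrier (fmod X k)" "\<phi> k (h' (k + 1) (fdiff X k x)) = h (D (\<phi> k x))"
      using c(2)[OF X.diff_closed[OF x]] h'(2)[OF X.diff_closed[OF x]] X.phi_diff[OF x] by simp_all
    have 2: "fdiff X (k + 1) (h' k x) \<in> carrier (fmod X k)" "\<phi> k (fdiff X (k + 1) (h' k x)) = D (h (\<phi> k x))"
      using X.diff_closed[OF c(2)[OF x]] X.phi_diff[OF c(2)[OF x]] h'(2)[OF x] by simp_all
    have 3: "g' k (f' k x) \<in> carrier (fmod X k)" "\<phi> k (g' k (f' k x)) = g (f (\<phi> k x))"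
      using cg[OF c(1)[OF x]] g'(2)[OF c(1)[OF x]] f'(2)[OF x] by simp_all
    show ?thesis
      using x 1 2 3 hom[OF vX[OF x]] by (intro A.eqI) (simp_all add: A.phi_minus A.phi_add A.add_closed)
  qed
  have hoX: "homotopic n V' X X (\<lambda>i. g' i \<circ> f' i) (\<lambda>i. id)"
    unfolding homotopic_def using h'(1) hom' by (intro exI[of _ h'] allI conjI ballI) simp_all
  have hoY: "homotopic n V' Y Y (\<lambda>i. f' i \<circ> g' i) (\<lambda>i. id)"
    unfolding homotopic_def
  \<comment> \<open>The composite on \<open>Y\<close> equals the identity, so the zero homotopy
    serves.\<close>
  proof (intro exI[of _ "\<lambda>i _. \<zero>\<^bsub>fmod Y (i + 1)\<^esub>"] allI conjI ballI)
    fix k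
    interpret A: coords V' "{i. par' i = k}" \<delta>' "\<psi> k" "fmod Y k" by (rule Y.coords)
    interpret B: coords V' "{i. par' i = k + 1}" \<delta>' "\<psi> (k + 1)" "fmod Y (k + 1)" by (rule Y.coords)
    show "(\<lambda>_. \<zero>\<^bsub>fmod Y (k + 1)\<^esub>) \<in> graded_hom V' (- int n - 1) (fmod Y k) (fmod Y (k - 1))"
      unfolding graded_hom_def
      by (auto simp: B.zero_closed B.grade_eq B.phi_zero B.add_closed B.phi_add B.smult_closed B.phi_smult intro!: B.eqI)
    fix y assume y: "y \<in> carrier (fmod Y k)"
    have z: "fdiff Y (k + 1) \<zero>\<^bsub>fmod Y (k + 1)\<^esub> = \<zero>\<^bsub>fmod Y k\<^esub>"
      by (rule graded_hom_zero(1)[OF graded_factorizationD(3)[OF gY] graded_factorizationD(1)[OF gY] graded_factorizationD(1)[OF gY]])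
    show "(f' k \<circ> g' k) y \<ominus>\<^bsub>fmod Y k\<^esub> id y = \<zero>\<^bsub>fmod Y (k + 1 + 1)\<^esub> \<oplus>\<^bsub>fmod Y k\<^esub> fdiff Y (k - 1) \<zero>\<^bsub>fmod Y (k + 1)\<^esub>"
      using y by (intro A.eqI) (simp_all add: fg' z A.phi_minus A.zero_closed A.add_closed A.phi_add A.phi_zero)
  qed
  \<comment> \<open>A nonzero constant term has degree \<open>0\<close>, but \<open>w\<close> is
    homogeneous of degree \<open>2 (n + 1)\<close>.\<close>
  have "lookup w 0 = 0"
  proof (rule ccontr)
    assume "lookup w 0 \<noteq> 0"
    then have "0 \<in> keys w"
      by (simp add: in_keys_iff)
    then have "mono_deg 0 = 2 * (int n + 1)"
      using w(2) unfolding homogeneous_def by blast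
    then show False by simp
  qed
  then have wm: "w \<in> max_ideal V'" by (rule max_ideal_I[OF w(1)])
  have oY: "hmf_object n V' w Y"
    unfolding hmf_object_def using gY Y.coh_span_exists[OF gY] finite_dim_cohomology[OF gY wm] by blast
  have "\<exists>S. coh_span V' X k S" for k
  proof -
    obtain S where "coh_span V' Y k S" using Y.coh_span_exists[OF gY] by blast
    from coh_span_transfer[OF gX gY fh gh fg' h'(1) hom' this] show ?thesis by blast
  qed
  then have oX: "hmf_object n V' w X"
    unfolding hmf_object_def using gX finite_dim_cohomology[OF gX wm] by blast
  show ?thesis
    unfolding hmf_isomorphic_def using oX oY fh gh hoX hoY by blast
qed

section \<open>Elimination of a Koszul row\<close>

definition linop :: "(('i \<Rightarrow> rpoly) \<Rightarrow> 'i \<Rightarrow> rpoly) \<Rightarrow> bool" where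
  "linop D \<longleftrightarrow> (\<forall>F G i. D (\<lambda>i. F i + G i) i = D F i + D G i) \<and> (\<forall>p F i. D (\<lambda>i. p * F i) i = p * D F i)"

lemma linopD:
  assumes "linop D"
  shows "D (\<lambda>i. F i + G i) i = D F i + D G i" "D (\<lambda>i. p * F i) i = p * D F i"
    "D (\<lambda>i. - F i) i = - D F i" "D (\<lambda>i. F i - G i) i = D F i - D G i" "D (\<lambda>i. 0) i = 0"
proof -
  show add: "\<And>F G. D (\<lambda>i. F i + G i) i = D F i + D G i" and mult: "\<And>p F. D (\<lambda>i. p * F i) i = p * D F i"
    using assms unfolding linop_def by blast+
  show neg: "\<And>F. D (\<lambda>i. - F i) i = - D F i" using mult[of "- 1"] by simp
  show "D (\<lambda>i. F i - G i) i = D F i - D G i" using add[of F "\<lambda>i. - G i"] neg[of G] by simp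
  show "D (\<lambda>i. 0) i = 0" using mult[of 0 "\<lambda>_. 0"] by simp
qed

lemma linop_koszul: "linop (koszul_op a b)"
  by (simp add: linop_def koszul_op_def algebra_simps)

lemma linop_tensor: "linop D \<Longrightarrow> linop E \<Longrightarrow> linop (tensor_op par D E)"
  by (auto simp: linop_def tensor_op_def algebra_simps)

lemma tensor_op_koszul:
  "tensor_op id (koszul_op a b) D F (0, j) = b * F (1, j) + D (\<lambda>j. F (0, j)) j"
  "tensor_op id (koszul_op a b) D F (1, j) = a * F (0, j) - D (\<lambda>j. F (1, j)) j"
  by (simp_all add: tensor_op_def koszul_op_def)

lemma tensor_op_koszul_square:
  assumes "linop D" "\<And>F j. D (D F) j = c * F j"
  shows "tensor_op id (koszul_op a b) D (tensor_op id (koszul_op a b) D F) ij = (a * b + c) * F ij"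
proof -
  obtain i j where ij: "ij = (i, j)" by fastforce
  show ?thesis
    unfolding ij by (cases i) (simp_all add: tensor_op_koszul linopD[OF assms(1)] assms(2) algebra_simps)
qed

lemma koszul_op_square: "koszul_op a b (koszul_op a b F) i = a * b * F i"
  by (cases i) (simp_all add: koszul_op_def mult_ac)

text \<open>The signs agree because \<open>(-1)^(i+j) = (-1)^i (-1)^j\<close>. Rebracketing puts the
  first Koszul row outermost, where the elimination can act on it.\<close>

lemma tensor_op_assoc:
  "tensor_op (\<lambda>ij. id (fst ij) + id (snd ij)) (tensor_op id (koszul_op a b) (koszul_op c d)) E F ((i, j), k) =
   tensor_op id (koszul_op a b) (tensor_op id (koszul_op c d) E) (\<lambda>(i, j, k). F ((i, j), k)) (i, j, k)"
  by (cases i; cases j) (simp_all add: tensor_op_def koszul_op_def)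

lemma map_koszul_op:
  assumes "\<And>p. \<theta> (a * p) = a' * \<theta> p" "\<And>p. \<theta> (b * p) = b' * \<theta> p"
  shows "\<theta> (koszul_op a b F i) = koszul_op a' b' (\<lambda>i. \<theta> (F i)) i"
  by (simp add: koszul_op_def assms)

lemma map_tensor_op:
  assumes "\<And>p q. \<theta> (p + q) = \<theta> p + \<theta> q" "\<And>p. \<theta> (- p) = - \<theta> p"
    and "\<And>F i. \<theta> (D F i) = D' (\<lambda>i. \<theta> (F i)) i" "\<And>F j. \<theta> (E F j) = E' (\<lambda>j. \<theta> (F j)) j"
  shows "\<theta> (tensor_op par D E F ij) = tensor_op par D' E' (\<lambda>ij. \<theta> (F ij)) ij"
  by (cases ij) (simp add: tensor_op_def assms)

text \<open>The operator to be reduced is \<open>{a, b} \<otimes> D\<close>, with square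
  \<open>w\<close>. Remainder \<open>\<rho>\<close> and quotient \<open>\<delta>\<close> of division
  by \<open>b\<close> are additive but not linear over all polynomials; that \<open>\<delta>\<close>
  commutes with \<open>w\<close> is what makes the embedding of remainders compatible with the
  differentials.\<close>

locale koszul_elimination =
  fixes a b w :: rpoly and D :: "('j \<Rightarrow> rpoly) \<Rightarrow> 'j \<Rightarrow> rpoly" and \<rho> \<delta> :: "rpoly \<Rightarrow> rpoly"
  assumes lin: "linop D" and DD: "\<And>F j. D (D F) j = (w - a * b) * F j"
    and rho_diff: "\<rho> (p - q) = \<rho> p - \<rho> q" and delta_diff: "\<delta> (p - q) = \<delta> p - \<delta> q"
    and division: "p = \<rho> p + b * \<delta> p"
    and rho_b: "\<rho> (b * p) = 0" and delta_b: "\<delta> (b * p) = p" and delta_rho: "\<delta> (\<rho> p) = 0"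
    and delta_w: "\<delta> (w * p) = w * \<delta> p"
begin

definition K :: "(bit \<times> 'j \<Rightarrow> rpoly) \<Rightarrow> bit \<times> 'j \<Rightarrow> rpoly" where
  "K = tensor_op id (koszul_op a b) D"

definition f :: "(bit \<times> 'j \<Rightarrow> rpoly) \<Rightarrow> 'j \<Rightarrow> rpoly" where
  "f F j = \<rho> (F (0, j))"

text \<open>The odd component is forced: the even component of \<open>K (g G)\<close> is
  \<open>D G\<close> plus \<open>b\<close> times it, and this has to be the remainder
  \<open>\<rho> (D G)\<close>.\<close>

definition g :: "('j \<Rightarrow> rpoly) \<Rightarrow> bit \<times> 'j \<Rightarrow> rpoly" where
  "g G = (\<lambda>(i, j). if i = 0 then G j else - \<delta> (D G j))"

text \<open>Division by \<open>b\<close> with a sign: multiplying the odd component back by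
  \<open>b\<close> gives remainder minus original in the even part.\<close>

definition h :: "(bit \<times> 'j \<Rightarrow> rpoly) \<Rightarrow> bit \<times> 'j \<Rightarrow> rpoly" where
  "h F = (\<lambda>(i, j). if i = 0 then 0 else - \<delta> (F (0, j)))"

lemma zero: "\<rho> 0 = 0" "\<delta> 0 = 0"
  using rho_diff[of 0 0] delta_diff[of 0 0] by simp_all

lemma minus: "\<rho> (- p) = - \<rho> p" "\<delta> (- p) = - \<delta> p"
  using rho_diff[of 0 p] delta_diff[of 0 p] by (simp_all add: zero)

lemma plus: "\<rho> (p + q) = \<rho> p + \<rho> q" "\<delta> (p + q) = \<delta> p + \<delta> q"
  using rho_diff[of p "- q"] delta_diff[of p "- q"] by (simp_all add: minus)

lemma rho_rho: "\<rho> (\<rho> p) = \<rho> p"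
proof -
  have "\<rho> p = p - b * \<delta> p" using division[of p] by (metis add_diff_cancel_right')
  then have "\<rho> (\<rho> p) = \<rho> (p - b * \<delta> p)" by simp
  then show ?thesis by (simp add: rho_diff rho_b)
qed

lemma D_split: "D F j = D (\<lambda>j. \<rho> (F j)) j + b * D (\<lambda>j. \<delta> (F j)) j"
proof -
  have "D F j = D (\<lambda>j. \<rho> (F j) + b * \<delta> (F j)) j" by (simp flip: division)
  then show ?thesis by (simp add: linopD[OF lin])
qed

text \<open>\<open>\<rho>\<close> kills multiples of \<open>b\<close>, hence both the contribution
  of the odd component and the part of \<open>D\<close> that comes from quotients.\<close>

lemma f_K: "f (K F) j = \<rho> (D (f F) j)"
proof -
  have "f (K F) j = \<rho> (D (\<lambda>j. F (0, j)) j)"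
    by (simp add: f_def K_def tensor_op_koszul plus rho_b)
  also have "\<dots> = \<rho> (D (\<lambda>j. \<rho> (F (0, j))) j)"
    by (subst D_split) (simp add: plus rho_b)
  finally show ?thesis by (simp add: f_def[abs_def])
qed

lemma f_g: "(\<And>j. \<rho> (G j) = G j) \<Longrightarrow> f (g G) = G"
  by (simp add: f_def g_def fun_eq_iff)

lemma rho_eq: "\<rho> p = p - b * \<delta> p"
  using division[of p] by (metis add_diff_cancel_right')

text \<open>The even component holds by the choice of \<open>g\<close>. In the odd one,
  \<open>\<delta>\<close> is applied to \<open>D (D G) = (w - a b) G\<close>; the term with
  \<open>w\<close> drops out because remainders have quotient \<open>0\<close>.\<close>

lemma g_D:
  assumes G: "\<And>j. \<rho> (G j) = G j"
  shows "g (\<lambda>j. \<rho> (D G j)) ij = K (g G) ij"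
proof -
  obtain i j where ij: "ij = (i, j)" by fastforce
  have dG: "\<delta> (G j) = 0" for j using delta_rho[of "G j"] G by simp
  have "\<delta> (D (\<lambda>j. D G j - b * \<delta> (D G j)) j) = \<delta> (w * G j - b * (a * G j) - b * D (\<lambda>j. \<delta> (D G j)) j)"
    by (simp add: linopD[OF lin] DD algebra_simps)
  also have "\<dots> = - (a * G j) - D (\<lambda>j. \<delta> (D G j)) j"
    by (simp add: delta_diff delta_w dG delta_b)
  finally have e: "\<delta> (D (\<lambda>j. \<rho> (D G j)) j) = - (a * G j) - D (\<lambda>j. \<delta> (D G j)) j"
    by (simp only: rho_eq)
  show ?thesis
  proof (cases i)
    case zero
    then show ?thesis by (simp add: ij K_def tensor_op_koszul g_def rho_eq[of "D G j"])
  next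
    case one
    then show ?thesis by (simp add: ij K_def tensor_op_koszul g_def e linopD(3)[OF lin])
  qed
qed

text \<open>The even component is the division identity. In the odd one, applying \<open>D\<close>
  to the division of \<open>F (0, j)\<close> accounts for the correction term of
  \<open>g\<close>.\<close>

lemma homotopy: "g (f F) ij - F ij = h (K F) ij + K (h F) ij"
proof -
  obtain i j where ij: "ij = (i, j)" by fastforce
  have f: "f F = (\<lambda>j. \<rho> (F (0, j)))" by (simp add: f_def fun_eq_iff)
  show ?thesis
  proof (cases i)
    case zero
    then show ?thesis
      by (simp add: ij K_def tensor_op_koszul g_def h_def f rho_eq[of "F (0, j)"] linopD(5)[OF lin])
  next
    case one
    have "\<delta> (D (\<lambda>j. F (0, j)) j) = \<delta> (D (f F) j) + D (\<lambda>j. \<delta> (F (0, j))) j"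
      by (subst D_split) (simp add: plus delta_b f)
    then show ?thesis
      by (simp add: one ij K_def tensor_op_koszul g_def h_def plus delta_b linopD(3)[OF lin])
  qed
qed

end

text \<open>Everything follows from cancelling \<open>Var v - c\<close>, that is from uniqueness of
  the quotient. The identities hold for all polynomials at once, as
  \<open>koszul_elimination\<close> demands; only \<open>c\<close> has to be free of
  \<open>v\<close>.\<close>

lemma ev_dq:
  assumes c: "c \<in> P (- {v})" "homogeneous 2 c"
  shows "p = ev v c p + (Var v - c) * dq v c p"
    and "ev v c ((Var v - c) * p) = 0" and "dq v c ((Var v - c) * p) = p"
    and "dq v c (p - q) = dq v c p - dq v c q" and "dq v c (ev v c p) = 0"
    and "dq v c (p * q) = dq v c p * q + ev v c p * dq v c q"
    and "ev v c (ev v c p) = ev v c p"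
proof -
  have div: "p = ev v c p + (Var v - c) * dq v c p" for p
  proof -
    have "insert v (- {v}) = UNIV" by auto
    then show ?thesis using dq_props(1)[of p v "- {v}" c] c by simp
  qed
  then show "p = ev v c p + (Var v - c) * dq v c p" .
  have div': "(Var v - c) * dq v c p = p - ev v c p" for p
    using div[of p] by (metis add_diff_cancel_left')
  have nz: "Var v - c \<noteq> 0" using Var_diff_nonzero[OF c(1)] by simp
  have unq: "dq v c p = q" if "(Var v - c) * q = p - ev v c p" for p q
    using div'[of p] that nz by (metis mult_left_cancel)
  have evc: "ev v c c = c" using ev_id[OF c(1)] by simp
  show ev0: "ev v c ((Var v - c) * p) = 0" for p
    by (simp add: ev_simps evc)
  show "dq v c ((Var v - c) * p) = p"
    by (rule unq) (simp add: ev0)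
  show "dq v c (p - q) = dq v c p - dq v c q"
    by (rule unq) (simp add: right_diff_distrib div' ev_simps)
  show "ev v c (ev v c p) = ev v c p" for p
    using ev0[of "dq v c p"] unfolding div' by (simp add: ev_simps)
  then show "dq v c (ev v c p) = 0"
    by (intro unq) simp
  show "dq v c (p * q) = dq v c p * q + ev v c p * dq v c q"
  proof (rule unq)
    have "(Var v - c) * (dq v c p * q + ev v c p * dq v c q) =
        ((Var v - c) * dq v c p) * q + ev v c p * ((Var v - c) * dq v c q)"
      by (simp add: algebra_simps)
    also have "\<dots> = p * q - ev v c (p * q)"
      unfolding div' by (simp add: ev_simps algebra_simps)
    finally show "(Var v - c) * (dq v c p * q + ev v c p * dq v c q) = p * q - ev v c (p * q)" .
  qed
qed

lemma ev_dq_scalar: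
  assumes "c \<in> P (- {v})" "homogeneous 2 c" "p \<in> P V" "v \<notin> V"
  shows "ev v c (p * q) = p * ev v c q" "dq v c (p * q) = p * dq v c q"
proof -
  have e: "ev v c p = p" by (rule ev_id[OF assms(3,4)])
  then have "dq v c p = 0" using ev_dq(5)[OF assms(1,2), of p] by simp
  then show "ev v c (p * q) = p * ev v c q" "dq v c (p * q) = p * dq v c q"
    by (simp_all add: ev_simps e ev_dq(6)[OF assms(1,2)])
qed

section \<open>Degrees, parities and coefficient rings of an elimination\<close>

lemma model_homD:
  assumes "model_hom V' V par \<delta> U par' \<delta>' e d f" "F \<in> vals V"
  shows "f F \<in> vals U" "G \<in> vals V \<Longrightarrow> f (\<lambda>i. F i + G i) = (\<lambda>j. f F j + f G j)"
    "p \<in> P V' \<Longrightarrow> f (\<lambda>i. p * F i) = (\<lambda>j. p * f F j)"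
    "\<forall>i. par i \<noteq> k \<longrightarrow> F i = 0 \<Longrightarrow> \<forall>j. par' j \<noteq> k + e \<longrightarrow> f F j = 0"
    "\<forall>i. homogeneous (l - \<delta> i) (F i) \<Longrightarrow> \<forall>j. homogeneous (l + d - \<delta>' j) (f F j)"
proof -
  note f = assms(1)[unfolded model_hom_def]
  show "f F \<in> vals U" using f assms(2) by blast
  show "G \<in> vals V \<Longrightarrow> f (\<lambda>i. F i + G i) = (\<lambda>j. f F j + f G j)"
    by (rule ext) (use f assms(2) in blast)
  show "p \<in> P V' \<Longrightarrow> f (\<lambda>i. p * F i) = (\<lambda>j. p * f F j)"
    by (rule ext) (use f assms(2) in blast)
  show "\<forall>i. par i \<noteq> k \<longrightarrow> F i = 0 \<Longrightarrow> \<forall>j. par' j \<noteq> k + e \<longrightarrow> f F j = 0"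
    using f assms(2) by blast
  show "\<forall>i. homogeneous (l - \<delta> i) (F i) \<Longrightarrow> \<forall>j. homogeneous (l + d - \<delta>' j) (f F j)"
    using f assms(2) by blast
qed

lemma model_hom_comp:
  fixes f :: "('a \<Rightarrow> rpoly) \<Rightarrow> 'b \<Rightarrow> rpoly" and g :: "('b \<Rightarrow> rpoly) \<Rightarrow> 'c \<Rightarrow> rpoly"
  assumes f: "model_hom V' V par \<delta> U par' \<delta>' e d f" and g: "model_hom V' U par' \<delta>' T par'' \<delta>'' e' d' g"
  shows "model_hom V' V par \<delta> T par'' \<delta>'' (e + e') (d + d') (\<lambda>F. g (f F))"
  unfolding model_hom_def
proof (intro conjI ballI)
  fix F :: "'a \<Rightarrow> rpoly" assume F: "F \<in> vals V"
  note fF = model_homD[OF f F] and gfF = model_homD[OF g model_homD(1)[OF f F]]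
  show "g (f F) \<in> vals T" by (rule gfF(1))
  show "\<forall>j. g (f (\<lambda>i. F i + G i)) j = g (f F) j + g (f G) j" if G: "G \<in> vals V" for G
    using fF(2)[OF G] gfF(2)[OF model_homD(1)[OF f G]] by simp
  show "\<forall>j. g (f (\<lambda>i. p * F i)) j = p * g (f F) j" if "p \<in> P V'" for p
    using fF(3)[OF that] gfF(3)[OF that] by simp
next
  show "\<forall>k. \<forall>F\<in>vals V. (\<forall>i. homogeneous (k - \<delta> i) (F i)) \<longrightarrow>
      (\<forall>j. homogeneous (k + (d + d') - \<delta>'' j) (g (f F) j))"
  proof (intro allI ballI impI)
    fix k j and F :: "'a \<Rightarrow> rpoly"
    assume F: "F \<in> vals V" "\<forall>i. homogeneous (k - \<delta> i) (F i)"
    show "homogeneous (k + (d + d') - \<delta>'' j) (g (f F) j)"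
      using model_homD(5)[OF g model_homD(1)[OF f F(1)] model_homD(5)[OF f F]] by (simp add: add.assoc)
  qed
  show "\<forall>k. \<forall>F\<in>vals V. (\<forall>i. par i \<noteq> k \<longrightarrow> F i = 0) \<longrightarrow> (\<forall>j. par'' j \<noteq> k + (e + e') \<longrightarrow> g (f F) j = 0)"
  proof (intro allI ballI impI)
    fix k j and F :: "'a \<Rightarrow> rpoly"
    assume F: "F \<in> vals V" "\<forall>i. par i \<noteq> k \<longrightarrow> F i = 0" and j: "par'' j \<noteq> k + (e + e')"
    show "g (f F) j = 0"
      using model_homD(4)[OF g model_homD(1)[OF f F(1)] model_homD(4)[OF f F]] j by (simp add: add.assoc)
  qed
qed

lemma model_hom_add:
  fixes f g :: "('a \<Rightarrow> rpoly) \<Rightarrow> 'b \<Rightarrow> rpoly"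
  assumes f: "model_hom V' V par \<delta> U par' \<delta>' e d f" and g: "model_hom V' V par \<delta> U par' \<delta>' e d g"
  shows "model_hom V' V par \<delta> U par' \<delta>' e d (\<lambda>F j. f F j + g F j)"
  unfolding model_hom_def
proof (intro conjI ballI)
  fix F :: "'a \<Rightarrow> rpoly" assume F: "F \<in> vals V"
  note fF = model_homD[OF f F] and gF = model_homD[OF g F]
  show "(\<lambda>j. f F j + g F j) \<in> vals U" using fF(1) gF(1) by (simp add: vals_def)
  show "\<forall>j. f (\<lambda>i. F i + G i) j + g (\<lambda>i. F i + G i) j = f F j + g F j + (f G j + g G j)" if G: "G \<in> vals V" for G
    using fF(2)[OF G] gF(2)[OF G] by simp
  show "\<forall>j. f (\<lambda>i. p * F i) j + g (\<lambda>i. p * F i) j = p * (f F j + g F j)" if "p \<in> P V'" for p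
    using fF(3)[OF that] gF(3)[OF that] by (simp add: distrib_left)
next
  show "\<forall>k. \<forall>F\<in>vals V. (\<forall>i. homogeneous (k - \<delta> i) (F i)) \<longrightarrow>
      (\<forall>j. homogeneous (k + d - \<delta>' j) (f F j + g F j))"
    using model_homD(5)[OF f] model_homD(5)[OF g] by (intro allI ballI impI homogeneous_add) blast+
  show "\<forall>k. \<forall>F\<in>vals V. (\<forall>i. par i \<noteq> k \<longrightarrow> F i = 0) \<longrightarrow> (\<forall>j. par' j \<noteq> k + e \<longrightarrow> f F j + g F j = 0)"
    using model_homD(4)[OF f] model_homD(4)[OF g] by fastforce
qed

text \<open>\<open>m\<close> is the degree of \<open>b\<close>: \<open>\<delta>\<close> lowers
  degrees by \<open>m\<close>, and the odd generator of the row sits in degree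
  \<open>m - n - 1\<close>. Entries lie in \<open>\<rat>[U]\<close>, remainders in
  \<open>\<rat>[U']\<close>, and linearity is over \<open>\<rat>[V']\<close>.\<close>

locale graded_elimination = koszul_elimination a b w D \<rho> \<delta> + odd_op n U par dg D
  for a b w and D :: "('j \<Rightarrow> rpoly) \<Rightarrow> 'j \<Rightarrow> rpoly" and \<rho> \<delta> n U par dg +
  fixes V' U' :: "nat set" and m :: int
  assumes rho_P: "p \<in> P U \<Longrightarrow> \<rho> p \<in> P U'" and delta_P: "p \<in> P U \<Longrightarrow> \<delta> p \<in> P U"
    and rho_scalar: "p \<in> P V' \<Longrightarrow> \<rho> (p * q) = p * \<rho> q" and delta_scalar: "p \<in> P V' \<Longrightarrow> \<delta> (p * q) = p * \<delta> q"
    and rho_graded: "homogeneous k p \<Longrightarrow> homogeneous k (\<rho> p)"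
    and delta_graded: "homogeneous k p \<Longrightarrow> homogeneous (k - m) (\<delta> p)"
    and U': "U' \<subseteq> U"
begin

abbreviation "kpar \<equiv> \<lambda>ij :: bit \<times> 'j. fst ij + par (snd ij)"
abbreviation "kdeg \<equiv> \<lambda>ij :: bit \<times> 'j. (if fst ij = 0 then 0 else m - int n - 1) + dg (snd ij)"

lemma model_hom_f: "model_hom V' U kpar kdeg U' par dg 0 0 f"
  unfolding model_hom_def
proof (intro conjI ballI allI impI)
  fix F :: "bit \<times> 'j \<Rightarrow> rpoly" and j k
  assume F: "F \<in> vals U"
  then show "f F \<in> vals U'" by (simp add: vals_def f_def rho_P)
  show "f F j = 0" if "\<forall>i. kpar i \<noteq> k \<longrightarrow> F i = 0" "par j \<noteq> k + 0" for k
    using that by (simp add: f_def zero)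
  show "homogeneous (k + 0 - dg j) (f F j)" if F: "\<forall>i. homogeneous (k - kdeg i) (F i)" for k
    using F[rule_format, of "(0, j)"] by (simp add: f_def rho_graded)
qed (simp_all add: f_def plus rho_scalar)

lemma model_hom_g: "model_hom V' U' par dg U kpar kdeg 0 0 g"
  unfolding model_hom_def
proof (intro conjI ballI allI impI)
  fix G :: "'j \<Rightarrow> rpoly" and ij :: "bit \<times> 'j"
  assume G: "G \<in> vals U'"
  obtain i j where ij: "ij = (i, j)" by fastforce
  have GU: "G j \<in> P U" for j using G P_mono[OF U'] by (simp add: vals_def)
  then show "g G \<in> vals U" using D_P[of U G] by (auto simp: vals_def g_def delta_P)
  show "g (\<lambda>i. G i + H i) ij = g G ij + g H ij" for H
    by (simp add: ij g_def D_add plus)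
  show "g G ij = 0" if "\<forall>i. par i \<noteq> k \<longrightarrow> G i = 0" "kpar ij \<noteq> k + 0" for k
    using that D_par[of k G j] by (cases i) (auto simp: ij g_def zero bit_neq add.commute)
  show "homogeneous (k + 0 - kdeg ij) (g G ij)" if "\<forall>i. homogeneous (k - dg i) (G i)" for k
  proof (cases "i = 0")
    case False
    have "homogeneous (k + int n + 1 - dg j - m) (\<delta> (D G j))"
      using D_graded[of k G j] that by (intro delta_graded) simp
    then show ?thesis using False by (simp add: ij g_def algebra_simps)
  qed (use that in \<open>simp add: ij g_def\<close>)
qed (auto simp: g_def D_mult delta_scalar)

lemma model_hom_h: "model_hom V' U kpar kdeg U kpar kdeg 1 (- int n - 1) h"
  unfolding model_hom_def
proof (intro conjI ballI allI impI)
  fix F :: "bit \<times> 'j \<Rightarrow> rpoly" and ij :: "bit \<times> 'j"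
  assume F: "F \<in> vals U"
  obtain i j where ij: "ij = (i, j)" by fastforce
  show "h F \<in> vals U" using F by (auto simp: vals_def h_def delta_P)
  show "h (\<lambda>i. F i + H i) ij = h F ij + h H ij" for H
    by (simp add: ij h_def plus)
  show "h F ij = 0" if "\<forall>i. kpar i \<noteq> k \<longrightarrow> F i = 0" "kpar ij \<noteq> k + 1" for k
    using that(1)[rule_format, of "(0, j)"] that(2) by (cases i) (auto simp: ij h_def zero add.commute)
  show "homogeneous (k + (- int n - 1) - kdeg ij) (h F ij)" if F: "\<forall>i. homogeneous (k - kdeg i) (F i)" for k
  proof (cases "i = 0")
    case False
    have "homogeneous (k - dg j - m) (\<delta> (F (0, j)))"
      using F[rule_format, of "(0, j)"] by (intro delta_graded) simp
    then show ?thesis using False by (simp add: ij h_def algebra_simps)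
  qed (simp add: ij h_def)
qed (auto simp: h_def delta_scalar)

end

section \<open>Wide edges as operators\<close>

definition wide_op :: "nat \<Rightarrow> rpoly \<Rightarrow> rpoly \<Rightarrow> rpoly \<Rightarrow> rpoly \<Rightarrow> (bit \<times> bit \<Rightarrow> rpoly) \<Rightarrow> bit \<times> bit \<Rightarrow> rpoly" where
  "wide_op n s p s' p' = tensor_op id (koszul_op (u1 n s s' p) (s - s')) (koszul_op (u2 n s' p p') (p - p'))"

abbreviation "wide_par \<equiv> \<lambda>ij :: bit \<times> bit. id (fst ij) + id (snd ij)"

text \<open>\<open>2n\<close> and \<open>2n - 2\<close> are the degrees of \<open>u1\<close> and
  \<open>u2\<close>; the final \<open>- 1\<close> is the normalizing shift \<open>{-1}\<close> of a
  wide edge.\<close>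

definition wide_deg :: "nat \<Rightarrow> bit \<times> bit \<Rightarrow> int" where
  "wide_deg n = (\<lambda>ij. koszul_deg n (2 * int n) (fst ij) + koszul_deg n (2 * int n - 2) (snd ij) + (- 1))"

definition potential :: "nat \<Rightarrow> rpoly \<Rightarrow> rpoly \<Rightarrow> rpoly \<Rightarrow> rpoly \<Rightarrow> rpoly" where
  "potential n s p s' p' = psum (n + 1) s p - psum (n + 1) s' p'"

lemma u_mult:
  "u1 n s s' p * (s - s') = psum (n + 1) s p - psum (n + 1) s' p"
  "u2 n s p p' * (p - p') = psum (n + 1) s p - psum (n + 1) s p'"
  by (simp_all only: u1_def u2_def psum1_mult psum2_mult)

lemma linop_wide_op: "linop (wide_op n s p s' p')"
  unfolding wide_op_def by (intro linop_tensor linop_koszul)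

text \<open>The products of the two rows telescope: the mixed power sum at \<open>(s', p)\<close>
  cancels.\<close>

lemma wide_op_square: "wide_op n s p s' p' (wide_op n s p s' p' F) ij = potential n s p s' p' * F ij"
proof -
  have "wide_op n s p s' p' (wide_op n s p s' p' F) ij =
      (u1 n s s' p * (s - s') + u2 n s' p p' * (p - p')) * F ij"
    unfolding wide_op_def by (rule tensor_op_koszul_square[OF linop_koszul koszul_op_square])
  then show ?thesis by (simp only: u_mult potential_def) simp
qed

lemma homogeneous_u:
  assumes "homogeneous 2 s" "homogeneous 4 p" "homogeneous 2 s'" "homogeneous 4 p'"
  shows "homogeneous (2 * int n) (u1 n s s' p)" "homogeneous (2 * int n - 2) (u2 n s' p p')"
  using homogeneous_psum(2)[OF assms(1,2,3), of "n + 1"] homogeneous_psum(3)[OF assms(3,2,4), of "n + 1"]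
  by (simp_all add: u1_def u2_def)

lemma P_u: "s \<in> P V \<Longrightarrow> p \<in> P V \<Longrightarrow> s' \<in> P V \<Longrightarrow> u1 n s s' p \<in> P V"
  "s \<in> P V \<Longrightarrow> p \<in> P V \<Longrightarrow> p' \<in> P V \<Longrightarrow> u2 n s p p' \<in> P V"
  unfolding u1_def u2_def by (simp_all only: P_psum)

lemma odd_op_wide:
  assumes "homogeneous 2 s" "homogeneous 4 p" "homogeneous 2 s'" "homogeneous 4 p'"
    and "s \<in> P V" "p \<in> P V" "s' \<in> P V" "p' \<in> P V"
  shows "odd_op n V wide_par (wide_deg n) (wide_op n s p s' p')"
proof -
  have k1: "odd_op n V id (koszul_deg n (2 * int n)) (koszul_op (u1 n s s' p) (s - s'))"
    using assms by (intro odd_op_koszul P_u P_diff homogeneous_u) (simp_all add: homogeneous_diff)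
  have k2: "odd_op n V id (koszul_deg n (2 * int n - 2)) (koszul_op (u2 n s' p p') (p - p'))"
    using assms by (intro odd_op_koszul P_u P_diff homogeneous_u(2)[of s]) (simp_all add: homogeneous_diff)
  show ?thesis
    using odd_op_shift[OF odd_op_tensor[OF k1 k2], of "- 1"] unfolding wide_op_def wide_deg_def Un_absorb .
qed

lemma homogeneous_sp: "homogeneous 2 (Var i + Var j)" "homogeneous 4 (Var i * Var j)"
  using homogeneous_mult[OF homogeneous_Var homogeneous_Var] by (simp_all add: homogeneous_add)

lemma fact_coords_wide_edge:
  assumes "n \<ge> 1" "distinct [i, j, k, l]"
  shows "\<exists>\<phi>. fact_coords n {i, j, k, l} wide_par (wide_deg n)
    (wide_op n (Var i + Var j) (Var i * Var j) (Var k + Var l) (Var k * Var l)) \<phi> (wide_edge n i j k l)"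
proof -
  let ?s = "Var i + Var j" and ?p = "Var i * Var j" and ?s' = "Var k + Var l" and ?p' = "Var k * Var l"
  let ?V = "{i, j, k, l}"
  note hom = homogeneous_u[OF homogeneous_sp(1)[of i j] homogeneous_sp(2)[of i j]
      homogeneous_sp(1)[of k l] homogeneous_sp(2)[of k l], of n]
  have P: "?s \<in> P ?V" "?p \<in> P ?V" "?s' \<in> P ?V" "?p' \<in> P ?V" by simp_all
  note W = wide_edge_data[OF assms]
  have k1: "fact_coords n ?V id (koszul_deg n (2 * int n)) (koszul_op (u1 n ?s ?s' ?p) (?s - ?s'))
     (\<lambda>k x i. if i = k then x else 0) (koszul n ?V (u1 n ?s ?s' ?p) (?s - ?s'))"
    by (intro fact_coords_koszul P_u P_diff P hom W) (simp_all add: homogeneous_diff homogeneous_sp)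
  have k2: "fact_coords n ?V id (koszul_deg n (2 * int n - 2)) (koszul_op (u2 n ?s' ?p ?p') (?p - ?p'))
     (\<lambda>k x i. if i = k then x else 0) (koszul n ?V (u2 n ?s' ?p ?p') (?p - ?p'))"
    by (intro fact_coords_koszul P_u P_diff P hom W) (simp_all add: homogeneous_diff homogeneous_sp)
  show ?thesis
    unfolding W(1) wide_op_def wide_deg_def
    using fact_coords_shift[OF fact_coords_tensor[OF k1 k2], of "- 1"] unfolding Un_absorb by blast
qed

section \<open>Two wide edges in a row\<close>

lemma ev_u:
  "ev v c (u1 n s s' p) = u1 n (ev v c s) (ev v c s') (ev v c p)"
  "ev v c (u2 n s p p') = u2 n (ev v c s) (ev v c p) (ev v c p')"
  by (simp_all only: u1_def u2_def ev_def subst_psum)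

text \<open>Only the four entries of the operator have to act through scalars
  \<open>\<sigma> e\<close>; \<open>\<theta>\<close> itself need not be multiplicative. This admits
  \<open>pi1\<close>, which is not a ring homomorphism.\<close>

lemma map_wide_op:
  assumes "\<And>p q. \<theta> (p + q) = \<theta> p + \<theta> q" "\<And>p. \<theta> (- p) = - \<theta> p"
    and "\<And>e z. e \<in> {u1 n s s' p, s - s', u2 n s' p p', p - p'} \<Longrightarrow> \<theta> (e * z) = \<sigma> e * \<theta> z"
    and "\<sigma> (u1 n s s' p) = u1 n a a' b" "\<sigma> (s - s') = a - a'" "\<sigma> (u2 n s' p p') = u2 n a' b b'" "\<sigma> (p - p') = b - b'"
  shows "\<theta> (wide_op n s p s' p' F ij) = wide_op n a b a' b' (\<lambda>ij. \<theta> (F ij)) ij"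
  unfolding wide_op_def
  by (intro map_tensor_op map_koszul_op assms(1,2)) (simp_all add: assms(3-7))

declare One_nat_def [simp del]

locale digon =
  fixes n :: nat
begin

section \<open>The polynomials of the digon and the two divisions\<close>

definition "s = Var 1 + Var 2"
definition "p = Var 1 * Var 2"
definition "s' = Var 3 + Var 4"
definition "p' = Var 3 * Var 4"
definition "t = Var 5 + Var 6"
definition "q = Var 5 * Var 6"
text \<open>The value of \<open>x6\<close> that solves \<open>t = s\<close>; \<open>q5\<close> is
  what \<open>q\<close> becomes under it.\<close>

definition "c6 = Var 1 + Var 2 - Var 5"
definition "q5 = Var 5 * c6"
definition "w = potential n s p s' p'"

abbreviation "V4 \<equiv> {1, 2, 3, 4 :: nat}"
abbreviation "V5 \<equiv> {1, 2, 3, 4, 5 :: nat}"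
abbreviation "V6 \<equiv> {1, 2, 3, 4, 5, 6 :: nat}"

lemmas defs = s_def p_def s'_def p'_def t_def q_def c6_def q5_def

lemma homs: "homogeneous 2 s" "homogeneous 4 p" "homogeneous 2 s'" "homogeneous 4 p'"
  "homogeneous 2 t" "homogeneous 4 q" "homogeneous 2 c6" "homogeneous 4 q5"
proof -
  show c: "homogeneous 2 c6"
    unfolding c6_def by (intro homogeneous_diff homogeneous_add homogeneous_Var)
  show "homogeneous 4 q5"
    using homogeneous_mult[OF homogeneous_Var c] by (simp add: q5_def)
qed (simp_all add: s_def p_def s'_def p'_def t_def q_def homogeneous_sp)

lemma Ps: "s \<in> P V4" "p \<in> P V4" "s' \<in> P V4" "p' \<in> P V4" "c6 \<in> P V5" "q5 \<in> P V5"
  "s \<in> P V5" "p \<in> P V5" "s' \<in> P V5" "p' \<in> P V5"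
  "s \<in> P V6" "p \<in> P V6" "s' \<in> P V6" "p' \<in> P V6" "t \<in> P V6" "q \<in> P V6"
  by (simp_all add: defs)

lemma wP: "w \<in> P V4" "homogeneous (2 * (int n + 1)) w"
  using homogeneous_psum(1)[OF homs(1,2), of "n + 1"] homogeneous_psum(1)[OF homs(3,4), of "n + 1"]
  by (simp_all add: w_def potential_def P_psum Ps homogeneous_diff del: psum.simps)

definition "\<rho>1 = ev 6 c6"
text \<open>The sign comes from \<open>s - t = - (Var 6 - c6)\<close>.\<close>

definition "\<delta>1 z = - dq 6 c6 z"
text \<open>\<open>pi0\<close> and \<open>pi1\<close> are the Newton interpolation coefficients at
  the nodes \<open>x5 = x1\<close> and \<open>x5 = x2\<close>: the value at the first node and the
  divided difference over both. They describe the remainder modulo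
  \<open>(x5 - x1) (x5 - x2)\<close>.\<close>

definition "pi0 = ev 5 (Var 1)"
definition "pi1 z = ev 5 (Var 2) (dq 5 (Var 1) z)"
definition "incl y z = y + (Var 5 - Var 1) * z"
definition "\<rho>2 z = incl (pi0 z) (pi1 z)"
definition "\<delta>2 z = dq 5 (Var 2) (dq 5 (Var 1) z)"

lemma c6': "c6 \<in> P (- {6})" "homogeneous 2 c6"
  by (simp_all add: c6_def homs(7)[unfolded c6_def])

lemma x1': "Var 1 \<in> P (- {5})" "homogeneous 2 (Var 1)"
  and x2': "Var 2 \<in> P (- {5})" "homogeneous 2 (Var 2)"
  by simp_all

lemmas e6 = ev_dq[OF c6'] and e51 = ev_dq[OF x1'] and e52 = ev_dq[OF x2']

lemma scalars:
  assumes "y \<in> P V4"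
  shows "ev 6 c6 (y * z) = y * ev 6 c6 z" "dq 6 c6 (y * z) = y * dq 6 c6 z"
    "ev 5 (Var 1) (y * z) = y * ev 5 (Var 1) z" "dq 5 (Var 1) (y * z) = y * dq 5 (Var 1) z"
    "ev 5 (Var 2) (y * z) = y * ev 5 (Var 2) z" "dq 5 (Var 2) (y * z) = y * dq 5 (Var 2) z"
  using ev_dq_scalar[OF c6' assms] ev_dq_scalar[OF x1' assms] ev_dq_scalar[OF x2' assms] by simp_all

lemma b1: "s - t = - (Var 6 - c6)"
  by (simp add: defs)

lemma b2: "p - q5 = (Var 5 - Var 1) * (Var 5 - Var 2)"
  by (simp add: defs algebra_simps)

lemma pi_linear: "pi0 (y - z) = pi0 y - pi0 z" "pi1 (y - z) = pi1 y - pi1 z"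
  "pi0 (y + z) = pi0 y + pi0 z" "pi1 (y + z) = pi1 y + pi1 z" "pi0 (- z) = - pi0 z" "pi1 (- z) = - pi1 z"
  "pi0 0 = 0" "pi1 0 = 0"
proof -
  show d: "pi0 (y - z) = pi0 y - pi0 z" "pi1 (y - z) = pi1 y - pi1 z" for y z
    by (simp_all add: pi0_def pi1_def ev_simps e51(4))
  show "pi0 0 = 0" "pi1 0 = 0" using d[of 0 0] by simp_all
  then show n: "pi0 (- z) = - pi0 z" "pi1 (- z) = - pi1 z" for z using d[of 0 z] by simp_all
  show "pi0 (y + z) = pi0 y + pi0 z" "pi1 (y + z) = pi1 y + pi1 z"
    using d[of y "- z"] by (simp_all add: n)
qed

text \<open>If \<open>e\<close> has the same value at both nodes, its divided difference vanishes,
  so \<open>e\<close> is congruent to that value modulo the divisor and acts as a scalar on both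
  coefficients.\<close>

lemma pi_mult:
  assumes "ev 5 (Var 1) e = e'" "ev 5 (Var 2) e = e'"
  shows "pi0 (e * z) = e' * pi0 z" "pi1 (e * z) = e' * pi1 z"
proof -
  show "pi0 (e * z) = e' * pi0 z" by (simp add: pi0_def ev_simps assms)
  have e'0: "ev 5 (Var 2) e' = e'" using e52(7)[of e] by (simp add: assms)
  have "e = e' + (Var 5 - Var 1) * dq 5 (Var 1) e" using e51(1)[of e] by (simp add: assms)
  then have "ev 5 (Var 2) e = ev 5 (Var 2) (e' + (Var 5 - Var 1) * dq 5 (Var 1) e)" by simp
  then have "e' = e' + (Var 2 - Var 1) * ev 5 (Var 2) (dq 5 (Var 1) e)"
    by (simp add: ev_simps e'0 assms)
  \<comment> \<open>The nodes are distinct, so \<open>x2 - x1\<close> can be cancelled and the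
    divided difference is \<open>0\<close>.\<close>
  moreover have "Var 2 - Var 1 \<noteq> 0" using Var_diff_nonzero[of "Var 1" "{1}" 2] by simp
  ultimately have "ev 5 (Var 2) (dq 5 (Var 1) e) = 0" by simp
  then show "pi1 (e * z) = e' * pi1 z"
    by (simp add: pi1_def e51(6) ev_simps assms e'0)
qed

lemma pi_b2: "pi0 ((p - q5) * z) = 0" "pi1 ((p - q5) * z) = 0"
  unfolding b2 mult.assoc by (simp_all add: pi0_def pi1_def e51(2,3) e52(2))

lemma pi_V4: "y \<in> P V4 \<Longrightarrow> pi0 y = y" "y \<in> P V4 \<Longrightarrow> pi1 y = 0"
proof -
  assume y: "y \<in> P V4"
  show 0: "pi0 y = y" unfolding pi0_def by (rule ev_id[OF y]) simp
  have "dq 5 (Var 1) (pi0 y) = 0" unfolding pi0_def by (rule e51(5))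
  then show "pi1 y = 0" unfolding 0 by (simp add: pi1_def ev_simps)
qed

lemma pi_incl: "y \<in> P V4 \<Longrightarrow> z \<in> P V4 \<Longrightarrow> pi0 (incl y z) = y" "y \<in> P V4 \<Longrightarrow> z \<in> P V4 \<Longrightarrow> pi1 (incl y z) = z"
proof -
  assume y: "y \<in> P V4" and z: "z \<in> P V4"
  have "pi0 ((Var 5 - Var 1) * z) = 0" by (simp add: pi0_def e51(2))
  then show "pi0 (incl y z) = y" by (simp add: incl_def pi_linear pi_V4 y)
  have "pi1 ((Var 5 - Var 1) * z) = z" unfolding pi1_def e51(3) by (rule ev_id[OF z]) simp
  then show "pi1 (incl y z) = z" by (simp add: incl_def pi_linear pi_V4 y)
qed

lemma pi_rho2: "pi0 (\<rho>2 z) = pi0 z" "pi1 (\<rho>2 z) = pi1 z"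
proof -
  have "pi0 (pi0 z) = pi0 z" unfolding pi0_def by (rule e51(7))
  then show "pi0 (\<rho>2 z) = pi0 z"
    by (simp add: \<rho>2_def incl_def pi_linear) (simp add: pi0_def e51(2))
  have "pi1 (pi0 z) = 0" by (simp add: pi1_def pi0_def e51(5) ev_simps)
  then show "pi1 (\<rho>2 z) = pi1 z"
    by (simp add: \<rho>2_def incl_def pi_linear) (simp add: pi1_def e51(3) e52(7))
qed

text \<open>Newton's form: divide by \<open>x5 - x1\<close>, then divide the quotient by
  \<open>x5 - x2\<close>.\<close>

lemma division2: "z = \<rho>2 z + (p - q5) * \<delta>2 z"
proof -
  have "z = ev 5 (Var 1) z + (Var 5 - Var 1) * dq 5 (Var 1) z" by (rule e51(1))
  also have "dq 5 (Var 1) z = ev 5 (Var 2) (dq 5 (Var 1) z) + (Var 5 - Var 2) * dq 5 (Var 2) (dq 5 (Var 1) z)"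
    by (rule e52(1))
  finally have "z = ev 5 (Var 1) z + (Var 5 - Var 1) * (ev 5 (Var 2) (dq 5 (Var 1) z) + (Var 5 - Var 2) * dq 5 (Var 2) (dq 5 (Var 1) z))" .
  also have "\<dots> = \<rho>2 z + (p - q5) * \<delta>2 z"
    unfolding b2 \<rho>2_def incl_def pi0_def pi1_def \<delta>2_def by (simp only: distrib_left mult.assoc add.assoc)
  finally show ?thesis .
qed

abbreviation "D1 \<equiv> tensor_op id (koszul_op (u2 n t p q) (p - q)) (wide_op n t q s' p')"
abbreviation "D2 \<equiv> wide_op n s q5 s' p'"
abbreviation "par1 \<equiv> \<lambda>ij :: bit \<times> bit \<times> bit. id (fst ij) + wide_par (snd ij)"
abbreviation "deg1 \<equiv> \<lambda>ij :: bit \<times> bit \<times> bit. koszul_deg n (2 * int n - 2) (fst ij) + wide_deg n (snd ij) + (- 1)"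
abbreviation "deg2 \<equiv> \<lambda>ij. wide_deg n ij + (- 1)"

text \<open>The eliminated row is the first one of the edge with outgoing marks
  \<open>x1, x2\<close>. \<open>D1\<close> consists of the other row of this edge and of the whole
  second edge; the divisor \<open>s - t\<close> has degree 2.\<close>

sublocale S1: graded_elimination "u1 n s t p" "s - t" w D1 \<rho>1 \<delta>1 n V6 par1 deg1 V4 V5 2
proof (intro graded_elimination.intro koszul_elimination.intro graded_elimination_axioms.intro)
  show "linop D1" by (intro linop_tensor linop_koszul linop_wide_op)
  \<comment> \<open>Removing the first row from \<open>w\<close> leaves the difference of the power
    sums at \<open>(t, p)\<close> and \<open>(s', p')\<close>, to which the squares in
    \<open>D1\<close> telescope.\<close>
  show "D1 (D1 F) j = (w - u1 n s t p * (s - t)) * F j" for F j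
    unfolding tensor_op_koszul_square[OF linop_wide_op wide_op_square] u_mult w_def potential_def
    by (simp add: algebra_simps del: psum.simps)
  show "\<rho>1 (y - z) = \<rho>1 y - \<rho>1 z" "\<delta>1 (y - z) = \<delta>1 y - \<delta>1 z" for y z
    by (simp_all add: \<rho>1_def \<delta>1_def ev_simps e6(4))
  show "z = \<rho>1 z + (s - t) * \<delta>1 z" for z
    unfolding b1 \<rho>1_def \<delta>1_def minus_mult_minus by (rule e6(1))
  show "\<rho>1 ((s - t) * z) = 0" for z
  proof -
    have "(s - t) * z = (Var 6 - c6) * - z" by (simp add: b1 algebra_simps)
    then show ?thesis by (simp only: \<rho>1_def e6(2))
  qed
  show "\<delta>1 ((s - t) * z) = z" for z
  proof -
    have "(s - t) * z = (Var 6 - c6) * - z" by (simp add: b1 algebra_simps)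
    then show ?thesis by (simp only: \<delta>1_def e6(3)) simp
  qed
  show "\<delta>1 (\<rho>1 z) = 0" for z by (simp add: \<delta>1_def \<rho>1_def e6(5))
  show "\<delta>1 (w * z) = w * \<delta>1 z" for z by (simp add: \<delta>1_def scalars wP)
  have k: "odd_op n V6 id (koszul_deg n (2 * int n - 2)) (koszul_op (u2 n t p q) (p - q))"
    by (intro odd_op_koszul P_u P_diff homogeneous_u(2)[of s] Ps homs) (simp add: homogeneous_diff homs)
  have "odd_op n V6 wide_par (wide_deg n) (wide_op n t q s' p')"
    by (intro odd_op_wide homs Ps)
  from odd_op_shift[OF odd_op_tensor[OF k this], of "- 1"]
  show "odd_op n V6 par1 deg1 D1" unfolding Un_absorb .
  show "\<rho>1 z \<in> P V5" if "z \<in> P V6" for z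
    unfolding \<rho>1_def by (rule ev_in_P[OF that _ Ps(5)]) auto
  have i: "insert 6 V5 = V6" by auto
  show "\<delta>1 z \<in> P V6" if "z \<in> P V6" for z
    using dq_props(2)[of z 6 V5 c6] that Ps(5) homs unfolding i \<delta>1_def by simp
  show "\<rho>1 (y * z) = y * \<rho>1 z" "\<delta>1 (y * z) = y * \<delta>1 z" if "y \<in> P V4" for y z
    using that by (simp_all add: \<rho>1_def \<delta>1_def scalars)
  show "homogeneous k (\<rho>1 z)" if "homogeneous k z" for k z
    unfolding \<rho>1_def by (rule homogeneous_ev[OF homs(7) that])
  show "homogeneous (k - 2) (\<delta>1 z)" if "homogeneous k z" for k z
  proof -
    have "insert (6 :: nat) (- {6}) = UNIV" by auto
    then show ?thesis using dq_props(3)[of z 6 "- {6}" c6] that c6' by (simp add: \<delta>1_def)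
  qed
qed auto

text \<open>The divisor \<open>p - q5\<close> has degree 4. The remainders
  \<open>y + (x5 - x1) z\<close> still contain \<open>x5\<close>, so they stay in
  \<open>\<rat>[x1,...,x5]\<close> and are unpacked into pairs of coefficients afterwards, by
  \<open>proj\<close>.\<close>

sublocale S2: graded_elimination "u2 n s p q5" "p - q5" w D2 \<rho>2 \<delta>2 n V5 wide_par deg2 V4 V5 4
proof (intro graded_elimination.intro koszul_elimination.intro graded_elimination_axioms.intro)
  show "linop D2" by (rule linop_wide_op)
  show "D2 (D2 F) j = (w - u2 n s p q5 * (p - q5)) * F j" for F j
    unfolding wide_op_square u_mult w_def potential_def by (simp add: algebra_simps del: psum.simps)
  show "\<rho>2 (y - z) = \<rho>2 y - \<rho>2 z" "\<delta>2 (y - z) = \<delta>2 y - \<delta>2 z" for y z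
    by (simp add: \<rho>2_def incl_def pi_linear algebra_simps, simp add: \<delta>2_def e51(4) e52(4))
  show "z = \<rho>2 z + (p - q5) * \<delta>2 z" for z by (rule division2)
  show "\<rho>2 ((p - q5) * z) = 0" for z by (simp add: \<rho>2_def pi_b2 incl_def)
  show "\<delta>2 ((p - q5) * z) = z" for z
    unfolding b2 mult.assoc \<delta>2_def e51(3) e52(3) ..
  show "\<delta>2 (\<rho>2 z) = 0" for z
  proof -
    have "dq 5 (Var 1) (\<rho>2 z) = pi1 z"
    proof -
      have "dq 5 (Var 1) (y + v) = dq 5 (Var 1) y + dq 5 (Var 1) v" for y v
        using e51(4)[of "y + v" v] by simp
      then show ?thesis by (simp add: \<rho>2_def incl_def e51(3)) (simp add: pi0_def e51(5))
    qed
    then show ?thesis by (simp add: \<delta>2_def pi1_def e52(5))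
  qed
  show "\<delta>2 (w * z) = w * \<delta>2 z" for z by (simp add: \<delta>2_def scalars wP)
  show "odd_op n V5 wide_par deg2 D2"
    by (intro odd_op_shift odd_op_wide homs Ps)
  have i: "insert 5 V4 = V5" by auto
  have P5: "ev 5 c z \<in> P V4" "dq 5 c z \<in> P V5" if "z \<in> P V5" "c \<in> P V4" "homogeneous 2 c" for c z
    using that ev_in_P[of z V5 5 V4 c] dq_props(2)[of z 5 V4 c] unfolding i by auto
  have P4: "z \<in> P V4 \<Longrightarrow> z \<in> P V5" for z by (rule P_mono[rotated]) auto
  show "\<rho>2 z \<in> P V5" "\<delta>2 z \<in> P V5" if "z \<in> P V5" for z
    using that P5 P4 by (simp_all add: \<rho>2_def \<delta>2_def incl_def pi0_def pi1_def)
  show "\<rho>2 (y * z) = y * \<rho>2 z" "\<delta>2 (y * z) = y * \<delta>2 z" if "y \<in> P V4" for y z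
    using that by (simp_all add: \<rho>2_def \<delta>2_def incl_def pi0_def pi1_def scalars algebra_simps)
  have h: "homogeneous (k - 2) (dq 5 c z)" if "homogeneous k z" "c \<in> P (- {5})" "homogeneous 2 c" for k c z
  proof -
    have "insert (5 :: nat) (- {5}) = UNIV" by auto
    then show ?thesis using dq_props(3)[of z 5 "- {5}" c] that by simp
  qed
  show "homogeneous k (\<rho>2 z)" if "homogeneous k z" for k z
  proof -
    have "homogeneous (k - 2) (pi1 z)"
      unfolding pi1_def by (intro homogeneous_ev x2' h x1' that)
    then have "homogeneous k ((Var 5 - Var 1) * pi1 z)"
      by (rule homogeneous_mult'[OF homogeneous_diff[OF homogeneous_Var homogeneous_Var]]) simp
    then show ?thesis
      unfolding \<rho>2_def incl_def pi0_def by (intro homogeneous_add homogeneous_ev x1' that)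
  qed
  show "homogeneous (k - 4) (\<delta>2 z)" if "homogeneous k z" for k z
    using h[OF h[OF that x1'] x2'] by (simp add: \<delta>2_def)
qed auto

end

lemma model_hom_reindex:
  assumes "\<And>j. par' j = par (r j)" "\<And>j. \<delta>' j = \<delta> (r j)"
  shows "model_hom V' V par \<delta> V par' \<delta>' 0 0 (\<lambda>F j. F (r j))"
  using assms by (simp add: model_hom_def vals_def)

context digon
begin

section \<open>Composition of the two eliminations\<close>

abbreviation "W4 \<equiv> wide_op n s p s' p'"

text \<open>\<open>q5\<close> becomes \<open>x1 x2\<close> both at \<open>x5 = x1\<close> and at
  \<open>x5 = x2\<close>, and nothing else in \<open>D2\<close> involves \<open>x5\<close>. So all
  entries act as scalars on the interpolation coefficients, and \<open>D2\<close> splits into two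
  copies of the wide edge.\<close>

lemma pi_D2: "pi0 (D2 F k) = W4 (\<lambda>k. pi0 (F k)) k" "pi1 (D2 F k) = W4 (\<lambda>k. pi1 (F k)) k"
proof -
  have e: "ev 5 c s = s" "ev 5 c s' = s'" "ev 5 c p' = p'" for c
    by (simp_all add: defs ev_simps)
  have q: "ev 5 (Var 1) q5 = p" "ev 5 (Var 2) q5 = p"
    by (simp_all add: defs ev_simps mult.commute)
  define \<sigma> where "\<sigma> e = ev 5 (Var 1) e" for e
  have \<sigma>: "\<sigma> (u1 n s s' q5) = u1 n s s' p" "\<sigma> (s - s') = s - s'" "\<sigma> (u2 n s' q5 p') = u2 n s' p p'" "\<sigma> (q5 - p') = p - p'"
    by (simp_all add: \<sigma>_def ev_u ev_simps e q)
  have \<sigma>2: "ev 5 (Var 2) x = \<sigma> x" if "x \<in> {u1 n s s' q5, s - s', u2 n s' q5 p', q5 - p'}" for x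
    using that by (auto simp: \<sigma>_def ev_u ev_simps e q)
  have m: "pi0 (x * z) = \<sigma> x * pi0 z" "pi1 (x * z) = \<sigma> x * pi1 z"
    if "x \<in> {u1 n s s' q5, s - s', u2 n s' q5 p', q5 - p'}" for x z
    using pi_mult[of x "\<sigma> x" z] \<sigma>2[OF that] by (simp_all add: \<sigma>_def)
  show "pi0 (D2 F k) = W4 (\<lambda>k. pi0 (F k)) k"
    by (rule map_wide_op[where \<sigma> = \<sigma>]) (rule pi_linear m \<sigma>; assumption?)+
  show "pi1 (D2 F k) = W4 (\<lambda>k. pi1 (F k)) k"
    by (rule map_wide_op[where \<sigma> = \<sigma>]) (rule pi_linear m \<sigma>; assumption?)+
qed

text \<open>Inserting \<open>c6\<close> for \<open>x6\<close> is a ring homomorphism taking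
  \<open>t\<close> to \<open>s\<close> and \<open>q\<close> to \<open>q5\<close>; it carries what
  the first elimination leaves to the total operator of the second.\<close>

lemma rho1_D1: "\<rho>1 (D1 F ij) = S2.K (\<lambda>ij. \<rho>1 (F ij)) ij"
proof -
  have e: "ev 6 c6 t = s" "ev 6 c6 s' = s'" "ev 6 c6 p' = p'" "ev 6 c6 p = p" "ev 6 c6 q = q5"
    by (simp_all add: defs ev_simps)
  show ?thesis
    unfolding S2.K_def \<rho>1_def
  proof (intro map_tensor_op map_koszul_op)
    show "ev 6 c6 (wide_op n t q s' p' F j) = D2 (\<lambda>i. ev 6 c6 (F i)) j" for F j
      by (rule map_wide_op[where \<sigma> = "ev 6 c6"]) (simp_all add: ev_u ev_simps e)
  qed (simp_all add: ev_u ev_simps e)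
qed

definition asc :: "((bit \<times> bit) \<times> (bit \<times> bit) \<Rightarrow> rpoly) \<Rightarrow> bit \<times> bit \<times> bit \<times> bit \<Rightarrow> rpoly" where
  "asc F = (\<lambda>(i, j, k). F ((i, j), k))"
definition csa :: "(bit \<times> bit \<times> bit \<times> bit \<Rightarrow> rpoly) \<Rightarrow> (bit \<times> bit) \<times> (bit \<times> bit) \<Rightarrow> rpoly" where
  "csa F = (\<lambda>((i, j), k). F (i, j, k))"

lemma asc_csa [simp]: "asc (csa F) = F" "csa (asc G) = G"
  by (auto simp: asc_def csa_def)

text \<open>The coefficient of \<open>x5 - x1\<close>, an element of degree 2, goes to the left
  summand, which carries the shift \<open>{1}\<close>.\<close>

definition proj :: "(bit \<times> bit \<Rightarrow> rpoly) \<Rightarrow> (bit \<times> bit) + (bit \<times> bit) \<Rightarrow> rpoly" where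
  "proj F = case_sum (\<lambda>k. pi1 (F k)) (\<lambda>k. pi0 (F k))"
definition emb :: "((bit \<times> bit) + (bit \<times> bit) \<Rightarrow> rpoly) \<Rightarrow> bit \<times> bit \<Rightarrow> rpoly" where
  "emb H k = incl (H (Inr k)) (H (Inl k))"

definition DG :: "((bit \<times> bit) \<times> (bit \<times> bit) \<Rightarrow> rpoly) \<Rightarrow> (bit \<times> bit) \<times> (bit \<times> bit) \<Rightarrow> rpoly" where
  "DG = tensor_op wide_par (wide_op n s p t q) (wide_op n t q s' p')"
definition DW :: "((bit \<times> bit) + (bit \<times> bit) \<Rightarrow> rpoly) \<Rightarrow> (bit \<times> bit) + (bit \<times> bit) \<Rightarrow> rpoly" where
  "DW H = case_sum (W4 (\<lambda>k. H (Inl k))) (W4 (\<lambda>k. H (Inr k)))"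

lemma asc_DG: "asc (DG F) = S1.K (asc F)"
  unfolding asc_def DG_def S1.K_def wide_op_def[of n s p t q]
  by (rule ext, clarify) (simp only: tensor_op_assoc prod.case)

lemma DG_csa: "DG (csa A) = csa (S1.K A)"
  using asc_DG[of "csa A"] by (metis asc_csa)

lemma linop_K1: "linop S1.K"
  unfolding S1.K_def by (intro linop_tensor linop_koszul S1.lin)

definition ff where "ff F = proj (S2.f (S1.f (asc F)))"
definition gg where "gg H = csa (S1.g (S2.g (emb H)))"
definition h1 where "h1 F = S1.h (asc F)"
definition h2 where "h2 F = S1.g (S2.h (S1.f (asc F)))"
text \<open>The homotopy for a composite of two retractions: the first homotopy plus the second one
  transported by the first pair of maps.\<close>

definition hh where "hh F = csa (\<lambda>ij. h1 F ij + h2 F ij)"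

lemma rho1_V5: "F \<in> vals V5 \<Longrightarrow> \<rho>1 (F j) = F j"
  unfolding \<rho>1_def by (rule ev_id[of _ V5]) (auto simp: vals_def)

lemma S1_f_K: "S1.f (S1.K A) = S2.K (S1.f A)"
proof
  fix j
  have "(\<lambda>ij. \<rho>1 (S1.f A ij)) = S1.f A" by (simp add: fun_eq_iff S1.f_def S1.rho_rho)
  then show "S1.f (S1.K A) j = S2.K (S1.f A) j"
    using S1.f_K[of A j] rho1_D1[of "S1.f A" j] by simp
qed

text \<open>Families free of \<open>x6\<close> are their own remainders; on them the embedding of
  the first elimination respects the differentials.\<close>

lemma S1_g_K: "G \<in> vals V5 \<Longrightarrow> S1.g (S2.K G) = S1.K (S1.g G)"
proof
  fix ij assume G: "G \<in> vals V5"
  have "S2.K G = (\<lambda>j. \<rho>1 (D1 G j))"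
    using rho1_D1[of G] rho1_V5[OF G] by (simp add: fun_eq_iff)
  then show "S1.g (S2.K G) ij = S1.K (S1.g G) ij"
    using S1.g_D[of G ij] rho1_V5[OF G] by simp
qed

lemma proj_rho2: "proj (\<lambda>k. \<rho>2 (F k)) = proj F"
  by (simp add: proj_def pi_rho2)

lemma proj_D2: "proj (D2 F) = DW (proj F)"
  by (simp add: proj_def DW_def pi_D2[abs_def] cong: sum.case_cong)

lemma emb_proj: "emb (proj F) k = \<rho>2 (F k)"
  by (simp add: emb_def proj_def \<rho>2_def)

lemma proj_emb: "H \<in> vals V4 \<Longrightarrow> proj (emb H) = H"
  by (rule ext, rename_tac l, case_tac l) (simp_all add: proj_def emb_def pi_incl vals_def)

lemma rho2_emb: "H \<in> vals V4 \<Longrightarrow> \<rho>2 (emb H k) = emb H k"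
  using emb_proj[of "emb H" k] proj_emb[of H] by simp

lemma emb_vals: "H \<in> vals V4 \<Longrightarrow> emb H \<in> vals V5"
proof -
  assume "H \<in> vals V4"
  then have "H l \<in> P V5" for l by (auto simp: vals_def intro: P_mono[of V4])
  then show ?thesis by (simp add: vals_def emb_def incl_def)
qed

lemma ff_D: "ff (DG F) = DW (ff F)"
proof -
  have "S2.f (S2.K B) = (\<lambda>k. \<rho>2 (D2 (S2.f B) k))" for B
    by (simp add: fun_eq_iff S2.f_K)
  then show ?thesis
    by (simp add: ff_def asc_DG S1_f_K proj_rho2 proj_D2)
qed

lemma gg_D:
  assumes H: "H \<in> vals V4"
  shows "gg (DW H) = DG (gg H)"
proof -
  let ?z = "emb H"
  have e: "emb (DW H) = (\<lambda>k. \<rho>2 (D2 ?z k))"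
    using emb_proj[of "D2 ?z"] by (simp add: fun_eq_iff proj_D2 proj_emb[OF H])
  have "S2.g (emb (DW H)) = S2.K (S2.g ?z)"
    unfolding e by (rule ext, rule S2.g_D, rule rho2_emb[OF H])
  then have "gg (DW H) = csa (S1.g (S2.K (S2.g ?z)))" by (simp add: gg_def)
  also have "S1.g (S2.K (S2.g ?z)) = S1.K (S1.g (S2.g ?z))"
    by (rule S1_g_K) (rule model_homD(1)[OF S2.model_hom_g emb_vals[OF H]])
  finally show ?thesis by (simp add: gg_def DG_csa)
qed

lemma ff_gg:
  assumes H: "H \<in> vals V4"
  shows "ff (gg H) = H"
proof -
  have "S2.g (emb H) \<in> vals V5"
    by (rule model_homD(1)[OF S2.model_hom_g emb_vals[OF H]])
  then have "S1.f (S1.g (S2.g (emb H))) = S2.g (emb H)"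
    by (intro S1.f_g) (rule rho1_V5)
  moreover have "S2.f (S2.g (emb H)) = emb H"
    by (intro S2.f_g) (rule rho2_emb[OF H])
  ultimately show ?thesis
    by (simp add: ff_def gg_def proj_emb[OF H])
qed

lemma S1_g_add: "S1.g (\<lambda>i. F i + G i) ij = S1.g F ij + S1.g G ij"
  by (cases ij) (simp add: S1.g_def S1.D_add S1.plus)

text \<open>Write \<open>g1 g2 f2 f1 - 1\<close> as \<open>g1 (g2 f2 - 1) f1 + (g1 f1 - 1)\<close>
  and insert the two homotopies; \<open>g1\<close> passes through the differential because the
  values of the second homotopy are free of \<open>x6\<close>.\<close>

lemma hh_homotopy:
  assumes F: "F \<in> vals V6"
  shows "gg (ff F) i - F i = hh (DG F) i + DG (hh F) i"
proof -
  define A where "A = asc F"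
  define B where "B = S1.f A"
  have Av: "A \<in> vals V6" using F by (auto simp: A_def asc_def vals_def)
  have B: "B \<in> vals V5" unfolding B_def by (rule model_homD(1)[OF S1.model_hom_f Av])
  have h2v: "S2.h B \<in> vals V5" by (rule model_homD(1)[OF S2.model_hom_h B])
  have "emb (proj (S2.f B)) = S2.f B"
    by (simp add: fun_eq_iff emb_proj S2.f_def S2.rho_rho)
  then have g: "gg (ff F) = csa (S1.g (S2.g (S2.f B)))"
    by (simp add: gg_def ff_def A_def B_def)
  have "S2.g (S2.f B) = (\<lambda>i. B i + (S2.h (S2.K B) i + S2.K (S2.h B) i))"
  proof
    fix i show "S2.g (S2.f B) i = B i + (S2.h (S2.K B) i + S2.K (S2.h B) i)"
      using S2.homotopy[of B i] by (simp add: algebra_simps)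
  qed
  then have g2: "S1.g (S2.g (S2.f B)) ij = S1.g B ij + (S1.g (S2.h (S2.K B)) ij + S1.K (S1.g (S2.h B)) ij)" for ij
    by (simp add: S1_g_add S1_g_K[OF h2v])
  have g1: "S1.g B ij - A ij = S1.h (S1.K A) ij + S1.K (S1.h A) ij" for ij
    unfolding B_def by (rule S1.homotopy)
  have hD: "hh (DG F) = csa (\<lambda>ij. S1.h (S1.K A) ij + S1.g (S2.h (S2.K B)) ij)"
    by (simp add: hh_def h1_def h2_def asc_DG A_def B_def S1_f_K)
  have "DG (hh F) = csa (S1.K (\<lambda>ij. S1.h A ij + S1.g (S2.h B) ij))"
    by (simp add: hh_def h1_def h2_def DG_csa A_def B_def)
  also have "S1.K (\<lambda>ij. S1.h A ij + S1.g (S2.h B) ij) = (\<lambda>ij. S1.K (S1.h A) ij + S1.K (S1.g (S2.h B)) ij)"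
    by (simp add: fun_eq_iff linopD(1)[OF linop_K1])
  finally have Dh: "DG (hh F) = csa (\<lambda>ij. S1.K (S1.h A) ij + S1.K (S1.g (S2.h B)) ij)" .
  obtain a b k where i: "i = ((a, b), k)" by (metis surj_pair)
  have "F i = A (a, b, k)" by (simp add: A_def asc_def i)
  then show ?thesis
    unfolding g hD Dh using g1[of "(a, b, k)"] g2[of "(a, b, k)"] by (simp add: csa_def i algebra_simps)
qed

section \<open>Gradings and parities of the composite maps\<close>

abbreviation "parG \<equiv> \<lambda>ij :: (bit \<times> bit) \<times> (bit \<times> bit). wide_par (fst ij) + wide_par (snd ij)"
abbreviation "degG \<equiv> \<lambda>ij :: (bit \<times> bit) \<times> (bit \<times> bit). wide_deg n (fst ij) + wide_deg n (snd ij)"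
abbreviation "parW \<equiv> case_sum wide_par wide_par"
abbreviation "degW \<equiv> case_sum (\<lambda>k. wide_deg n k + 1) (\<lambda>k. wide_deg n k + - 1)"

text \<open>The row shared by both descriptions has its odd generator in degree
  \<open>3 - n\<close>, found once from \<open>deg u2 = 2n - 2\<close> and once from the degree 4 of
  the divisor.\<close>

lemma S2_kpar: "S2.kpar = par1" "S2.kdeg = deg1"
  by (auto simp: fun_eq_iff koszul_deg_def)

lemma model_hom_asc: "model_hom V4 V6 parG degG V6 S1.kpar S1.kdeg 0 0 asc"
proof -
  have e: "asc = (\<lambda>F x. F (case x of (i, j, k) \<Rightarrow> ((i, j), k)))"
    by (auto simp: asc_def fun_eq_iff)
  show ?thesis
    unfolding e
    by (rule model_hom_reindex) (simp_all add: wide_deg_def koszul_deg_def add.assoc split: prod.split)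
qed

lemma model_hom_csa: "model_hom V4 V6 S1.kpar S1.kdeg V6 parG degG 0 0 csa"
proof -
  have e: "csa = (\<lambda>F x. F (case x of ((i, j), k) \<Rightarrow> (i, j, k)))"
    by (auto simp: csa_def fun_eq_iff)
  show ?thesis
    unfolding e
    by (rule model_hom_reindex) (simp_all add: wide_deg_def koszul_deg_def add.assoc split: prod.split)
qed

lemma model_hom_proj: "model_hom V4 V5 wide_par deg2 V4 parW degW 0 0 proj"
  unfolding model_hom_def
proof (intro conjI ballI allI impI)
  fix F :: "bit \<times> bit \<Rightarrow> rpoly" and l
  assume F: "F \<in> vals V5"
  have i: "insert 5 V4 = V5" by auto
  have v: "pi0 (F k) \<in> P V4" "pi1 (F k) \<in> P V4" for k
  proof -
    have Fk: "F k \<in> P V5" using F unfolding vals_def by blast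
    then show "pi0 (F k) \<in> P V4"
      unfolding pi0_def by (rule ev_in_P) auto
    have "dq 5 (Var 1) (F k) \<in> P V5"
      using dq_props(2)[of "F k" 5 V4 "Var 1"] Fk unfolding i by simp
    then show "pi1 (F k) \<in> P V4"
      unfolding pi1_def by (rule ev_in_P) auto
  qed
  then show "proj F \<in> vals V4"
    by (auto simp: vals_def proj_def split: sum.split)
  show "proj (\<lambda>i. F i + G i) l = proj F l + proj G l" for G
    by (simp add: proj_def pi_linear split: sum.split)
  show "proj F l = 0" if "\<forall>i. wide_par i \<noteq> k \<longrightarrow> F i = 0" "parW l \<noteq> k + 0" for k
    using that by (cases l) (auto simp: proj_def pi_linear)
  show "homogeneous (d + 0 - degW l) (proj F l)" if d: "\<forall>i. homogeneous (d - deg2 i) (F i)" for d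
  proof (cases l)
    case (Inl k)
    have u: "insert (5 :: nat) (- {5}) = UNIV" by auto
    \<comment> \<open>The divided difference lowers the degree by 2; together with the surplus shift
      \<open>-1\<close> this produces the shift \<open>1\<close> of the left summand.\<close>
    have "homogeneous (d - deg2 k - 2) (dq 5 (Var 1) (F k))"
      using dq_props(3)[of "F k" 5 "- {5}" "Var 1", OF _ _ _ _ d[rule_format, of k]] x1' unfolding u by simp
    then have "homogeneous (d - deg2 k - 2) (pi1 (F k))"
      unfolding pi1_def by (rule homogeneous_ev[OF x2'(2)])
    then show ?thesis by (simp add: proj_def Inl algebra_simps)
  next
    case (Inr k)
    have "homogeneous (d - deg2 k) (pi0 (F k))"
      unfolding pi0_def by (rule homogeneous_ev[OF x1'(2) d[rule_format]])
    then show ?thesis by (simp add: proj_def Inr algebra_simps)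
  qed
next
  fix y l and F :: "bit \<times> bit \<Rightarrow> rpoly" assume "y \<in> P V4"
  then show "proj (\<lambda>i. y * F i) l = y * proj F l"
    by (simp add: proj_def pi0_def pi1_def scalars split: sum.split)
qed

lemma model_hom_emb: "model_hom V4 V4 parW degW V5 wide_par deg2 0 0 emb"
  unfolding model_hom_def
proof (intro conjI ballI allI impI)
  fix H :: "(bit \<times> bit) + (bit \<times> bit) \<Rightarrow> rpoly" and k
  assume H: "H \<in> vals V4"
  then show "emb H \<in> vals V5" by (rule emb_vals)
  show "emb (\<lambda>i. H i + G i) k = emb H k + emb G k" for G
    by (simp add: emb_def incl_def algebra_simps)
  show "emb H k = 0" if "\<forall>i. parW i \<noteq> l \<longrightarrow> H i = 0" "wide_par k \<noteq> l + 0" for l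
    using that(1)[rule_format, of "Inl k"] that(1)[rule_format, of "Inr k"] that(2) by (simp add: emb_def incl_def)
  show "homogeneous (d + 0 - deg2 k) (emb H k)" if d: "\<forall>i. homogeneous (d - degW i) (H i)" for d
  proof -
    have "homogeneous (d - deg2 k) ((Var 5 - Var 1) * H (Inl k))"
      using d[rule_format, of "Inl k"]
      by (intro homogeneous_mult'[OF homogeneous_diff[OF homogeneous_Var homogeneous_Var]]) (assumption, simp)
    moreover have "homogeneous (d - deg2 k) (H (Inr k))"
      using d[rule_format, of "Inr k"] by simp
    ultimately show ?thesis by (simp add: emb_def incl_def homogeneous_add)
  qed
qed (simp add: emb_def incl_def algebra_simps)

lemma model_hom_ff: "model_hom V4 V6 parG degG V4 parW degW 0 0 ff"
proof -
  note 1 = model_hom_comp[OF model_hom_asc S1.model_hom_f, folded S2_kpar]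
  note 2 = model_hom_comp[OF model_hom_comp[OF 1 S2.model_hom_f] model_hom_proj]
  show ?thesis using 2 by (simp add: ff_def[abs_def])
qed

lemma model_hom_gg: "model_hom V4 V4 parW degW V6 parG degG 0 0 gg"
proof -
  note 1 = model_hom_comp[OF model_hom_emb S2.model_hom_g, unfolded S2_kpar]
  note 2 = model_hom_comp[OF model_hom_comp[OF 1 S1.model_hom_g] model_hom_csa]
  show ?thesis using 2 by (simp add: gg_def[abs_def])
qed

lemma model_hom_hh: "model_hom V4 V6 parG degG V6 parG degG 1 (- int n - 1) hh"
proof -
  have 1: "model_hom V4 V6 parG degG V6 S1.kpar S1.kdeg 1 (- int n - 1) h1"
    using model_hom_comp[OF model_hom_asc S1.model_hom_h] by (simp add: h1_def[abs_def])
  note a = model_hom_comp[OF model_hom_asc S1.model_hom_f, folded S2_kpar]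
  note b = model_hom_comp[OF a S2.model_hom_h, unfolded S2_kpar]
  have 2: "model_hom V4 V6 parG degG V6 S1.kpar S1.kdeg 1 (- int n - 1) h2"
    using model_hom_comp[OF b S1.model_hom_g] by (simp add: h2_def[abs_def])
  show ?thesis
    using model_hom_comp[OF model_hom_add[OF 1 2] model_hom_csa] by (simp add: hh_def[abs_def])
qed

lemma DG_square: "DG (DG F) i = w * F i"
proof -
  have "DG (DG F) = csa (S1.K (S1.K (asc F)))"
    by (metis DG_csa asc_csa(2))
  moreover have "S1.K (S1.K A) ij = w * A ij" for A ij
  proof -
    have cancel: "y + (z - y) = z" for y z :: rpoly by simp
    have "S1.K (S1.K A) ij = (u1 n s t p * (s - t) + (w - u1 n s t p * (s - t))) * A ij"
      unfolding S1.K_def by (rule tensor_op_koszul_square) (rule S1.lin S1.DD)+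
    then show ?thesis by (simp only: cancel)
  qed
  ultimately show ?thesis
    by (cases i) (auto simp: csa_def asc_def)
qed

lemma DW_square: "DW (DW H) l = w * H l"
  by (cases l) (simp_all add: DW_def wide_op_square w_def)

theorem isomorphic:
  assumes n: "n \<ge> 1"
  shows "hmf_isomorphic n {1, 2, 3, 4} w
    (tensor_fact {1, 2, 5, 6} {5, 6, 3, 4} (wide_edge n 1 2 5 6) (wide_edge n 5 6 3 4))
    (sum_fact (shift_fact 1 (wide_edge n 1 2 3 4)) (shift_fact (- 1) (wide_edge n 1 2 3 4)))"
proof -
  obtain \<phi>1 where 1: "fact_coords n {1, 2, 5, 6} wide_par (wide_deg n) (wide_op n s p t q) \<phi>1 (wide_edge n 1 2 5 6)"
    using fact_coords_wide_edge[OF n, of 1 2 5 6] by (auto simp: defs)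
  obtain \<phi>2 where 2: "fact_coords n {5, 6, 3, 4} wide_par (wide_deg n) (wide_op n t q s' p') \<phi>2 (wide_edge n 5 6 3 4)"
    using fact_coords_wide_edge[OF n, of 5 6 3 4] by (auto simp: defs)
  obtain \<phi>3 where 3: "fact_coords n V4 wide_par (wide_deg n) W4 \<phi>3 (wide_edge n 1 2 3 4)"
    using fact_coords_wide_edge[OF n, of 1 2 3 4] by (auto simp: defs)
  have V: "{1, 2, 5, 6} \<union> {5, 6, 3, 4} = V6" by auto
  have X: "fact_coords n V6 parG degG DG (tensor_fact_coord \<phi>1 \<phi>2)
      (tensor_fact {1, 2, 5, 6} {5, 6, 3, 4} (wide_edge n 1 2 5 6) (wide_edge n 5 6 3 4))"
    using fact_coords_tensor[OF 1 2] unfolding V DG_def .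
  have DW: "(\<lambda>F. case_sum (W4 (\<lambda>i. F (Inl i))) (W4 (\<lambda>j. F (Inr j)))) = DW"
    by (simp add: fun_eq_iff DW_def)
  note Y = fact_coords_sum[OF fact_coords_shift[OF 3, of 1] fact_coords_shift[OF 3, of "- 1"], unfolded DW]
  show ?thesis
    by (rule hmf_isomorphic_models[OF X Y _ _ wP DG_square DW_square model_hom_ff model_hom_gg model_hom_hh
          ff_D gg_D ff_gg hh_homotopy]) auto
qed

end

theorem proposition30:
  fixes n :: nat
  assumes "n \<ge> 1"
  shows "hmf_isomorphic n {1, 2, 3, 4}
           (Var 1 ^ (n + 1) + Var 2 ^ (n + 1) - Var 3 ^ (n + 1) - Var 4 ^ (n + 1))
           (tensor_fact {1, 2, 5, 6} {5, 6, 3, 4} (wide_edge n 1 2 5 6) (wide_edge n 5 6 3 4))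
           (sum_fact (shift_fact 1 (wide_edge n 1 2 3 4)) (shift_fact (- 1) (wide_edge n 1 2 3 4)))"
proof -
  \<comment> \<open>The potential was expressed by sums and products of the marks;
    \<open>psum_power\<close> turns it back into powers of the variables.\<close>
  have "digon.w n = Var 1 ^ (n + 1) + Var 2 ^ (n + 1) - Var 3 ^ (n + 1) - Var 4 ^ (n + 1)"
    unfolding digon.w_def potential_def digon.s_def digon.p_def digon.s'_def digon.p'_def psum_power
    by (rule diff_diff_eq[symmetric])
  then show ?thesis
    using digon.isomorphic[OF assms] by simp
qed

end
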